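(* Let $p$ be an odd prime. A representation group of $G = \mathbb{H}_{3}\big(\mathbb{F}_p[t]/(t^2)\big)$ is given by $$\begin{aligned}G^\star=\langle\, x_i,y_i,\ i=1,2 \mid\ & [y_1,x_1]=z_1,\ [y_1,x_2]=z_2,\ [x_2,x_1]=w_1,\ [y_2,x_1]z_2^{-1}=w_2,\\ & [y_2,x_2]=w_3,\ [y_2,y_1]=w_4,\ [z_1, x_i]=v_i,\ [z_1, y_i]=u_i,\ [z_2,x_1]=[z_1, x_2],\\ & [z_2,y_1]=[z_1, y_2],\ x_i^p=y_i^p=z_i^p=w_j^p=1,\ 1\le i\le 2,\ 1 \leq j \leq 4\, \rangle.\end{aligned}$$
   Context: $\mathbb{H}_3(R)$ is the group of upper unitriangular $3\times 3$ matrices over the commutative ring $R$. $[x,y]=x^{-1}y^{-1}xy$. Convention for presentations: all commutators between pairs of the named elements ($x_i,y_i,z_i,w_j,u_i,v_i$) which are not explicitly stated in the presentation are trivial (so in particular all $w_j,u_i,v_i$ are central, $[z_2,x_2]=[z_2,y_2]=1$ and $[z_1,z_2]=1$). A representation group of a finite group $G$ is a finite group $G^\star$ having a subgroup $A\subseteq Z(G^\star)\cap [G^\star,G^\star]$ with $A\cong \mathrm{H}^2(G,\mathbb{C}^\times)$ (trivial action) and $G^\star/A\cong G$. *)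

theory Defs
  imports
    "HOL-Algebra.Algebra"
    "HOL-Number_Theory.Residues"
    "Jordan_Normal_Form.Matrix"
begin

section \<open>Free groups and presentations\<close>

text \<open>A letter \<open>(a, True)\<close> stands for \<open>a\<close> and \<open>(a, False)\<close> for its formal inverse.
  The elements of the free group are the freely reduced words.\<close>

type_synonym 'a word = "('a \<times> bool) list"

definition inv_letter :: "'a \<times> bool \<Rightarrow> 'a \<times> bool" where
  "inv_letter l = (fst l, \<not> snd l)"

fun push :: "'a \<times> bool \<Rightarrow> 'a word \<Rightarrow> 'a word" where
  "push l [] = [l]"
| "push l (k # ks) = (if k = inv_letter l then ks else l # k # ks)"

definition free_reduce :: "'a word \<Rightarrow> 'a word" where
  "free_reduce w = foldr push w []"

fun reduced :: "'a word \<Rightarrow> bool" where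
  "reduced (l # k # ks) \<longleftrightarrow> k \<noteq> inv_letter l \<and> reduced (k # ks)"
| "reduced _ \<longleftrightarrow> True"

definition free_group :: "'a set \<Rightarrow> 'a word monoid" where
  "free_group S =
     \<lparr>carrier = {w. reduced w \<and> fst ` set w \<subseteq> S},
      monoid.mult = (\<lambda>u v. free_reduce (u @ v)),
      one = []\<rparr>"

definition free_gen :: "'a \<Rightarrow> 'a word" where
  "free_gen a = [(a, True)]"

definition normal_closure :: "('a, 'b) monoid_scheme \<Rightarrow> 'a set \<Rightarrow> 'a set" where
  "normal_closure G S = (\<lambda>N. N \<lhd> G) hull S"

text \<open>Relations are pairs of elements of the free group, \<open>(l, r)\<close> standing for \<open>l = r\<close>.\<close>

definition presented_group ::
    "'a set \<Rightarrow> ('a word \<times> 'a word) set \<Rightarrow> 'a word set monoid" where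
  "presented_group S E =
     free_group S Mod
       normal_closure (free_group S)
         {l \<otimes>\<^bsub>free_group S\<^esub> inv\<^bsub>free_group S\<^esub> r | l r. (l, r) \<in> E}"

definition commutator :: "('a, 'b) monoid_scheme \<Rightarrow> 'a \<Rightarrow> 'a \<Rightarrow> 'a" where
  "commutator G a b = inv\<^bsub>G\<^esub> a \<otimes>\<^bsub>G\<^esub> inv\<^bsub>G\<^esub> b \<otimes>\<^bsub>G\<^esub> a \<otimes>\<^bsub>G\<^esub> b"


lemma inv_letter_inv_letter [simp]: "inv_letter (inv_letter l) = l"
  by (simp add: inv_letter_def)

lemma inv_letter_neq [simp]: "inv_letter l \<noteq> l" "l \<noteq> inv_letter l"
  by (auto simp: inv_letter_def prod_eq_iff)

lemma reduced_ConsD: "reduced (l # w) \<Longrightarrow> reduced w"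
  by (cases w) auto

lemma reduced_push: "reduced w \<Longrightarrow> reduced (push l w)"
  by (cases w) (auto dest: reduced_ConsD)

lemma push_inv_letter: "reduced w \<Longrightarrow> push l (push (inv_letter l) w) = w"
proof (cases w)
  case (Cons k ks)
  assume "reduced w"
  then show ?thesis using Cons by (cases ks) auto
qed auto

lemma reduced_foldr_push: "reduced w \<Longrightarrow> reduced (foldr push u w)"
  by (induction u) (auto intro: reduced_push)

lemma free_reduce_reduced: "reduced w \<Longrightarrow> free_reduce w = w"
proof (induction w)
  case (Cons l w)
  then show ?case by (cases w) (auto simp: free_reduce_def)
qed (simp add: free_reduce_def)

lemma foldr_push_push:
  assumes "reduced w"
  shows "foldr push (push l u) w = push l (foldr push u w)"
proof (cases u)
  case (Cons k ks)
  show ?thesis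
    using push_inv_letter[of "foldr push ks w" l] assms
    by (auto simp: Cons reduced_foldr_push)
qed simp

lemma foldr_push_free_reduce:
  "reduced w \<Longrightarrow> foldr push (free_reduce u) w = foldr push u w"
  unfolding free_reduce_def by (induction u) (auto simp: foldr_push_push)

lemma free_reduce_append_left: "free_reduce (free_reduce u @ v) = free_reduce (u @ v)"
proof -
  have "reduced (foldr push v [])" by (rule reduced_foldr_push) simp
  then show ?thesis
    using foldr_push_free_reduce[of "foldr push v []" u] by (simp add: free_reduce_def)
qed

lemma free_reduce_append_right: "free_reduce (u @ free_reduce v) = free_reduce (u @ v)"
proof -
  have "reduced (free_reduce v)"
    unfolding free_reduce_def by (rule reduced_foldr_push) simp
  then show ?thesis
    using free_reduce_reduced by (metis foldr_append free_reduce_def)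
qed

lemma set_push: "set (push l w) \<subseteq> insert l (set w)"
  by (cases w) auto

lemma set_free_reduce: "set (free_reduce w) \<subseteq> set w"
  unfolding free_reduce_def
proof (induction w)
  case (Cons l w)
  then show ?case using set_push[of l "foldr push w []"] by auto
qed simp

lemma foldr_push_inverse:
  "reduced w \<Longrightarrow> foldr push (map inv_letter (rev u)) (foldr push u w) = w"
proof (induction u arbitrary: w)
  case (Cons l u)
  then show ?case
    using push_inv_letter[of "foldr push u w" "inv_letter l"]
    by (simp add: reduced_foldr_push)
qed simp

lemma group_free_group: "group (free_group S)"
proof (rule groupI)
  fix u v
  assume u: "u \<in> carrier (free_group S)" and v: "v \<in> carrier (free_group S)"
  have "fst ` set (free_reduce (u @ v)) \<subseteq> fst ` set (u @ v)"
    by (intro image_mono set_free_reduce)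
  also have "\<dots> \<subseteq> S" using u v by (auto simp: free_group_def)
  finally show "u \<otimes>\<^bsub>free_group S\<^esub> v \<in> carrier (free_group S)"
    by (simp add: free_group_def) (simp add: free_reduce_def reduced_foldr_push)
next
  fix u assume u: "u \<in> carrier (free_group S)"
  let ?i = "map inv_letter (rev u)"
  have "fst ` set (free_reduce ?i) \<subseteq> fst ` set ?i"
    by (intro image_mono set_free_reduce)
  also have "fst ` set ?i = fst ` set u" by (force simp: inv_letter_def)
  also have "\<dots> \<subseteq> S" using u by (auto simp: free_group_def)
  finally have 1: "free_reduce ?i \<in> carrier (free_group S)"
    by (simp add: free_group_def) (simp add: free_reduce_def reduced_foldr_push)
  have 2: "free_reduce ?i \<otimes>\<^bsub>free_group S\<^esub> u = \<one>\<^bsub>free_group S\<^esub>"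
    using foldr_push_inverse[of "[]" u]
    by (simp add: free_group_def free_reduce_append_left) (simp add: free_reduce_def)
  from 1 2 show "\<exists>v\<in>carrier (free_group S). v \<otimes>\<^bsub>free_group S\<^esub> u = \<one>\<^bsub>free_group S\<^esub>"
    by blast
qed (auto simp: free_group_def free_reduce_append_left free_reduce_append_right
      free_reduce_reduced)

lemma normal_normal_closure:
  assumes "group G" "S \<subseteq> carrier G"
  shows "normal_closure G S \<lhd> G"
proof -
  interpret group G by fact
  let ?M = "{N. N \<lhd> G \<and> S \<subseteq> N}"
  have ne: "carrier G \<in> ?M"
    using assms(2) normal_inv_iff subgroup_self by auto
  have "subgroup (\<Inter>?M) G"
    by (rule subgroups_Inter) (use ne in \<open>auto simp: normal_def\<close>)
  moreover have "g \<otimes>\<^bsub>G\<^esub> h \<otimes>\<^bsub>G\<^esub> inv\<^bsub>G\<^esub> g \<in> \<Inter>?M" if "g \<in> carrier G" "h \<in> \<Inter>?M" for g h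
    using that by (auto simp: normal_inv_iff)
  ultimately show ?thesis
    unfolding normal_closure_def hull_def by (auto simp: normal_inv_iff)
qed

lemma group_presented_group:
  assumes "\<And>l r. (l, r) \<in> E \<Longrightarrow> l \<in> carrier (free_group S) \<and> r \<in> carrier (free_group S)"
  shows "group (presented_group S E)"
proof -
  interpret group "free_group S" by (rule group_free_group)
  show ?thesis
    unfolding presented_group_def
    by (intro normal.factorgroup_is_group normal_normal_closure group_axioms) (use assms in auto)
qed


section \<open>Unitriangular matrices over a ring\<close>

definition mat_mult_over :: "('a, 'b) ring_scheme \<Rightarrow> nat \<Rightarrow> 'a mat \<Rightarrow> 'a mat \<Rightarrow> 'a mat" where
  "mat_mult_over R n A B =
     mat n n (\<lambda>(i, j). finsum R (\<lambda>k. A $$ (i, k) \<otimes>\<^bsub>R\<^esub> B $$ (k, j)) {0..<n})"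

definition unitriangular_group :: "nat \<Rightarrow> ('a, 'b) ring_scheme \<Rightarrow> 'a mat monoid" where
  "unitriangular_group n R =
     \<lparr>carrier = {A \<in> carrier_mat n n. \<forall>i<n. \<forall>j<n.
         A $$ (i, j) \<in> carrier R \<and>
         (i = j \<longrightarrow> A $$ (i, j) = \<one>\<^bsub>R\<^esub>) \<and>
         (j < i \<longrightarrow> A $$ (i, j) = \<zero>\<^bsub>R\<^esub>)},
      monoid.mult = mat_mult_over R n,
      one = mat n n (\<lambda>(i, j). if i = j then \<one>\<^bsub>R\<^esub> else \<zero>\<^bsub>R\<^esub>)\<rparr>"

definition heisenberg_group :: "('a, 'b) ring_scheme \<Rightarrow> 'a mat monoid" where
  "heisenberg_group R = unitriangular_group 3 R"

text \<open>The ring \<open>K[t]/(t\<^sup>2)\<close>.\<close>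

definition dual_numbers :: "('a, 'b) ring_scheme \<Rightarrow> 'a list set ring" where
  "dual_numbers K =
     (let P = univ_poly K (carrier K) in P Quot (PIdl\<^bsub>P\<^esub> (var K [^]\<^bsub>P\<^esub> (2::nat))))"


section \<open>Second cohomology and representation groups\<close>

text \<open>Cohomology is taken with trivial action on the (multiplicatively written) abelian
  group \<open>A\<close>, by means of inhomogeneous cochains.\<close>

definition two_cocycles ::
    "('g, 'b) monoid_scheme \<Rightarrow> ('a, 'c) monoid_scheme \<Rightarrow> ('g \<times> 'g \<Rightarrow> 'a) monoid" where
  "two_cocycles G A =
     \<lparr>carrier = {f \<in> carrier G \<times> carrier G \<rightarrow>\<^sub>E carrier A.
         \<forall>g\<in>carrier G. \<forall>h\<in>carrier G. \<forall>k\<in>carrier G.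
           f (g, h) \<otimes>\<^bsub>A\<^esub> f (g \<otimes>\<^bsub>G\<^esub> h, k) = f (h, k) \<otimes>\<^bsub>A\<^esub> f (g, h \<otimes>\<^bsub>G\<^esub> k)},
      monoid.mult = (\<lambda>f f'. \<lambda>x\<in>carrier G \<times> carrier G. f x \<otimes>\<^bsub>A\<^esub> f' x),
      one = (\<lambda>x\<in>carrier G \<times> carrier G. \<one>\<^bsub>A\<^esub>)\<rparr>"

definition two_coboundaries ::
    "('g, 'b) monoid_scheme \<Rightarrow> ('a, 'c) monoid_scheme \<Rightarrow> ('g \<times> 'g \<Rightarrow> 'a) set" where
  "two_coboundaries G A =
     {(\<lambda>(g, h)\<in>carrier G \<times> carrier G. c g \<otimes>\<^bsub>A\<^esub> c h \<otimes>\<^bsub>A\<^esub> inv\<^bsub>A\<^esub> c (g \<otimes>\<^bsub>G\<^esub> h))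
       | c. c \<in> carrier G \<rightarrow> carrier A}"

definition H2 ::
    "('g, 'b) monoid_scheme \<Rightarrow> ('a, 'c) monoid_scheme \<Rightarrow> ('g \<times> 'g \<Rightarrow> 'a) set monoid" where
  "H2 G A = two_cocycles G A Mod two_coboundaries G A"

definition complex_units :: "complex monoid" where
  "complex_units = \<lparr>carrier = UNIV - {0}, monoid.mult = (*), one = 1\<rparr>"

definition group_center :: "('a, 'b) monoid_scheme \<Rightarrow> 'a set" where
  "group_center G = {z \<in> carrier G. \<forall>g\<in>carrier G. z \<otimes>\<^bsub>G\<^esub> g = g \<otimes>\<^bsub>G\<^esub> z}"

definition is_representation_group ::
    "('h, 'b) monoid_scheme \<Rightarrow> ('g, 'c) monoid_scheme \<Rightarrow> bool" where
  "is_representation_group E G \<longleftrightarrow>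
     group G \<and> finite (carrier G) \<and> group E \<and> finite (carrier E) \<and>
     (\<exists>A. subgroup A E \<and> A \<subseteq> group_center E \<inter> derived E (carrier E) \<and>
          E\<lparr>carrier := A\<rparr> \<cong> H2 G complex_units \<and> E Mod A \<cong> G)"

lemma comm_group_complex_units: "comm_group complex_units"
proof (rule comm_groupI)
  fix x assume "x \<in> carrier complex_units"
  then show "\<exists>y\<in>carrier complex_units. y \<otimes>\<^bsub>complex_units\<^esub> x = \<one>\<^bsub>complex_units\<^esub>"
    by (intro bexI[of _ "inverse x"]) (auto simp: complex_units_def)
qed (auto simp: complex_units_def)

lemma comm_group_two_cocycles:
  assumes "group G" "comm_group A"
  shows "comm_group (two_cocycles G A)"
proof -
  interpret G: group G by fact
  interpret A: comm_group A by fact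
  show ?thesis
  proof (rule comm_groupI)
    fix f f' assume f: "f \<in> carrier (two_cocycles G A)" and f': "f' \<in> carrier (two_cocycles G A)"
    {
      fix g h k assume m: "g \<in> carrier G" "h \<in> carrier G" "k \<in> carrier G"
      have c: "f (g, h) \<otimes>\<^bsub>A\<^esub> f (g \<otimes>\<^bsub>G\<^esub> h, k) = f (h, k) \<otimes>\<^bsub>A\<^esub> f (g, h \<otimes>\<^bsub>G\<^esub> k)"
             "f' (g, h) \<otimes>\<^bsub>A\<^esub> f' (g \<otimes>\<^bsub>G\<^esub> h, k) = f' (h, k) \<otimes>\<^bsub>A\<^esub> f' (g, h \<otimes>\<^bsub>G\<^esub> k)"
        using f f' m by (auto simp: two_cocycles_def)
      have cl: "f (a, b) \<in> carrier A" "f' (a, b) \<in> carrier A"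
        if "a \<in> carrier G" "b \<in> carrier G" for a b
        using f f' that by (auto simp: two_cocycles_def PiE_iff)
      have "(f (g, h) \<otimes>\<^bsub>A\<^esub> f' (g, h)) \<otimes>\<^bsub>A\<^esub> (f (g \<otimes>\<^bsub>G\<^esub> h, k) \<otimes>\<^bsub>A\<^esub> f' (g \<otimes>\<^bsub>G\<^esub> h, k)) =
            (f (g, h) \<otimes>\<^bsub>A\<^esub> f (g \<otimes>\<^bsub>G\<^esub> h, k)) \<otimes>\<^bsub>A\<^esub> (f' (g, h) \<otimes>\<^bsub>A\<^esub> f' (g \<otimes>\<^bsub>G\<^esub> h, k))"
        using m by (simp add: cl A.m_ac)
      also have "\<dots> = (f (h, k) \<otimes>\<^bsub>A\<^esub> f' (h, k)) \<otimes>\<^bsub>A\<^esub> (f (g, h \<otimes>\<^bsub>G\<^esub> k) \<otimes>\<^bsub>A\<^esub> f' (g, h \<otimes>\<^bsub>G\<^esub> k))"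
        unfolding c using m by (simp add: cl A.m_ac)
      finally have "(f (g, h) \<otimes>\<^bsub>A\<^esub> f' (g, h)) \<otimes>\<^bsub>A\<^esub> (f (g \<otimes>\<^bsub>G\<^esub> h, k) \<otimes>\<^bsub>A\<^esub> f' (g \<otimes>\<^bsub>G\<^esub> h, k)) =
        (f (h, k) \<otimes>\<^bsub>A\<^esub> f' (h, k)) \<otimes>\<^bsub>A\<^esub> (f (g, h \<otimes>\<^bsub>G\<^esub> k) \<otimes>\<^bsub>A\<^esub> f' (g, h \<otimes>\<^bsub>G\<^esub> k))" .
    }
    then show "f \<otimes>\<^bsub>two_cocycles G A\<^esub> f' \<in> carrier (two_cocycles G A)"
      using f f' by (auto simp: two_cocycles_def PiE_iff)
  next
    fix f assume f: "f \<in> carrier (two_cocycles G A)"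
    let ?i = "\<lambda>x\<in>carrier G \<times> carrier G. inv\<^bsub>A\<^esub> f x"
    have cl: "f (a, b) \<in> carrier A" if "a \<in> carrier G" "b \<in> carrier G" for a b
      using f that by (auto simp: two_cocycles_def PiE_iff)
    have "?i \<in> carrier (two_cocycles G A)"
      using f by (auto simp: two_cocycles_def PiE_iff cl A.inv_mult[symmetric])
    moreover have "?i \<otimes>\<^bsub>two_cocycles G A\<^esub> f = \<one>\<^bsub>two_cocycles G A\<^esub>"
      by (auto simp: two_cocycles_def cl fun_eq_iff restrict_def)
    ultimately show "\<exists>f'\<in>carrier (two_cocycles G A).
        f' \<otimes>\<^bsub>two_cocycles G A\<^esub> f = \<one>\<^bsub>two_cocycles G A\<^esub>" by blast
  qed (auto simp: two_cocycles_def PiE_iff fun_eq_iff A.m_ac extensional_def restrict_def)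
qed

lemma subgroup_two_coboundaries:
  assumes "group G" "comm_group A"
  shows "subgroup (two_coboundaries G A) (two_cocycles G A)"
proof -
  interpret G: group G by fact
  interpret A: comm_group A by fact
  interpret Z: comm_group "two_cocycles G A"
    using assms by (rule comm_group_two_cocycles)
  define d where "d c = (\<lambda>(g, h)\<in>carrier G \<times> carrier G.
    c g \<otimes>\<^bsub>A\<^esub> c h \<otimes>\<^bsub>A\<^esub> inv\<^bsub>A\<^esub> c (g \<otimes>\<^bsub>G\<^esub> h))" for c
  have B: "two_coboundaries G A = d ` (carrier G \<rightarrow> carrier A)"
    by (auto simp: two_coboundaries_def d_def)
  have dZ: "d c \<in> carrier (two_cocycles G A)" if c: "c \<in> carrier G \<rightarrow> carrier A" for c
  proof -
    {
      fix g h k assume m: "g \<in> carrier G" "h \<in> carrier G" "k \<in> carrier G"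
      have cl: "c a \<in> carrier A" if "a \<in> carrier G" for a using c that by auto
      have canc: "x \<otimes>\<^bsub>A\<^esub> (inv\<^bsub>A\<^esub> x \<otimes>\<^bsub>A\<^esub> y) = y" if "x \<in> carrier A" "y \<in> carrier A" for x y
        using that by (simp add: A.m_assoc[symmetric])
      have "(c g \<otimes>\<^bsub>A\<^esub> c h \<otimes>\<^bsub>A\<^esub> inv\<^bsub>A\<^esub> c (g \<otimes>\<^bsub>G\<^esub> h)) \<otimes>\<^bsub>A\<^esub>
          (c (g \<otimes>\<^bsub>G\<^esub> h) \<otimes>\<^bsub>A\<^esub> c k \<otimes>\<^bsub>A\<^esub> inv\<^bsub>A\<^esub> c (g \<otimes>\<^bsub>G\<^esub> h \<otimes>\<^bsub>G\<^esub> k)) =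
          c (g \<otimes>\<^bsub>G\<^esub> h) \<otimes>\<^bsub>A\<^esub> (inv\<^bsub>A\<^esub> c (g \<otimes>\<^bsub>G\<^esub> h) \<otimes>\<^bsub>A\<^esub>
            (c g \<otimes>\<^bsub>A\<^esub> c h \<otimes>\<^bsub>A\<^esub> c k \<otimes>\<^bsub>A\<^esub> inv\<^bsub>A\<^esub> c (g \<otimes>\<^bsub>G\<^esub> h \<otimes>\<^bsub>G\<^esub> k)))"
        using m by (simp add: cl A.m_ac)
      also have "\<dots> = c (h \<otimes>\<^bsub>G\<^esub> k) \<otimes>\<^bsub>A\<^esub> (inv\<^bsub>A\<^esub> c (h \<otimes>\<^bsub>G\<^esub> k) \<otimes>\<^bsub>A\<^esub>
            (c g \<otimes>\<^bsub>A\<^esub> c h \<otimes>\<^bsub>A\<^esub> c k \<otimes>\<^bsub>A\<^esub> inv\<^bsub>A\<^esub> c (g \<otimes>\<^bsub>G\<^esub> h \<otimes>\<^bsub>G\<^esub> k)))"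
        using m by (simp add: cl canc)
      also have "\<dots> = (c h \<otimes>\<^bsub>A\<^esub> c k \<otimes>\<^bsub>A\<^esub> inv\<^bsub>A\<^esub> c (h \<otimes>\<^bsub>G\<^esub> k)) \<otimes>\<^bsub>A\<^esub>
          (c g \<otimes>\<^bsub>A\<^esub> c (h \<otimes>\<^bsub>G\<^esub> k) \<otimes>\<^bsub>A\<^esub> inv\<^bsub>A\<^esub> c (g \<otimes>\<^bsub>G\<^esub> (h \<otimes>\<^bsub>G\<^esub> k)))"
        using m by (simp add: cl A.m_ac G.m_assoc)
      finally have "d c (g, h) \<otimes>\<^bsub>A\<^esub> d c (g \<otimes>\<^bsub>G\<^esub> h, k) = d c (h, k) \<otimes>\<^bsub>A\<^esub> d c (g, h \<otimes>\<^bsub>G\<^esub> k)"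
        using m by (simp add: d_def)
    }
    moreover have "d c \<in> carrier G \<times> carrier G \<rightarrow>\<^sub>E carrier A"
      using c by (auto simp: d_def PiE_iff Pi_iff)
    ultimately show ?thesis by (auto simp: two_cocycles_def)
  qed
  have mult: "d c \<otimes>\<^bsub>two_cocycles G A\<^esub> d c' = d (\<lambda>g. c g \<otimes>\<^bsub>A\<^esub> c' g)"
    if "c \<in> carrier G \<rightarrow> carrier A" "c' \<in> carrier G \<rightarrow> carrier A" for c c'
  proof -
    have "c a \<in> carrier A \<and> c' a \<in> carrier A" if "a \<in> carrier G" for a
      using that \<open>c \<in> _\<close> \<open>c' \<in> _\<close> by auto
    then show ?thesis
      by (auto simp: two_cocycles_def d_def fun_eq_iff restrict_def A.inv_mult A.m_ac)
  qed
  have one: "d (\<lambda>_. \<one>\<^bsub>A\<^esub>) = \<one>\<^bsub>two_cocycles G A\<^esub>"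
    by (auto simp: two_cocycles_def d_def fun_eq_iff restrict_def)
  show ?thesis
  proof (rule Z.subgroupI)
    show "two_coboundaries G A \<subseteq> carrier (two_cocycles G A)"
      using dZ by (auto simp: B)
    show "two_coboundaries G A \<noteq> {}" by (auto simp: B intro!: exI[of _ "\<lambda>_. \<one>\<^bsub>A\<^esub>"])
  next
    fix f assume "f \<in> two_coboundaries G A"
    then obtain c where c: "c \<in> carrier G \<rightarrow> carrier A" and f: "f = d c" by (auto simp: B)
    let ?c = "\<lambda>g. inv\<^bsub>A\<^esub> c g"
    have c': "?c \<in> carrier G \<rightarrow> carrier A" using c by auto
    have "d ?c \<otimes>\<^bsub>two_cocycles G A\<^esub> d c = d (\<lambda>g. inv\<^bsub>A\<^esub> c g \<otimes>\<^bsub>A\<^esub> c g)"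
      by (rule mult[OF c' c])
    also have "\<dots> = d (\<lambda>_. \<one>\<^bsub>A\<^esub>)"
    proof -
      have "inv\<^bsub>A\<^esub> c g \<otimes>\<^bsub>A\<^esub> c g = \<one>\<^bsub>A\<^esub>" if "g \<in> carrier G" for g
        using c that by (auto simp: Pi_iff)
      then show ?thesis by (auto simp: d_def fun_eq_iff restrict_def)
    qed
    finally have "inv\<^bsub>two_cocycles G A\<^esub> f = d ?c"
      using Z.inv_equality dZ[OF c] dZ[OF c'] by (simp add: one f)
    then show "inv\<^bsub>two_cocycles G A\<^esub> f \<in> two_coboundaries G A" using c' by (auto simp: B)
  next
    fix f f' assume "f \<in> two_coboundaries G A" "f' \<in> two_coboundaries G A"
    then obtain c c' where c: "c \<in> carrier G \<rightarrow> carrier A" "c' \<in> carrier G \<rightarrow> carrier A"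
      and f: "f = d c" "f' = d c'" by (auto simp: B)
    have "(\<lambda>g. c g \<otimes>\<^bsub>A\<^esub> c' g) \<in> carrier G \<rightarrow> carrier A" using c by auto
    then show "f \<otimes>\<^bsub>two_cocycles G A\<^esub> f' \<in> two_coboundaries G A"
      using mult[OF c] by (auto simp: B f)
  qed
qed


section \<open>The presentation\<close>

datatype gen = Gx nat | Gy nat

definition gens :: "gen set" where
  "gens = {Gx 1, Gx 2, Gy 1, Gy 2}"

abbreviation Fr :: "gen word monoid" where
  "Fr \<equiv> free_group gens"

abbreviation comm :: "gen word \<Rightarrow> gen word \<Rightarrow> gen word" where
  "comm \<equiv> commutator Fr"

definition el_x :: "nat \<Rightarrow> gen word" where "el_x i = free_gen (Gx i)"
definition el_y :: "nat \<Rightarrow> gen word" where "el_y i = free_gen (Gy i)"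
definition el_z :: "nat \<Rightarrow> gen word" where "el_z i = comm (el_y 1) (el_x i)"
definition el_v :: "nat \<Rightarrow> gen word" where "el_v i = comm (el_z 1) (el_x i)"
definition el_u :: "nat \<Rightarrow> gen word" where "el_u i = comm (el_z 1) (el_y i)"

definition el_w :: "nat \<Rightarrow> gen word" where
  "el_w j =
    (if j = 1 then comm (el_x 2) (el_x 1)
     else if j = 2 then comm (el_y 2) (el_x 1) \<otimes>\<^bsub>Fr\<^esub> inv\<^bsub>Fr\<^esub> el_z 2
     else if j = 3 then comm (el_y 2) (el_x 2)
     else comm (el_y 2) (el_y 1))"

text \<open>The convention on commutators that are not stated refers to the names, so names
  are kept apart from the words they denote.\<close>

datatype name = Nx nat | Ny nat | Nz nat | Nw nat | Nu nat | Nv nat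

primrec val :: "name \<Rightarrow> gen word" where
  "val (Nx i) = el_x i"
| "val (Ny i) = el_y i"
| "val (Nz i) = el_z i"
| "val (Nw j) = el_w j"
| "val (Nu i) = el_u i"
| "val (Nv i) = el_v i"

definition names :: "name set" where
  "names = Nx ` {1..2} \<union> Ny ` {1..2} \<union> Nz ` {1..2} \<union> Nw ` {1..4} \<union> Nu ` {1..2} \<union> Nv ` {1..2}"

text \<open>The pairs \<open>(a, b)\<close> for which \<open>[a, b]\<close> occurs in the displayed relations.\<close>

definition stated_pairs :: "(name \<times> name) set" where
  "stated_pairs =
    {(Ny 1, Nx 1), (Ny 1, Nx 2), (Nx 2, Nx 1), (Ny 2, Nx 1), (Ny 2, Nx 2), (Ny 2, Ny 1),
     (Nz 1, Nx 1), (Nz 1, Nx 2), (Nz 1, Ny 1), (Nz 1, Ny 2), (Nz 2, Nx 1), (Nz 2, Ny 1)}"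

text \<open>The relations that merely introduce \<open>z\<^sub>i, w\<^sub>j, u\<^sub>i, v\<^sub>i\<close> are absorbed into
  the definitions of these words.\<close>

definition relations :: "nat \<Rightarrow> (gen word \<times> gen word) set" where
  "relations p =
     {(comm (el_z 2) (el_x 1), comm (el_z 1) (el_x 2)),
      (comm (el_z 2) (el_y 1), comm (el_z 1) (el_y 2))} \<union>
     (\<Union>i\<in>{1..2}.
        {(el_x i [^]\<^bsub>Fr\<^esub> p, \<one>\<^bsub>Fr\<^esub>),
         (el_y i [^]\<^bsub>Fr\<^esub> p, \<one>\<^bsub>Fr\<^esub>),
         (el_z i [^]\<^bsub>Fr\<^esub> p, \<one>\<^bsub>Fr\<^esub>)}) \<union>
     (\<Union>j\<in>{1..4}. {(el_w j [^]\<^bsub>Fr\<^esub> p, \<one>\<^bsub>Fr\<^esub>)}) \<union>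
     {(comm (val a) (val b), \<one>\<^bsub>Fr\<^esub>) | a b.
        a \<in> names \<and> b \<in> names \<and> (a, b) \<notin> stated_pairs \<and> (b, a) \<notin> stated_pairs}"

definition G_star :: "nat \<Rightarrow> gen word set monoid" where
  "G_star p = presented_group gens (relations p)"

end

theory Submission
  imports Defs
begin

text \<open>
  Write \<open>G\<close> for the Heisenberg group, \<open>E\<close> for the presented group, and \<open>A\<close> for the kernel of
  the homomorphism \<open>E \<rightarrow> G\<close> that sends the generators to the elementary matrices with entries
  \<open>1\<close> and \<open>t\<close>. The proof never computes \<open>H\<^sup>2(G, \<complex>\<^sup>\<times>)\<close>, nor even the order of \<open>A\<close>.
  It uses two general facts.

  If \<open>A\<close> is central in \<open>E\<close> and contained in \<open>[E, E]\<close>, then composing the factor set of \<open>E \<rightarrow> G\<close>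
  with characters of \<open>A\<close> embeds \<open>Hom(A, \<complex>\<^sup>\<times>)\<close> in \<open>H\<^sup>2(G, \<complex>\<^sup>\<times>)\<close>: when the result is
  a coboundary, the character extends to \<open>E\<close>, and a character of \<open>E\<close> is trivial on \<open>[E, E]\<close>.
  This embedding (the transgression) is onto as soon as every central extension of \<open>G\<close> by
  \<open>\<complex>\<^sup>\<times>\<close> receives a homomorphism from \<open>E\<close> over \<open>G\<close>, because the restriction of that
  homomorphism to \<open>A\<close> is the required character. Since a finite elementary abelian group is
  isomorphic to its group of characters, the two facts together give
  \<open>A \<cong> H\<^sup>2(G, \<complex>\<^sup>\<times>)\<close>; this is \<open>central_cover.kernel_iso_H2\<close>.

  The presentation is made so that the homomorphisms into central extensions exist. The group
  \<open>\<complex>\<^sup>\<times>\<close> is divisible, so the four matrices lift to elements of order dividing \<open>p\<close> in any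
  central extension by it. The relations of \<open>G\<close> hold for these lifts up to central elements, and this implies all
  relations of \<open>E\<close>: the Hall--Witt identity gives \<open>[z\<^sub>2, x\<^sub>1] = [z\<^sub>1, x\<^sub>2]\<close>,
  \<open>[z\<^sub>2, y\<^sub>1] = [z\<^sub>1, y\<^sub>2]\<close> and \<open>[z\<^sub>2, x\<^sub>2] = [z\<^sub>2, y\<^sub>2] = 1\<close>, and moving
  \<open>y\<close> past \<open>x\<^sup>p = 1\<close> shows that commutators have order dividing \<open>p\<close>, as \<open>p\<close> is odd. The
  locale \<open>heisenberg_lift\<close> collects these consequences; its main result is
  \<open>free_lift_relations\<close>.

  That \<open>A\<close> is central, elementary abelian and inside \<open>[E, E]\<close> follows from a normal form: every element
  of \<open>E\<close> is \<open>x\<^sub>1\<^sup>a x\<^sub>2\<^sup>b y\<^sub>1\<^sup>c y\<^sub>2\<^sup>d z\<^sub>1\<^sup>e z\<^sub>2\<^sup>f k\<close> with \<open>k\<close> in the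
  central subgroup generated by the \<open>w\<^sub>j\<close>, \<open>u\<^sub>i\<close> and \<open>v\<^sub>i\<close>. The exponents modulo \<open>p\<close> can be
  read off from the image matrix, so \<open>A\<close> is exactly that central subgroup
  (\<open>heisenberg_projection.pi_kernel\<close>).
\<close>


section \<open>Commutator calculus\<close>

context group begin

lemma mult_inv_cancel_left:
  assumes "x \<in> carrier G" "y \<in> carrier G"
  shows "x \<otimes> (inv x \<otimes> y) = y" "inv x \<otimes> (x \<otimes> y) = y"
  using assms by (simp_all add: m_assoc[symmetric])

lemma commutator_closed [simp]:
  "a \<in> carrier G \<Longrightarrow> b \<in> carrier G \<Longrightarrow> commutator G a b \<in> carrier G"
  by (simp add: commutator_def)

lemma mult_eq_mult_commutator:
  assumes "a \<in> carrier G" "b \<in> carrier G"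
  shows "a \<otimes> b = b \<otimes> a \<otimes> commutator G a b"
  using assms by (simp add: commutator_def m_assoc mult_inv_cancel_left)

lemma commutator_unique:
  assumes "a \<in> carrier G" "b \<in> carrier G" "c \<in> carrier G" "a \<otimes> b = b \<otimes> a \<otimes> c"
  shows "commutator G a b = c"
  using assms mult_eq_mult_commutator[of a b] by (metis commutator_closed l_cancel m_closed)

lemma commutator_eq_one_iff:
  assumes "a \<in> carrier G" "b \<in> carrier G"
  shows "commutator G a b = \<one> \<longleftrightarrow> a \<otimes> b = b \<otimes> a"
  using assms commutator_unique[of a b \<one>] mult_eq_mult_commutator[of a b] by auto

lemma inv_commutator:
  assumes "a \<in> carrier G" "b \<in> carrier G"
  shows "inv (commutator G a b) = commutator G b a"
  using assms by (simp add: commutator_def inv_mult_group m_assoc)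

lemma commutator_commute_swap:
  assumes "a \<in> carrier G" "b \<in> carrier G"
  shows "commutator G a b = \<one> \<longleftrightarrow> commutator G b a = \<one>"
  using assms by (auto simp add: commutator_eq_one_iff)

lemma group_centerD:
  assumes "c \<in> group_center G"
  shows "c \<in> carrier G" "g \<in> carrier G \<Longrightarrow> c \<otimes> g = g \<otimes> c"
  using assms by (auto simp: group_center_def)

lemma one_in_group_center: "\<one> \<in> group_center G"
  by (simp add: group_center_def)

lemma central_left_commute:
  assumes "c \<in> group_center G" "g \<in> carrier G" "h \<in> carrier G"
  shows "c \<otimes> (g \<otimes> h) = g \<otimes> (c \<otimes> h)"
  using assms group_centerD(1)[OF assms(1)] group_centerD(2)[OF assms(1,2)]
  by (simp add: m_assoc[symmetric])

lemma subgroup_group_center: "subgroup (group_center G) G"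
proof (rule subgroupI)
  fix a assume a: "a \<in> group_center G"
  note A = group_centerD[OF a]
  have "inv a \<otimes> g = g \<otimes> inv a" if g: "g \<in> carrier G" for g
  proof -
    have "inv a \<otimes> g = inv a \<otimes> (g \<otimes> a) \<otimes> inv a"
      using A(1) g by (simp add: m_assoc)
    also have "\<dots> = inv a \<otimes> (a \<otimes> g) \<otimes> inv a" by (simp only: A(2)[OF g])
    also have "\<dots> = g \<otimes> inv a" using A(1) g by (simp add: mult_inv_cancel_left)
    finally show ?thesis .
  qed
  then show "inv a \<in> group_center G" using A(1) by (simp add: group_center_def)
next
  fix a b assume a: "a \<in> group_center G" and b: "b \<in> group_center G"
  note A = group_centerD[OF a] and B = group_centerD[OF b]
  have "a \<otimes> b \<otimes> g = g \<otimes> (a \<otimes> b)" if g: "g \<in> carrier G" for g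
  proof -
    have "a \<otimes> b \<otimes> g = a \<otimes> (g \<otimes> b)"
      using A(1) B(1) g by (simp add: m_assoc B(2)[OF g])
    then show ?thesis using central_left_commute[OF a g B(1)] by simp
  qed
  then show "a \<otimes> b \<in> group_center G" using A(1) B(1) by (simp add: group_center_def)
qed (use one_in_group_center in \<open>auto simp: group_center_def\<close>)

lemma nat_pow_in_group_center:
  "c \<in> group_center G \<Longrightarrow> c [^] (n::nat) \<in> group_center G"
  by (metis int_pow_int subgroup_group_center subgroup_int_pow_closed)

lemma commutator_central:
  assumes "c \<in> group_center G" "g \<in> carrier G"
  shows "commutator G c g = \<one>" "commutator G g c = \<one>"
  using assms group_centerD(1)[OF assms(1)] group_centerD(2)[OF assms]
  by (simp_all add: commutator_eq_one_iff)

lemma commutator_mult_central_left: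
  assumes c: "c \<in> group_center G" and a: "a \<in> carrier G" and b: "b \<in> carrier G"
  shows "commutator G (a \<otimes> c) b = commutator G a b"
proof (rule commutator_unique)
  note C = group_centerD[OF c]
  have "a \<otimes> c \<otimes> b = a \<otimes> b \<otimes> c" using C(1) a b by (simp add: m_assoc C(2)[OF b])
  also have "\<dots> = b \<otimes> a \<otimes> (commutator G a b \<otimes> c)"
    using a b C(1) mult_eq_mult_commutator[OF a b] by (simp add: m_assoc)
  also have "commutator G a b \<otimes> c = c \<otimes> commutator G a b"
    by (rule C(2)[symmetric]) (use a b in simp)
  finally show "a \<otimes> c \<otimes> b = b \<otimes> (a \<otimes> c) \<otimes> commutator G a b"
    using a b C(1) by (simp add: m_assoc)
qed (use a b group_centerD(1)[OF c] in auto)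

lemma commutator_mult_central_right:
  assumes c: "c \<in> group_center G" and a: "a \<in> carrier G" and b: "b \<in> carrier G"
  shows "commutator G a (b \<otimes> c) = commutator G a b"
proof -
  have "commutator G a (b \<otimes> c) = inv (commutator G (b \<otimes> c) a)"
    using a b group_centerD(1)[OF c] by (simp add: inv_commutator)
  also have "\<dots> = commutator G a b"
    using a b c by (simp add: commutator_mult_central_left inv_commutator)
  finally show ?thesis .
qed

lemma conjugate_commutator:
  assumes "u \<in> carrier G" "a \<in> carrier G" "b \<in> carrier G"
  shows "inv u \<otimes> commutator G a b \<otimes> u =
    commutator G (inv u \<otimes> a \<otimes> u) (inv u \<otimes> b \<otimes> u)"
  using assms by (simp add: commutator_def m_assoc inv_mult_group mult_inv_cancel_left)

lemma conjugate_eq_mult_commutator: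
  assumes "u \<in> carrier G" "a \<in> carrier G"
  shows "inv u \<otimes> a \<otimes> u = a \<otimes> commutator G a u"
  using assms by (simp add: commutator_def m_assoc mult_inv_cancel_left)

text \<open>Conjugation by \<open>u\<close> moves \<open>a\<close> and \<open>b\<close> only by central factors, and those do not
  affect the commutator of \<open>a\<close> and \<open>b\<close>.\<close>

lemma commutes_with_commutator:
  assumes u: "u \<in> carrier G" and a: "a \<in> carrier G" and b: "b \<in> carrier G"
    and ca: "commutator G u a \<in> group_center G" and cb: "commutator G u b \<in> group_center G"
  shows "u \<otimes> commutator G a b = commutator G a b \<otimes> u"
proof -
  have *: "commutator G x u \<in> group_center G"
    if "commutator G u x \<in> group_center G" "x \<in> carrier G" for x
    using that u inv_commutator[of u x] subgroup.m_inv_closed[OF subgroup_group_center] by metis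
  have "inv u \<otimes> commutator G a b \<otimes> u = commutator G a b"
    using u a b ca cb *
    by (simp add: conjugate_commutator)
       (simp add: conjugate_eq_mult_commutator commutator_mult_central_left
         commutator_mult_central_right)
  then have "u \<otimes> (inv u \<otimes> commutator G a b \<otimes> u) = u \<otimes> commutator G a b" by simp
  then show ?thesis using u a b by (simp add: m_assoc mult_inv_cancel_left)
qed

text \<open>This is the Hall--Witt identity in the case where \<open>[a, b]\<close> is central: conjugating \<open>c\<close>
  by \<open>a b\<close> and by \<open>b a\<close> gives the same element, and the two results are
  \<open>c [c, b] [c, a] [[c, a], b]\<close> and \<open>c [c, a] [c, b] [[c, b], a]\<close>.\<close>

lemma commutator_exchange:
  assumes a: "a \<in> carrier G" and b: "b \<in> carrier G" and c: "c \<in> carrier G"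
    and ab: "commutator G a b \<in> group_center G"
    and comm: "commutator G c a \<otimes> commutator G c b = commutator G c b \<otimes> commutator G c a"
  shows "commutator G (commutator G c a) b = commutator G (commutator G c b) a"
proof -
  define P where "P = commutator G c a"
  define Q where "Q = commutator G c b"
  have PQ: "P \<in> carrier G" "Q \<in> carrier G" "P \<otimes> Q = Q \<otimes> P"
    using a b c comm by (auto simp: P_def Q_def)
  have conj: "inv (x \<otimes> y) \<otimes> c \<otimes> (x \<otimes> y) =
      c \<otimes> commutator G c y \<otimes> commutator G c x \<otimes> commutator G (commutator G c x) y"
    if x: "x \<in> carrier G" and y: "y \<in> carrier G" for x y
  proof -
    have "inv (x \<otimes> y) \<otimes> c \<otimes> (x \<otimes> y) = inv y \<otimes> (inv x \<otimes> c \<otimes> x) \<otimes> y"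
      using x y c by (simp add: inv_mult_group m_assoc)
    also have "\<dots> = inv y \<otimes> (c \<otimes> commutator G c x) \<otimes> y"
      using x c by (simp add: conjugate_eq_mult_commutator)
    also have "\<dots> = (inv y \<otimes> c \<otimes> y) \<otimes> (inv y \<otimes> commutator G c x \<otimes> y)"
      using x y c by (simp add: m_assoc mult_inv_cancel_left)
    also have "\<dots> = c \<otimes> commutator G c y \<otimes> commutator G c x \<otimes> commutator G (commutator G c x) y"
      using x y c conjugate_eq_mult_commutator[of y c]
        conjugate_eq_mult_commutator[of y "commutator G c x"] by (simp add: m_assoc)
    finally show ?thesis .
  qed
  let ?k = "commutator G a b"
  note k = group_centerD[OF ab]
  have "inv (a \<otimes> b) \<otimes> c \<otimes> (a \<otimes> b) = inv ?k \<otimes> (inv (b \<otimes> a) \<otimes> c \<otimes> (b \<otimes> a)) \<otimes> ?k"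
    using mult_eq_mult_commutator[OF a b] a b c k(1) by (simp add: inv_mult_group m_assoc)
  also have "\<dots> = inv (b \<otimes> a) \<otimes> c \<otimes> (b \<otimes> a)"
    using a b c k(1) k(2)[of "inv (b \<otimes> a) \<otimes> c \<otimes> (b \<otimes> a)"]
    by (simp add: m_assoc[of "inv ?k"]) (simp add: mult_inv_cancel_left flip: k(2))
  finally have "c \<otimes> Q \<otimes> P \<otimes> commutator G P b = c \<otimes> P \<otimes> Q \<otimes> commutator G Q a"
    using a b c by (simp add: conj P_def Q_def)
  then have "(c \<otimes> (P \<otimes> Q)) \<otimes> commutator G P b = (c \<otimes> (P \<otimes> Q)) \<otimes> commutator G Q a"
    using PQ a b c by (simp add: m_assoc)
  then show ?thesis unfolding P_def[symmetric] Q_def[symmetric]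
    using PQ a b c by (metis commutator_closed l_cancel m_closed)
qed

lemma commutator_inv_left:
  assumes a: "a \<in> carrier G" and b: "b \<in> carrier G" and ab: "commutator G a b \<in> group_center G"
  shows "commutator G (inv a) b = inv (commutator G a b)"
proof (rule commutator_unique)
  let ?k = "commutator G a b"
  have k: "inv ?k \<in> group_center G"
    using subgroup.m_inv_closed[OF subgroup_group_center ab] .
  note K = group_centerD[OF k]
  have "b \<otimes> inv a \<otimes> inv ?k = b \<otimes> (inv ?k \<otimes> inv a)"
    using a b K(1) K(2)[of "inv a"] by (simp only: m_assoc m_closed inv_closed)
  also have "\<dots> = inv a \<otimes> b"
    using a b by (simp add: inv_commutator) (simp add: commutator_def m_assoc mult_inv_cancel_left)
  finally show "inv a \<otimes> b = b \<otimes> inv a \<otimes> inv ?k" ..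
qed (use a b in auto)

lemma nat_pow_swap_central:
  assumes z: "z \<in> carrier G" and x: "x \<in> carrier G" and v: "v \<in> group_center G"
    and eq: "z \<otimes> x = x \<otimes> z \<otimes> v"
  shows "z [^] (n::nat) \<otimes> x = x \<otimes> z [^] n \<otimes> v [^] n"
proof (induction n)
  case (Suc n)
  note V = group_centerD[OF v]
  have "z [^] Suc n \<otimes> x = z [^] n \<otimes> (z \<otimes> x)" using z x by (simp add: m_assoc)
  also have "\<dots> = (z [^] n \<otimes> x) \<otimes> (z \<otimes> v)" using z x V(1) eq by (simp add: m_assoc)
  also have "\<dots> = x \<otimes> z [^] n \<otimes> (v [^] n \<otimes> z) \<otimes> v"
    using z x V(1) Suc by (simp add: m_assoc)
  also have "v [^] n \<otimes> z = z \<otimes> v [^] n"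
    by (rule group_centerD(2)[OF nat_pow_in_group_center[OF v] z])
  finally show ?case using z x V(1) by (simp add: m_assoc)
qed (use z x in simp)

text \<open>Each of the \<open>n\<close> steps of moving \<open>y\<close> past a factor \<open>x\<close> creates one \<open>z\<close>; the \<open>i\<close>-th new \<open>z\<close>
  then has to pass the remaining factors \<open>x\<close>, which creates one \<open>v\<close> for each pair of factors.\<close>

lemma commutator_pow_collect:
  assumes y: "y \<in> carrier G" and x: "x \<in> carrier G"
    and z: "z = commutator G y x" and v: "v = commutator G z x" and vc: "v \<in> group_center G"
  shows "y \<otimes> x [^] (n::nat) = x [^] n \<otimes> y \<otimes> z [^] n \<otimes> v [^] (n choose 2)"
proof (induction n)
  case 0
  then show ?case using y x by (simp add: binomial_eq_0)
next
  case (Suc n)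
  have zc: "z \<in> carrier G" using y x z by simp
  note V = group_centerD[OF vc]
  have zx: "z \<otimes> x = x \<otimes> z \<otimes> v" using v mult_eq_mult_commutator[OF zc x] by simp
  have yx: "y \<otimes> x = x \<otimes> y \<otimes> z" using z mult_eq_mult_commutator[OF y x] by simp
  have vx: "v [^] k \<otimes> x = x \<otimes> v [^] k" for k :: nat
    by (rule group_centerD(2)[OF nat_pow_in_group_center[OF vc] x])
  have "y \<otimes> x [^] Suc n = (y \<otimes> x [^] n) \<otimes> x" using x y by (simp add: m_assoc)
  also have "\<dots> = x [^] n \<otimes> y \<otimes> (z [^] n \<otimes> (v [^] (n choose 2) \<otimes> x))"
    using x y zc V(1) Suc by (simp add: m_assoc)
  also have "\<dots> = x [^] n \<otimes> y \<otimes> ((z [^] n \<otimes> x) \<otimes> v [^] (n choose 2))"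
    using x y zc V(1) by (simp add: m_assoc vx)
  also have "\<dots> = x [^] n \<otimes> (y \<otimes> x) \<otimes> z [^] n \<otimes> (v [^] n \<otimes> v [^] (n choose 2))"
    using x y zc V(1) nat_pow_swap_central[OF zc x vc zx, of n] by (simp add: m_assoc)
  also have "\<dots> = (x [^] n \<otimes> x) \<otimes> y \<otimes> (z \<otimes> z [^] n) \<otimes> (v [^] n \<otimes> v [^] (n choose 2))"
    using x y zc V(1) yx by (simp add: m_assoc)
  also have "\<dots> = x [^] Suc n \<otimes> y \<otimes> z [^] Suc n \<otimes> v [^] (Suc n choose 2)"
    using x y zc V(1) nat_pow_Suc2[OF zc, of n] by (simp add: nat_pow_mult numeral_2_eq_2)
  finally show ?case .
qed

text \<open>Moving \<open>y\<close> past \<open>x\<^sup>p = 1\<close> produces \<open>z\<^sup>p\<close> together with a central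
  factor whose exponent is divisible by \<open>p\<close>; that is where \<open>p\<close> has to be odd.\<close>

lemma commutator_pow_eq_one:
  fixes p :: nat
  assumes y: "y \<in> carrier G" and x: "x \<in> carrier G" and p: "odd p"
    and xp: "x [^] p = \<one>"
    and zp: "commutator G y x [^] p \<in> group_center G"
    and v: "commutator G (commutator G y x) x \<in> group_center G"
  shows "commutator G y x [^] p = \<one>"
proof -
  define z where "z = commutator G y x"
  define v where "v = commutator G z x"
  have vc: "v \<in> group_center G" using assms by (simp add: z_def v_def)
  have zc: "z \<in> carrier G" using y x by (simp add: z_def)
  note V = group_centerD[OF vc]
  have zx: "z \<otimes> x = x \<otimes> z \<otimes> v" using v_def mult_eq_mult_commutator[OF zc x] by simp
  have "x \<otimes> z [^] p \<otimes> v [^] p = z [^] p \<otimes> x"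
    using nat_pow_swap_central[OF zc x vc zx, of p] by simp
  also have "\<dots> = x \<otimes> z [^] p" by (rule group_centerD(2)[OF zp[folded z_def] x])
  finally have vp: "v [^] p = \<one>" using x zc V(1) by simp
  obtain k where "p = 2 * k + 1" using p by (elim oddE)
  then have k: "p choose 2 = p * k" by (simp add: choose_two algebra_simps)
  have "y = y \<otimes> z [^] p \<otimes> (v [^] p) [^] k"
    using commutator_pow_collect[OF y x z_def v_def vc, of p] xp y zc V(1)
    by (simp add: nat_pow_pow k)
  then have "y = y \<otimes> z [^] p" using vp y zc by simp
  then show ?thesis using y zc by (simp add: z_def)
qed

end

section \<open>The universal property of a presented group\<close>

definition free_lift :: "('h, 'b) monoid_scheme \<Rightarrow> ('a \<Rightarrow> 'h) \<Rightarrow> 'a word \<Rightarrow> 'h" where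
  "free_lift H \<phi> w =
     foldr (\<lambda>l h. (if snd l then \<phi> (fst l) else inv\<^bsub>H\<^esub> \<phi> (fst l)) \<otimes>\<^bsub>H\<^esub> h) w \<one>\<^bsub>H\<^esub>"

context group begin

lemma free_lift_closed:
  "\<phi> \<in> S \<rightarrow> carrier G \<Longrightarrow> fst ` set w \<subseteq> S \<Longrightarrow> free_lift G \<phi> w \<in> carrier G"
  by (induction w) (auto simp: free_lift_def Pi_iff)

lemma free_lift_append:
  assumes "\<phi> \<in> S \<rightarrow> carrier G" "fst ` set u \<subseteq> S" "fst ` set v \<subseteq> S"
  shows "free_lift G \<phi> (u @ v) = free_lift G \<phi> u \<otimes> free_lift G \<phi> v"
  using assms(2)
proof (induction u)
  case Nil
  then show ?case using free_lift_closed[OF assms(1,3)] by (simp add: free_lift_def)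
next
  case (Cons l u)
  let ?c = "if snd l then \<phi> (fst l) else inv (\<phi> (fst l))"
  have c: "?c \<in> carrier G" using Cons.prems assms(1) by (auto simp: Pi_iff)
  have step: "free_lift G \<phi> (l # w) = ?c \<otimes> free_lift G \<phi> w" for w
    by (simp add: free_lift_def)
  have u: "fst ` set u \<subseteq> S" using Cons.prems by auto
  then show ?case
    using c Cons.IH[OF u] free_lift_closed[OF assms(1) u] free_lift_closed[OF assms(1,3)]
    by (simp only: append_Cons step m_assoc)
qed

text \<open>A letter and its formal inverse have mutually inverse values, so cancelling them does not
  change the value of a word.\<close>

lemma free_lift_push:
  assumes \<phi>: "\<phi> \<in> S \<rightarrow> carrier G" and l: "fst l \<in> S" and w: "fst ` set w \<subseteq> S"
  shows "free_lift G \<phi> (push l w) = free_lift G \<phi> (l # w)"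
proof (cases w)
  case (Cons k ks)
  have "\<phi> (fst l) \<in> carrier G" "free_lift G \<phi> ks \<in> carrier G"
    using \<phi> l w free_lift_closed[OF \<phi>, of ks] Cons by auto
  then show ?thesis
    using Cons by (auto simp: free_lift_def inv_letter_def mult_inv_cancel_left)
qed simp

lemma free_lift_free_reduce:
  assumes \<phi>: "\<phi> \<in> S \<rightarrow> carrier G" and w: "fst ` set w \<subseteq> S"
  shows "free_lift G \<phi> (free_reduce w) = free_lift G \<phi> w"
  using w
proof (induction w)
  case (Cons l w)
  have "fst ` set (free_reduce w) \<subseteq> S" using set_free_reduce[of w] Cons.prems by auto
  then have "free_lift G \<phi> (free_reduce (l # w)) = free_lift G \<phi> (l # free_reduce w)"
    using free_lift_push[OF \<phi>, of l "free_reduce w"] Cons.prems by (simp add: free_reduce_def)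
  then show ?case using Cons by (simp add: free_lift_def)
qed (simp add: free_reduce_def)

lemma free_lift_hom:
  assumes "\<phi> \<in> S \<rightarrow> carrier G"
  shows "free_lift G \<phi> \<in> hom (free_group S) G"
  using assms free_lift_closed[OF assms] free_lift_append[OF assms]
    free_lift_free_reduce[OF assms]
  by (auto simp: hom_def free_group_def image_Un)

lemma free_lift_free_gen:
  "\<phi> a \<in> carrier G \<Longrightarrow> free_lift G \<phi> (free_gen a) = \<phi> a"
  by (simp add: free_lift_def free_gen_def)

end

lemma generate_free_gen: "generate (free_group S) (free_gen ` S) = carrier (free_group S)"
proof -
  interpret F: group "free_group S" by (rule group_free_group)
  have gen: "free_gen a \<in> carrier (free_group S)" if "a \<in> S" for a
    using that by (simp add: free_group_def free_gen_def)
  have "w \<in> generate (free_group S) (free_gen ` S)"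
    if "reduced w" "fst ` set w \<subseteq> S" for w
    using that
  proof (induction w)
    case Nil
    show ?case using generate.one[of "free_group S" "free_gen ` S"] by (simp add: free_group_def)
  next
    case (Cons l w)
    obtain a b where l: "l = (a, b)" by (cases l)
    have a: "a \<in> S" using Cons.prems l by simp
    have inv: "inv\<^bsub>free_group S\<^esub> (free_gen a) = [(a, False)]"
      by (rule F.inv_equality)
         (use a in \<open>auto simp: free_group_def free_gen_def free_reduce_def inv_letter_def\<close>)
    have "[l] \<in> generate (free_group S) (free_gen ` S)"
    proof (cases b)
      case True
      then show ?thesis using generate.incl[of "free_gen a" "free_gen ` S"] a l
        by (simp add: free_gen_def)
    next
      case False
      then show ?thesis using generate.inv[of "free_gen a" "free_gen ` S" "free_group S"] a l inv
        by simp
    qed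
    moreover have "w \<in> generate (free_group S) (free_gen ` S)"
      using Cons by (auto dest: reduced_ConsD)
    ultimately have "[l] \<otimes>\<^bsub>free_group S\<^esub> w \<in> generate (free_group S) (free_gen ` S)"
      by (rule generate.eng)
    then show ?case
      using Cons.prems(1) free_reduce_reduced[of "l # w"] by (simp add: free_group_def)
  qed
  then have "carrier (free_group S) \<subseteq> generate (free_group S) (free_gen ` S)"
    unfolding free_group_def[of S] by auto
  moreover have "generate (free_group S) (free_gen ` S) \<subseteq> carrier (free_group S)"
    using F.generate_in_carrier[of "free_gen ` S"] gen by blast
  ultimately show ?thesis by blast
qed

definition presented_class :: "'a set \<Rightarrow> ('a word \<times> 'a word) set \<Rightarrow> 'a word \<Rightarrow> 'a word set" where
  "presented_class S E w =
     normal_closure (free_group S)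
       {l \<otimes>\<^bsub>free_group S\<^esub> inv\<^bsub>free_group S\<^esub> r | l r. (l, r) \<in> E} #>\<^bsub>free_group S\<^esub> w"

locale presentation =
  fixes S :: "'a set" and E :: "('a word \<times> 'a word) set"
  assumes relation_closed:
    "(l, r) \<in> E \<Longrightarrow> l \<in> carrier (free_group S) \<and> r \<in> carrier (free_group S)"
begin

abbreviation "relators \<equiv> {l \<otimes>\<^bsub>free_group S\<^esub> inv\<^bsub>free_group S\<^esub> r | l r. (l, r) \<in> E}"

lemma relators_closed: "relators \<subseteq> carrier (free_group S)"
proof -
  interpret F: group "free_group S" by (rule group_free_group)
  show ?thesis using relation_closed by auto
qed

lemma normal_relators: "normal_closure (free_group S) relators \<lhd> free_group S"
  by (rule normal_normal_closure[OF group_free_group relators_closed])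

lemma group_presented: "group (presented_group S E)"
  by (rule group_presented_group) (rule relation_closed)

lemma presented_class_hom: "presented_class S E \<in> hom (free_group S) (presented_group S E)"
  using normal.r_coset_hom_Mod[OF normal_relators]
  by (simp add: presented_class_def[abs_def] presented_group_def)

lemma presented_class_image:
  "presented_class S E ` carrier (free_group S) = carrier (presented_group S E)"
  by (simp add: presented_class_def[abs_def] presented_group_def carrier_FactGroup)

lemma presented_class_relation:
  assumes "(l, r) \<in> E"
  shows "presented_class S E l = presented_class S E r"
proof -
  interpret F: group "free_group S" by (rule group_free_group)
  let ?N = "normal_closure (free_group S) relators"
  interpret N: normal ?N "free_group S" by (rule normal_relators)
  have "l \<otimes>\<^bsub>free_group S\<^esub> inv\<^bsub>free_group S\<^esub> r \<in> ?N"
    using assms hull_subset[of relators] unfolding normal_closure_def by blast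
  then have "l \<in> ?N #>\<^bsub>free_group S\<^esub> r"
    using relation_closed[OF assms] by (intro N.rcos_module_rev F.group_axioms) auto
  then show ?thesis
    unfolding presented_class_def
    by (rule F.repr_independence[symmetric]) (use relation_closed[OF assms] N.subgroup_axioms in auto)
qed

lemma generate_presented:
  "generate (presented_group S E) ((\<lambda>a. presented_class S E (free_gen a)) ` S) =
     carrier (presented_group S E)"
proof -
  interpret h: group_hom "free_group S" "presented_group S E" "presented_class S E"
    by (simp add: group_hom_def group_hom_axioms_def group_free_group group_presented
        presented_class_hom)
  have "free_gen ` S \<subseteq> carrier (free_group S)"
    by (auto simp: free_group_def free_gen_def)
  then show ?thesis
    using h.generate_img[of "free_gen ` S"]
    by (simp add: generate_free_gen presented_class_image image_image)
qed

text \<open>The relators lie in the kernel of the evaluation homomorphism, hence so does their normal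
  closure, and the evaluation factors through the quotient.\<close>

lemma presented_lift:
  assumes H: "group H" and \<phi>: "\<phi> \<in> S \<rightarrow> carrier H"
    and rel: "\<And>l r. (l, r) \<in> E \<Longrightarrow> free_lift H \<phi> l = free_lift H \<phi> r"
  obtains \<psi> where "\<psi> \<in> hom (presented_group S E) H"
    "\<And>w. w \<in> carrier (free_group S) \<Longrightarrow> \<psi> (presented_class S E w) = free_lift H \<phi> w"
proof -
  interpret H: group H by fact
  interpret F: group "free_group S" by (rule group_free_group)
  let ?N = "normal_closure (free_group S) relators"
  let ?h = "free_lift H \<phi>"
  interpret N: normal ?N "free_group S" by (rule normal_relators)
  interpret h: group_hom "free_group S" H ?h
    by (simp add: group_hom_def group_hom_axioms_def group_free_group H.group_axioms H.free_lift_hom[OF \<phi>])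
  have "relators \<subseteq> kernel (free_group S) H ?h"
    using rel relation_closed by (auto simp: kernel_def)
  then have N_kernel: "?N \<subseteq> kernel (free_group S) H ?h"
    using h.normal_kernel unfolding normal_closure_def by (intro hull_minimal)
  obtain \<psi> where "\<psi> \<in> hom (free_group S Mod ?N) H"
    "\<And>w. w \<in> carrier (free_group S) \<Longrightarrow> \<psi> (?N #>\<^bsub>free_group S\<^esub> w) = ?h w"
    using h.FactGroup_universal_kernel[OF normal_relators N_kernel] by blast
  then show ?thesis using that[of \<psi>] by (simp add: presented_group_def presented_class_def)
qed

end

section \<open>Which quadruples satisfy the relations\<close>

(* Without this the simplifier turns the indices 1 into Suc 0, and the relations, which mention
   the indices 1 and 2 literally, no longer match. *)
declare One_nat_def [simp del]

lemma index_sets: "{1..2::nat} = {1, 2}" "{1..4::nat} = {1, 2, 3, 4}"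
  by auto

primrec gen_val :: "(nat \<Rightarrow> 'h) \<Rightarrow> (nat \<Rightarrow> 'h) \<Rightarrow> gen \<Rightarrow> 'h" where
  "gen_val x y (Gx i) = x i"
| "gen_val x y (Gy i) = y i"

text \<open>The conditions express that the relations of the Heisenberg group hold modulo the centre.
  They are what is known about lifts of the elementary matrices to elements of order dividing \<open>p\<close> in
  a central extension, before any commutator is computed.\<close>

locale heisenberg_lift = group G for G :: "('h, 'b) monoid_scheme" (structure) +
  fixes p :: nat and x y :: "nat \<Rightarrow> 'h"
  assumes odd_p: "odd p"
    and x_closed: "i \<in> {1, 2} \<Longrightarrow> x i \<in> carrier G"
    and y_closed: "i \<in> {1, 2} \<Longrightarrow> y i \<in> carrier G"
    and x_pow: "i \<in> {1, 2} \<Longrightarrow> x i [^] p = \<one>"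
    and y_pow: "i \<in> {1, 2} \<Longrightarrow> y i [^] p = \<one>"
    and x2_x1: "commutator G (x 2) (x 1) \<in> group_center G"
    and y2_x2: "commutator G (y 2) (x 2) \<in> group_center G"
    and y2_y1: "commutator G (y 2) (y 1) \<in> group_center G"
    and y2_x1: "commutator G (y 2) (x 1) \<otimes> inv (commutator G (y 1) (x 2)) \<in> group_center G"
    and z_x: "i \<in> {1, 2} \<Longrightarrow> j \<in> {1, 2} \<Longrightarrow>
      commutator G (commutator G (y 1) (x i)) (x j) \<in> group_center G"
    and z_y: "i \<in> {1, 2} \<Longrightarrow> j \<in> {1, 2} \<Longrightarrow>
      commutator G (commutator G (y 1) (x i)) (y j) \<in> group_center G"
    and z_pow_central: "i \<in> {1, 2} \<Longrightarrow> commutator G (y 1) (x i) [^] p \<in> group_center G"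
begin

definition z :: "nat \<Rightarrow> 'h" where "z i = commutator G (y 1) (x i)"

definition w :: "nat \<Rightarrow> 'h" where
  "w j =
    (if j = 1 then commutator G (x 2) (x 1)
     else if j = 2 then commutator G (y 2) (x 1) \<otimes> inv (z 2)
     else if j = 3 then commutator G (y 2) (x 2)
     else commutator G (y 2) (y 1))"

primrec name_val :: "name \<Rightarrow> 'h" where
  "name_val (Nx i) = x i"
| "name_val (Ny i) = y i"
| "name_val (Nz i) = z i"
| "name_val (Nw j) = w j"
| "name_val (Nu i) = commutator G (z 1) (y i)"
| "name_val (Nv i) = commutator G (z 1) (x i)"

lemma xy_closed [simp]:
  "x 1 \<in> carrier G" "x 2 \<in> carrier G" "y 1 \<in> carrier G" "y 2 \<in> carrier G"
  using x_closed[of 1] x_closed[of 2] y_closed[of 1] y_closed[of 2] by auto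

lemma z_closed [simp]: "i \<in> {1, 2} \<Longrightarrow> z i \<in> carrier G" "z 1 \<in> carrier G" "z 2 \<in> carrier G"
  by (auto simp: z_def)

lemma w_central: "w j \<in> group_center G"
  using x2_x1 y2_x2 y2_y1 y2_x1 by (simp add: w_def z_def)

lemma z_commutator_central:
  assumes "i \<in> {1, 2}" "j \<in> {1, 2}"
  shows "commutator G (z i) (x j) \<in> group_center G" "commutator G (z i) (y j) \<in> group_center G"
  using z_x[OF assms] z_y[OF assms] by (auto simp: z_def)

text \<open>\<open>z\<^sub>1\<close> is the commutator of \<open>y\<^sub>1\<close> and \<open>x\<^sub>1\<close>, and \<open>z\<^sub>2\<close> commutes with both up to central
  elements.\<close>

lemma z2_z1: "z 2 \<otimes> z 1 = z 1 \<otimes> z 2"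
  using commutes_with_commutator[of "z 2" "y 1" "x 1"] z_commutator_central[of 2 1]
  by (simp add: z_def)

lemma y2_x1_eq: "commutator G (y 2) (x 1) = z 2 \<otimes> w 2"
proof -
  have "w 2 \<otimes> z 2 = commutator G (y 2) (x 1)" by (simp add: w_def m_assoc)
  then show ?thesis using group_centerD(2)[OF w_central, of "z 2" 2] by simp
qed

text \<open>\<open>[y\<^sub>2, x\<^sub>1]\<close> and \<open>z\<^sub>2\<close> differ by the central \<open>w\<^sub>2\<close>. This is how \<open>z\<^sub>2\<close> comes to have two
  descriptions as a commutator; the lemmas on commutators of \<open>z\<^sub>2\<close> below
  play them off against each other by means of \<open>commutator_exchange\<close>.\<close>

lemma commutator_y2_x1: "g \<in> carrier G \<Longrightarrow>
  commutator G (commutator G (y 2) (x 1)) g = commutator G (z 2) g"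
  using commutator_mult_central_left[OF w_central, of "z 2" g 2] by (simp add: y2_x1_eq)

lemma z2_x1: "commutator G (z 2) (x 1) = commutator G (z 1) (x 2)"
  using commutator_exchange[of "x 2" "x 1" "y 1"] x2_x1 z2_z1 by (simp add: z_def)

lemma z2_x2: "commutator G (z 2) (x 2) = \<one>"
proof -
  have "commutator G (x 1) (x 2) \<in> group_center G"
    using subgroup.m_inv_closed[OF subgroup_group_center x2_x1] by (simp add: inv_commutator)
  moreover have "commutator G (y 2) (x 1) \<otimes> commutator G (y 2) (x 2) =
      commutator G (y 2) (x 2) \<otimes> commutator G (y 2) (x 1)"
    by (rule group_centerD(2)[OF y2_x2, symmetric]) simp
  ultimately have "commutator G (z 2) (x 2) = commutator G (commutator G (y 2) (x 2)) (x 1)"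
    using commutator_exchange[of "x 1" "x 2" "y 2"] by (simp add: commutator_y2_x1)
  then show ?thesis using commutator_central(1)[OF y2_x2, of "x 1"] by simp
qed

text \<open>Here \<open>z\<^sub>1\<close> and \<open>z\<^sub>2\<close> are viewed as inverses of commutators \<open>[x, y]\<close>, so that the two factors
  exchanged are \<open>y\<^sub>1\<close> and \<open>y\<^sub>2\<close>.\<close>

lemma z2_y1: "commutator G (z 2) (y 1) = commutator G (z 1) (y 2)"
proof -
  let ?t = "commutator G (y 2) (x 1)"
  have t: "?t \<in> carrier G" by simp
  have "z 2 \<otimes> w 2 \<otimes> z 1 = z 1 \<otimes> (z 2 \<otimes> w 2)"
    using group_centerD(1)[OF w_central] group_centerD(2)[OF w_central, of "z 1" 2] z2_z1
    by (simp add: m_assoc) (simp add: m_assoc[symmetric])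
  then have "inv (z 1 \<otimes> ?t) = inv (?t \<otimes> z 1)" by (simp add: y2_x1_eq)
  then have comm: "commutator G (x 1) (y 2) \<otimes> commutator G (x 1) (y 1) =
      commutator G (x 1) (y 1) \<otimes> commutator G (x 1) (y 2)"
    by (simp add: inv_mult_group inv_commutator z_def)
  have "commutator G (commutator G (x 1) (y 2)) (y 1) =
      commutator G (commutator G (x 1) (y 1)) (y 2)"
    by (rule commutator_exchange) (use y2_y1 comm in simp_all)
  then have "commutator G (inv ?t) (y 1) = commutator G (inv (z 1)) (y 2)"
    by (simp add: inv_commutator z_def)
  then have "inv (commutator G (z 2) (y 1)) = inv (commutator G (z 1) (y 2))"
    using z_commutator_central(2)[of 2 1] z_commutator_central(2)[of 1 2]
    by (simp add: commutator_inv_left commutator_y2_x1)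
  then show ?thesis by (simp add: inj_on_eq_iff[OF inv_inj])
qed

lemma z2_y2: "commutator G (z 2) (y 2) = \<one>"
proof -
  have x2_y2: "commutator G (x 2) (y 2) \<in> group_center G"
    using subgroup.m_inv_closed[OF subgroup_group_center y2_x2] by (simp add: inv_commutator)
  have y1_y2: "commutator G (y 1) (y 2) \<in> group_center G"
    using subgroup.m_inv_closed[OF subgroup_group_center y2_y1] by (simp add: inv_commutator)
  have "commutator G (x 2) (y 1) \<otimes> commutator G (x 2) (y 2) =
      commutator G (x 2) (y 2) \<otimes> commutator G (x 2) (y 1)"
    by (rule group_centerD(2)[OF x2_y2, symmetric]) simp
  then have "commutator G (commutator G (x 2) (y 1)) (y 2) =
      commutator G (commutator G (x 2) (y 2)) (y 1)"
    using y1_y2 by (intro commutator_exchange) simp_all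
  also have "\<dots> = \<one>" using commutator_central(1)[OF x2_y2] by simp
  finally have "commutator G (inv (z 2)) (y 2) = \<one>" by (simp add: inv_commutator z_def)
  then have "inv (commutator G (z 2) (y 2)) = \<one>"
    using z_commutator_central(2)[of 2 2] by (simp add: commutator_inv_left)
  then show ?thesis by simp
qed

lemma z_pow: "i \<in> {1, 2} \<Longrightarrow> z i [^] p = \<one>"
  unfolding z_def
  by (rule commutator_pow_eq_one)
     (use odd_p x_closed y_closed x_pow z_pow_central z_x in auto)

lemma central_commutator_pow:
  assumes a: "a \<in> carrier G" and b: "b \<in> carrier G" and ab: "commutator G a b \<in> group_center G"
    and b_pow: "b [^] p = \<one>"
  shows "commutator G a b [^] p = \<one>"
  by (rule commutator_pow_eq_one)
     (use assms odd_p nat_pow_in_group_center[OF ab] one_in_group_center commutator_central[OF ab]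
       in simp_all)

text \<open>For \<open>w\<^sub>2 = [y\<^sub>2, x\<^sub>1] z\<^sub>2\<inverse>\<close> both factors have order dividing \<open>p\<close>, and they
  commute; the other \<open>w\<^sub>j\<close> are themselves central commutators.\<close>

lemma w_pow: "w j [^] p = \<one>"
proof -
  let ?t = "commutator G (y 2) (x 1)"
  have "?t [^] p = \<one>"
  proof (rule commutator_pow_eq_one)
    show "?t [^] p \<in> group_center G"
    proof -
      have "?t [^] p = z 2 [^] p \<otimes> w 2 [^] p"
        unfolding y2_x1_eq
        using pow_mult_distrib[of "z 2" "w 2" p] group_centerD(1)[OF w_central]
          group_centerD(2)[OF w_central, of "z 2" 2] by simp
      then show ?thesis
        using z_pow[of 2] nat_pow_in_group_center[OF w_central] group_centerD(1)[OF w_central]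
        by simp
    qed
    show "commutator G ?t (x 1) \<in> group_center G"
      using z_commutator_central(1)[of 2 1] by (simp add: commutator_y2_x1)
  qed (use odd_p x_pow in simp_all)
  moreover have "?t [^] p = z 2 [^] p \<otimes> w 2 [^] p"
    unfolding y2_x1_eq
    using pow_mult_distrib[of "z 2" "w 2" p] group_centerD(1)[OF w_central]
      group_centerD(2)[OF w_central, of "z 2" 2] by simp
  ultimately have "w 2 [^] p = \<one>"
    using z_pow[of 2] group_centerD(1)[OF w_central] by simp
  then show ?thesis
    using central_commutator_pow[OF _ _ x2_x1] central_commutator_pow[OF _ _ y2_x2]
      central_commutator_pow[OF _ _ y2_y1] x_pow y_pow by (simp add: w_def)
qed

lemma name_val_unstated:
  assumes a: "a \<in> names" and b: "b \<in> names"
    and unstated: "(a, b) \<notin> stated_pairs" "(b, a) \<notin> stated_pairs"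
  shows "commutator G (name_val a) (name_val b) = \<one>"
proof -
  have closed: "name_val c \<in> carrier G" if "c \<in> names" for c
    using that group_centerD(1)[OF w_central] x_closed y_closed
    by (auto simp: names_def index_sets)
  let ?small = "{Nx 1, Nx 2, Ny 1, Ny 2, Nz 1, Nz 2}"
  have central: "name_val c \<in> group_center G" if "c \<in> names - ?small" for c
    using that w_central z_commutator_central[of 1] by (auto simp: names_def index_sets)
  consider "name_val a \<in> group_center G" | "name_val b \<in> group_center G"
    | "a \<in> ?small" "b \<in> ?small"
    using central a b by blast
  then show ?thesis
  proof cases
    case 3
    have z: "commutator G (z 1) (z 2) = \<one>" "commutator G (z 2) (z 1) = \<one>"
      using z2_z1 by (simp_all add: commutator_eq_one_iff)
    have zx: "commutator G (x 2) (z 2) = \<one>" "commutator G (y 2) (z 2) = \<one>"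
      using z2_x2 z2_y2 commutator_commute_swap[of "z 2" "x 2"]
        commutator_commute_swap[of "z 2" "y 2"] by simp_all
    have self: "commutator G g g = \<one>" if "g \<in> carrier G" for g
      using that by (simp add: commutator_eq_one_iff)
    have "a = b \<or> (a, b) \<in> {(Nz 1, Nz 2), (Nz 2, Nz 1), (Nz 2, Nx 2), (Nx 2, Nz 2),
        (Nz 2, Ny 2), (Ny 2, Nz 2)}"
      using 3 unstated by (elim insertE emptyE; simp add: stated_pairs_def)
    then show ?thesis
      by (elim disjE insertE emptyE)
        (simp_all only: prod.inject name_val.simps z zx z2_x2 z2_y2 self[OF closed[OF b]])
  qed (use closed a b in \<open>simp_all add: commutator_central\<close>)
qed

end

lemma (in group_hom) hom_commutator:
  "a \<in> carrier G \<Longrightarrow> b \<in> carrier G \<Longrightarrow> h (commutator G a b) = commutator H (h a) (h b)"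
  by (simp add: commutator_def)

lemma Fr_closed:
  "i \<in> {1, 2} \<Longrightarrow> el_x i \<in> carrier Fr" "i \<in> {1, 2} \<Longrightarrow> el_y i \<in> carrier Fr"
  "i \<in> {1, 2} \<Longrightarrow> el_z i \<in> carrier Fr" "el_w j \<in> carrier Fr"
  "n \<in> names \<Longrightarrow> val n \<in> carrier Fr"
proof -
  interpret F: group Fr by (rule group_free_group)
  have x: "el_x i \<in> carrier Fr" and y: "el_y i \<in> carrier Fr" if "i \<in> {1, 2}" for i
    using that by (auto simp: el_x_def el_y_def free_group_def free_gen_def gens_def)
  have z: "el_z i \<in> carrier Fr" if "i \<in> {1, 2}" for i
    using that x[of i] y[of 1] by (simp add: el_z_def)
  have w: "el_w j \<in> carrier Fr" for j
    using x[of 1] x[of 2] y[of 1] y[of 2] z[of 2] by (simp add: el_w_def)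
  show "i \<in> {1, 2} \<Longrightarrow> el_x i \<in> carrier Fr" "i \<in> {1, 2} \<Longrightarrow> el_y i \<in> carrier Fr"
    "i \<in> {1, 2} \<Longrightarrow> el_z i \<in> carrier Fr" "el_w j \<in> carrier Fr" using x y z w by auto
  show "val n \<in> carrier Fr" if "n \<in> names"
    using that x y z w by (auto simp: names_def index_sets el_u_def el_v_def)
qed

lemma relationsE:
  assumes "(l, r) \<in> relations p"
  obtains
      "l = comm (el_z 2) (el_x 1)" "r = comm (el_z 1) (el_x 2)"
    | "l = comm (el_z 2) (el_y 1)" "r = comm (el_z 1) (el_y 2)"
    | i where "i \<in> {1, 2}" "l = el_x i [^]\<^bsub>Fr\<^esub> p" "r = \<one>\<^bsub>Fr\<^esub>"
    | i where "i \<in> {1, 2}" "l = el_y i [^]\<^bsub>Fr\<^esub> p" "r = \<one>\<^bsub>Fr\<^esub>"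
    | i where "i \<in> {1, 2}" "l = el_z i [^]\<^bsub>Fr\<^esub> p" "r = \<one>\<^bsub>Fr\<^esub>"
    | j where "l = el_w j [^]\<^bsub>Fr\<^esub> p" "r = \<one>\<^bsub>Fr\<^esub>"
    | a b where "a \<in> names" "b \<in> names" "(a, b) \<notin> stated_pairs" "(b, a) \<notin> stated_pairs"
        "l = comm (val a) (val b)" "r = \<one>\<^bsub>Fr\<^esub>"
  using assms[unfolded relations_def index_sets]
proof (elim UnE UN_E)
  assume "(l, r) \<in> {(comm (el_z 2) (el_x 1), comm (el_z 1) (el_x 2)),
      (comm (el_z 2) (el_y 1), comm (el_z 1) (el_y 2))}"
  then show thesis by (elim insertE emptyE Pair_inject) (rule that(1) that(2); assumption)+
next
  fix i :: nat
  assume i: "i \<in> {1, 2}"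
    and lr: "(l, r) \<in> {(el_x i [^]\<^bsub>Fr\<^esub> p, \<one>\<^bsub>Fr\<^esub>), (el_y i [^]\<^bsub>Fr\<^esub> p, \<one>\<^bsub>Fr\<^esub>),
      (el_z i [^]\<^bsub>Fr\<^esub> p, \<one>\<^bsub>Fr\<^esub>)}"
  from lr show thesis
    by (elim insertE emptyE Pair_inject) (rule that(3,4,5)[OF i]; assumption)+
next
  fix j :: nat
  assume "(l, r) \<in> {(el_w j [^]\<^bsub>Fr\<^esub> p, \<one>\<^bsub>Fr\<^esub>)}"
  then show thesis by (intro that(6)[of j]) (elim insertE emptyE Pair_inject; assumption)+
next
  assume "(l, r) \<in> {(comm (val a) (val b), \<one>\<^bsub>Fr\<^esub>) |a b.
      a \<in> names \<and> b \<in> names \<and> (a, b) \<notin> stated_pairs \<and> (b, a) \<notin> stated_pairs}"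
  then show thesis
    by (elim CollectE exE conjE Pair_inject) (rule that(7); assumption)
qed

lemma relations_closed:
  assumes "(l, r) \<in> relations p"
  shows "l \<in> carrier Fr \<and> r \<in> carrier Fr"
proof -
  interpret F: group Fr by (rule group_free_group)
  from assms show ?thesis by (cases rule: relationsE) (use Fr_closed in auto)
qed

context heisenberg_lift begin

lemma gen_val_closed: "gen_val x y \<in> gens \<rightarrow> carrier G"
  by (auto simp: gens_def)

lemma free_lift_names:
  "i \<in> {1, 2} \<Longrightarrow> free_lift G (gen_val x y) (el_x i) = x i"
  "i \<in> {1, 2} \<Longrightarrow> free_lift G (gen_val x y) (el_y i) = y i"
  "i \<in> {1, 2} \<Longrightarrow> free_lift G (gen_val x y) (el_z i) = z i"
  "free_lift G (gen_val x y) (el_w j) = w j"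
  "n \<in> names \<Longrightarrow> free_lift G (gen_val x y) (val n) = name_val n"
proof -
  interpret F: group Fr by (rule group_free_group)
  interpret h: group_hom Fr G "free_lift G (gen_val x y)"
    by (simp add: group_hom_def group_hom_axioms_def group_axioms
        free_lift_hom[OF gen_val_closed])
  note Fr = Fr_closed(1-4) Fr_closed(1)[of 1, simplified] Fr_closed(1)[of 2, simplified]
    Fr_closed(2)[of 1, simplified] Fr_closed(2)[of 2, simplified]
    Fr_closed(3)[of 1, simplified] Fr_closed(3)[of 2, simplified]
  have x: "free_lift G (gen_val x y) (el_x i) = x i"
    and y: "free_lift G (gen_val x y) (el_y i) = y i" if "i \<in> {1, 2}" for i
    using that x_closed y_closed by (auto simp: el_x_def el_y_def free_lift_free_gen)
  have z: "free_lift G (gen_val x y) (el_z i) = z i" if "i \<in> {1, 2}" for i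
    using that Fr x[of i] y[of 1] by (simp add: el_z_def z_def h.hom_commutator)
  have w: "free_lift G (gen_val x y) (el_w j) = w j" for j
    using Fr x[of 1] x[of 2] y[of 1] y[of 2] z[of 2]
    by (simp add: el_w_def w_def h.hom_commutator)
  show "i \<in> {1, 2} \<Longrightarrow> free_lift G (gen_val x y) (el_x i) = x i"
    "i \<in> {1, 2} \<Longrightarrow> free_lift G (gen_val x y) (el_y i) = y i"
    "i \<in> {1, 2} \<Longrightarrow> free_lift G (gen_val x y) (el_z i) = z i"
    "free_lift G (gen_val x y) (el_w j) = w j"
    using x y z w by auto
  show "free_lift G (gen_val x y) (val n) = name_val n" if "n \<in> names"
    using that x y z w Fr
    by (auto simp: names_def index_sets el_u_def el_v_def h.hom_commutator)
qed

text \<open>The relations that are left after the definitions of the names have been absorbed are exactly the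
  facts collected in this locale.\<close>

theorem free_lift_relations:
  assumes "(l, r) \<in> relations p"
  shows "free_lift G (gen_val x y) l = free_lift G (gen_val x y) r"
proof -
  interpret F: group Fr by (rule group_free_group)
  interpret h: group_hom Fr G "free_lift G (gen_val x y)"
    by (simp add: group_hom_def group_hom_axioms_def group_axioms
        free_lift_hom[OF gen_val_closed])
  from assms show ?thesis
  proof (cases rule: relationsE)
    case 1
    then show ?thesis using Fr_closed free_lift_names z2_x1 by (simp add: h.hom_commutator)
  next
    case 2
    then show ?thesis using Fr_closed free_lift_names z2_y1 by (simp add: h.hom_commutator)
  next
    case (3 i)
    then show ?thesis using Fr_closed(1)[OF 3(1)] free_lift_names x_pow by (simp add: h.hom_nat_pow)
  next
    case (4 i)
    then show ?thesis using Fr_closed(2)[OF 4(1)] free_lift_names y_pow by (simp add: h.hom_nat_pow)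
  next
    case (5 i)
    then show ?thesis using Fr_closed(3)[OF 5(1)] free_lift_names z_pow by (simp add: h.hom_nat_pow)
  next
    case (6 j)
    then show ?thesis using Fr_closed(4) free_lift_names w_pow by (simp add: h.hom_nat_pow)
  next
    case (7 a b)
    then show ?thesis
      using Fr_closed(5) free_lift_names(5) name_val_unstated by (simp add: h.hom_commutator)
  qed
qed

end

section \<open>A normal form\<close>

context group begin

text \<open>The hypothesis on commutators says that conjugation by \<open>g\<close> maps \<open>\<langle>S\<rangle>\<close> into itself, so powers of
  \<open>g\<close> can be collected on the left. The same holds for conjugation by the
  inverse of \<open>g\<close>, which is a power of \<open>g\<close>.\<close>

lemma generate_insert_normalizing:
  fixes p :: nat
  assumes S: "S \<subseteq> carrier G" and g: "g \<in> carrier G" and p: "p > 0" and gp: "g [^] p = \<one>"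
    and norm: "\<And>s. s \<in> S \<Longrightarrow> commutator G s g \<in> generate G S"
  shows "generate G (insert g S) = (\<lambda>(a, m). g [^] a \<otimes> m) ` ({..<p} \<times> generate G S)"
proof
  let ?M = "generate G S"
  let ?T = "(\<lambda>(a, m). g [^] a \<otimes> m) ` ({..<p} \<times> ?M)"
  have Mc: "m \<in> carrier G" if "m \<in> ?M" for m using generate_in_carrier[OF S that] .
  have red: "g [^] (n mod p) = g [^] n" for n
  proof -
    have "g [^] (p * (n div p)) = \<one>" using nat_pow_pow[OF g, of p "n div p"] gp by simp
    then show ?thesis using g nat_pow_mult[OF g, of "p * (n div p)" "n mod p"] by simp
  qed
  have TI: "g [^] (n :: nat) \<otimes> m \<in> ?T" if "m \<in> ?M" for n m
    using that p red[of n] by (auto intro!: image_eqI[of _ _ "(n mod p, m)"])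
  have swap1: "\<exists>m'\<in>?M. m \<otimes> g = g \<otimes> m'" if "m \<in> ?M" for m
    using that
  proof (induction rule: generate.induct)
    case one
    then show ?case using g generate.one by force
  next
    case (incl s)
    then have s: "s \<in> carrier G" using S by auto
    show ?case
      using mult_eq_mult_commutator[OF s g] s g m_assoc
        generate.eng[OF generate.incl[OF incl] norm[OF incl]]
      by (intro bexI[of _ "s \<otimes> commutator G s g"]) simp_all
  next
    case (inv s)
    then have s: "s \<in> carrier G" using S by auto
    let ?m = "s \<otimes> commutator G s g"
    have m: "?m \<in> ?M" using generate.eng[OF generate.incl[OF inv] norm[OF inv]] .
    have "s \<otimes> g = g \<otimes> ?m" using mult_eq_mult_commutator[OF s g] s g m_assoc by simp
    then have "inv s \<otimes> (g \<otimes> ?m) = g" using s g by (simp add: mult_inv_cancel_left flip: \<open>s \<otimes> g = g \<otimes> ?m\<close>)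
    then have "inv s \<otimes> g \<otimes> ?m \<otimes> inv ?m = g \<otimes> inv ?m" using s g by (simp add: m_assoc)
    then have "inv s \<otimes> g = g \<otimes> inv ?m"
      using s g m_assoc[of "inv s \<otimes> g" ?m "inv ?m"] by simp
    then show ?case using generate_m_inv_closed[OF S m] by blast
  next
    case (eng m n)
    then obtain m' n' where m': "m' \<in> ?M" "m \<otimes> g = g \<otimes> m'" and n': "n' \<in> ?M" "n \<otimes> g = g \<otimes> n'"
      by blast
    have "m \<otimes> n \<otimes> g = m \<otimes> (g \<otimes> n')" using eng Mc g n' by (simp add: m_assoc)
    also have "\<dots> = (m \<otimes> g) \<otimes> n'" using eng Mc g n' by (simp add: m_assoc)
    also have "\<dots> = g \<otimes> (m' \<otimes> n')" using Mc g m' n' by (simp add: m_assoc)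
    finally show ?case using generate.eng[OF m'(1) n'(1)] by blast
  qed
  have swap: "\<exists>m'\<in>?M. m \<otimes> g [^] n = g [^] n \<otimes> m'" if "m \<in> ?M" for m and n :: nat
  proof (induction n)
    case 0
    then show ?case using that Mc by auto
  next
    case (Suc n)
    then obtain m' where m': "m' \<in> ?M" "m \<otimes> g [^] n = g [^] n \<otimes> m'" by blast
    obtain m'' where m'': "m'' \<in> ?M" "m' \<otimes> g = g \<otimes> m''" using swap1[OF m'(1)] by blast
    have "m \<otimes> g [^] Suc n = (m \<otimes> g [^] n) \<otimes> g" using that Mc g by (simp add: m_assoc)
    also have "\<dots> = g [^] n \<otimes> (m' \<otimes> g)" using m' Mc g by (simp add: m_assoc)
    also have "\<dots> = g [^] Suc n \<otimes> m''" using m'' Mc g by (simp add: m_assoc)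
    finally show ?case using m'' by blast
  qed
  have "subgroup ?T G"
  proof (rule subgroupI)
    show "?T \<subseteq> carrier G" using g Mc by auto
    show "?T \<noteq> {}" using p generate.one[of G S] by auto
  next
    fix h assume "h \<in> ?T"
    then obtain a :: nat and m where am: "m \<in> ?M" "h = g [^] a \<otimes> m" by auto
    have "g [^] a \<otimes> g [^] (a * (p - 1)) = (g [^] p) [^] a"
      using g p by (simp add: nat_pow_mult nat_pow_pow) (cases p; simp add: algebra_simps)
    then have "inv (g [^] a) = g [^] (a * (p - 1))"
      using g gp by (intro inv_unique'[symmetric]) (simp_all add: nat_pow_mult add.commute)
    then have "inv h = inv m \<otimes> g [^] (a * (p - 1))" using am g Mc by (simp add: inv_mult_group)
    then show "inv h \<in> ?T" using swap[OF generate_m_inv_closed[OF S am(1)]] TI by metis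
  next
    fix h k assume "h \<in> ?T" "k \<in> ?T"
    then obtain a :: nat and m and b :: nat and n where am: "m \<in> ?M" "h = g [^] a \<otimes> m" and bn: "n \<in> ?M" "k = g [^] b \<otimes> n"
      by auto
    obtain m' where m': "m' \<in> ?M" "m \<otimes> g [^] b = g [^] b \<otimes> m'" using swap[OF am(1)] by blast
    have "h \<otimes> k = g [^] a \<otimes> (m \<otimes> g [^] b) \<otimes> n" using am bn g Mc by (simp add: m_assoc)
    also have "\<dots> = (g [^] a \<otimes> g [^] b) \<otimes> (m' \<otimes> n)" using m' bn g Mc by (simp add: m_assoc)
    also have "\<dots> = g [^] (a + b) \<otimes> (m' \<otimes> n)" using g by (simp add: nat_pow_mult)
    finally show "h \<otimes> k \<in> ?T" using TI[OF generate.eng[OF m'(1) bn(1)]] by metis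
  qed
  moreover have "g \<in> ?T" using TI[OF generate.one, of 1] g by simp
  moreover have "s \<in> ?T" if "s \<in> S" for s
  proof -
    have "g [^] (0 :: nat) \<otimes> s = s" using that S g by auto
    then show ?thesis using TI[OF generate.incl[OF that], of 0] by simp
  qed
  ultimately have "subgroup ?T G" "insert g S \<subseteq> ?T" by auto
  then show "generate G (insert g S) \<subseteq> ?T" by (rule generate_subgroup_incl[rotated])
  have "m \<in> generate G (insert g S)" if "m \<in> ?M" for m
    using that mono_generate[of S "insert g S"] by auto
  moreover have "g [^] (n :: nat) \<in> generate G (insert g S)" for n
    by (induction n) (auto intro: generate.one generate.eng generate.incl)
  ultimately show "?T \<subseteq> generate G (insert g S)" by (auto intro: generate.eng)
qed

lemma finite_generate_insert:
  fixes p :: nat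
  assumes "S \<subseteq> carrier G" "g \<in> carrier G" "p > 0" "g [^] p = \<one>"
    and "\<And>s. s \<in> S \<Longrightarrow> commutator G s g \<in> generate G S" and "finite (generate G S)"
  shows "finite (generate G (insert g S))"
  using assms by (subst generate_insert_normalizing) auto

lemma generate_insertE:
  fixes p :: nat
  assumes "h \<in> generate G (insert g S)" "S \<subseteq> carrier G" "g \<in> carrier G" "p > 0" "g [^] p = \<one>"
    and "\<And>s. s \<in> S \<Longrightarrow> commutator G s g \<in> generate G S"
  obtains a :: nat and m where "m \<in> generate G S" "h = g [^] a \<otimes> m"
proof -
  have "h \<in> (\<lambda>(a, m). g [^] a \<otimes> m) ` ({..<p} \<times> generate G S)"
    using assms(1) generate_insert_normalizing[OF assms(2-6)] by simp
  then show thesis using that by auto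
qed

lemma finite_generate_central:
  fixes p :: nat
  assumes "finite S" "S \<subseteq> group_center G" "p > 0" "\<And>s. s \<in> S \<Longrightarrow> s [^] p = \<one>"
  shows "finite (generate G S)"
  using assms(1,2,4)
proof (induction S rule: finite_induct)
  case empty
  then show ?case by (simp add: generate_empty)
next
  case (insert g S)
  have c: "s \<in> carrier G" if "s \<in> insert g S" for s
    using that insert.prems group_centerD(1) by blast
  show ?case
    by (rule finite_generate_insert[where p = p])
      (use insert assms(3) c commutator_central generate.one in auto)
qed

lemma generate_central:
  assumes "S \<subseteq> group_center G"
  shows "generate G S \<subseteq> group_center G"
  using generate_subgroup_incl[OF assms subgroup_group_center] .

lemma generate_central_pow:
  fixes p :: nat
  assumes S: "S \<subseteq> group_center G" and pow: "\<And>s. s \<in> S \<Longrightarrow> s [^] p = \<one>"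
    and g: "g \<in> generate G S"
  shows "g [^] p = \<one>"
  using g
proof (induction rule: generate.induct)
  case (inv s)
  then show ?case using pow[OF inv] S group_centerD(1)[of s] by (auto simp: nat_pow_inv)
next
  case (eng a b)
  have "a \<in> group_center G" "b \<in> group_center G" using eng generate_central[OF S] by auto
  then show ?case
    using eng.IH pow_mult_distrib[OF group_centerD(2)] group_centerD(1) by simp
qed (use pow in simp_all)

lemma central_if_commutes_with_generators:
  assumes S: "S \<subseteq> carrier G" "generate G S = carrier G" and c: "c \<in> carrier G"
    and comm: "\<And>s. s \<in> S \<Longrightarrow> commutator G c s = \<one>"
  shows "c \<in> group_center G"
proof -
  have "c \<otimes> g = g \<otimes> c" if "g \<in> generate G S" for g
    using that
  proof (induction rule: generate.induct)
    case (incl s)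
    then show ?case using comm[OF incl] S c by (auto simp: commutator_eq_one_iff)
  next
    case (inv s)
    then have s: "s \<in> carrier G" "c \<otimes> s = s \<otimes> c"
      using comm[OF inv] S c by (auto simp: commutator_eq_one_iff)
    have "inv s \<otimes> c = inv s \<otimes> (c \<otimes> s) \<otimes> inv s" using s(1) c by (simp add: m_assoc)
    also have "\<dots> = c \<otimes> inv s" using s c by (simp add: m_assoc mult_inv_cancel_left)
    finally show ?case ..
  next
    case (eng a b)
    then have ab: "a \<in> carrier G" "b \<in> carrier G" using S by auto
    have "c \<otimes> (a \<otimes> b) = (a \<otimes> c) \<otimes> b" using eng ab c by (simp add: m_assoc[symmetric])
    also have "\<dots> = a \<otimes> b \<otimes> c" using eng ab c by (simp add: m_assoc)
    finally show ?case .
  qed (use c in simp)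
  then show ?thesis using c S by (auto simp: group_center_def)
qed

lemma commutator_in_derived:
  assumes "a \<in> carrier G" "b \<in> carrier G"
  shows "commutator G a b \<in> derived G (carrier G)"
  unfolding derived_def
  using assms
  by (intro generate.incl UN_I[of "inv a"] UN_I[of "inv b"]) (simp_all add: commutator_def)

end

text \<open>When \<open>x\<close> and \<open>y\<close> generate, everything that the Heisenberg group does not see comes from the
  central elements \<open>w\<^sub>j\<close>, \<open>u\<^sub>i\<close> and \<open>v\<^sub>i\<close>, which generate the subgroup \<open>central_part\<close>.\<close>

locale heisenberg_cover = heisenberg_lift +
  assumes generate_xy: "generate G {x 1, x 2, y 1, y 2} = carrier G"
begin

definition central_gens :: "'a set" where
  "central_gens = {w 1, w 2, w 3, w 4} \<union>
     {commutator G (z 1) (y 1), commutator G (z 1) (y 2),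
      commutator G (z 1) (x 1), commutator G (z 1) (x 2)}"

lemma central_gens_central: "central_gens \<subseteq> group_center G"
  using w_central z_commutator_central[of 1 1] z_commutator_central[of 1 2]
  by (simp add: central_gens_def)

lemma central_gens_pow: "c \<in> central_gens \<Longrightarrow> c [^] p = \<one>"
  using w_pow central_commutator_pow[OF _ _ z_commutator_central(1)[of 1 1]]
    central_commutator_pow[OF _ _ z_commutator_central(1)[of 1 2]]
    central_commutator_pow[OF _ _ z_commutator_central(2)[of 1 1]]
    central_commutator_pow[OF _ _ z_commutator_central(2)[of 1 2]] x_pow y_pow
  by (auto simp: central_gens_def)

definition central_part :: "'a set" where "central_part = generate G central_gens"

lemma p_pos: "p > 0" using odd_p by (cases p) auto

lemma central_part_central: "central_part \<subseteq> group_center G"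
  unfolding central_part_def by (rule generate_central[OF central_gens_central])

lemma central_part_pow: "c \<in> central_part \<Longrightarrow> c [^] p = \<one>"
  unfolding central_part_def
  by (rule generate_central_pow[OF central_gens_central central_gens_pow])

lemma subgroup_central_part: "subgroup central_part G"
  unfolding central_part_def
  by (rule generate_is_subgroup) (use central_gens_central group_centerD(1) in blast)

lemma central_part_derived: "central_part \<subseteq> derived G (carrier G)"
proof -
  have D: "subgroup (derived G (carrier G)) G" by (simp add: derived_is_subgroup)
  have "z 2 \<in> derived G (carrier G)" using commutator_in_derived by (simp add: z_def)
  then have "w j \<in> derived G (carrier G)" for j
    using commutator_in_derived subgroup.m_closed[OF D] subgroup.m_inv_closed[OF D]
    by (simp add: w_def)
  then have "central_gens \<subseteq> derived G (carrier G)"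
    using commutator_in_derived by (simp add: central_gens_def)
  then show ?thesis unfolding central_part_def using generate_subgroup_incl D by blast
qed

text \<open>In the chain of generating sets, each new generator has its commutators with the earlier ones in the
  subgroup generated by the earlier ones. So the group is built from \<open>central_part\<close> by adjoining
  \<open>z\<^sub>2, z\<^sub>1, y\<^sub>2, y\<^sub>1, x\<^sub>2, x\<^sub>1\<close> one at a time, and each step multiplies by powers of one
  element of order dividing \<open>p\<close>.\<close>

lemma normal_form:
  shows "finite (carrier G)" (is ?finite)
    and "g \<in> carrier G \<Longrightarrow> \<exists>(a::nat) (b::nat) (c::nat) (d::nat) (e::nat) (f::nat). \<exists>k\<in>central_part.
      g = x 1 [^] a \<otimes> (x 2 [^] b \<otimes> (y 1 [^] c \<otimes> (y 2 [^] d \<otimes> (z 1 [^] e \<otimes> (z 2 [^] f \<otimes> k)))))"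
proof -
  define S\<^sub>0 where "S\<^sub>0 = central_gens"
  define S\<^sub>1 where "S\<^sub>1 = insert (z 2) S\<^sub>0"
  define S\<^sub>2 where "S\<^sub>2 = insert (z 1) S\<^sub>1"
  define S\<^sub>3 where "S\<^sub>3 = insert (y 2) S\<^sub>2"
  define S\<^sub>4 where "S\<^sub>4 = insert (y 1) S\<^sub>3"
  define S\<^sub>5 where "S\<^sub>5 = insert (x 2) S\<^sub>4"
  define S\<^sub>6 where "S\<^sub>6 = insert (x 1) S\<^sub>5"
  note S_defs = S\<^sub>0_def S\<^sub>1_def S\<^sub>2_def S\<^sub>3_def S\<^sub>4_def S\<^sub>5_def S\<^sub>6_def
  have S0: "S\<^sub>0 \<subseteq> carrier G" using central_gens_central group_centerD(1) S\<^sub>0_def by blast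
  have S1: "S\<^sub>1 \<subseteq> carrier G" and S2: "S\<^sub>2 \<subseteq> carrier G" and S3: "S\<^sub>3 \<subseteq> carrier G"
    and S4: "S\<^sub>4 \<subseteq> carrier G" and S5: "S\<^sub>5 \<subseteq> carrier G" and S6: "S\<^sub>6 \<subseteq> carrier G"
    using S0 by (auto simp: S_defs)
  have central: "commutator G c g \<in> generate G S" if "c \<in> S\<^sub>0" "g \<in> carrier G" for c g S
    using that central_gens_central commutator_central(1)[of c g] generate.one[of G S]
    unfolding S\<^sub>0_def by auto
  have one: "commutator G g h \<in> generate G S" if "commutator G g h = \<one>" for g h S
    using that generate.one[of G S] by simp
  have w_eq: "w 1 = commutator G (x 2) (x 1)" "w 3 = commutator G (y 2) (x 2)"
    "w 4 = commutator G (y 2) (y 1)" by (simp_all add: w_def)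
  have S0_mem: "w 1 \<in> S\<^sub>0" "w 2 \<in> S\<^sub>0" "w 3 \<in> S\<^sub>0" "w 4 \<in> S\<^sub>0"
    "commutator G (z 1) (y 1) \<in> S\<^sub>0" "commutator G (z 1) (y 2) \<in> S\<^sub>0"
    "commutator G (z 1) (x 1) \<in> S\<^sub>0" "commutator G (z 1) (x 2) \<in> S\<^sub>0"
    by (simp_all add: S\<^sub>0_def central_gens_def)
  have c1: "commutator G s (z 2) \<in> generate G S\<^sub>0" if "s \<in> S\<^sub>0" for s
    using that central by simp
  have c2: "commutator G s (z 1) \<in> generate G S\<^sub>1" if "s \<in> S\<^sub>1" for s
    using that central one[of "z 2" "z 1"] z2_z1 by (auto simp: S\<^sub>1_def commutator_eq_one_iff)
  have c3: "commutator G s (y 2) \<in> generate G S\<^sub>2" if "s \<in> S\<^sub>2" for s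
    using that central one[of "z 2" "y 2"] z2_y2 S0_mem(6)
    by (auto simp: S\<^sub>2_def S\<^sub>1_def intro: generate.incl)
  have c4: "commutator G s (y 1) \<in> generate G S\<^sub>3" if "s \<in> S\<^sub>3" for s
    using that central z2_y1 w_eq S0_mem
    by (auto simp: S\<^sub>3_def S\<^sub>2_def S\<^sub>1_def intro: generate.incl)
  have c5: "commutator G s (x 2) \<in> generate G S\<^sub>4" if "s \<in> S\<^sub>4" for s
    using that central z2_x2 one[of "z 2" "x 2"] w_eq S0_mem
    by (auto simp: S\<^sub>4_def S\<^sub>3_def S\<^sub>2_def S\<^sub>1_def simp flip: z_def intro: generate.incl)
  have "z 2 \<otimes> w 2 \<in> generate G S\<^sub>5"
    by (intro generate.eng generate.incl)
       (use S0_mem in \<open>auto simp: S\<^sub>5_def S\<^sub>4_def S\<^sub>3_def S\<^sub>2_def S\<^sub>1_def\<close>)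
  then have c6: "commutator G s (x 1) \<in> generate G S\<^sub>5" if "s \<in> S\<^sub>5" for s
    using that central z2_x1 w_eq S0_mem y2_x1_eq z_def[of 1]
    by (auto simp: S\<^sub>5_def S\<^sub>4_def S\<^sub>3_def S\<^sub>2_def S\<^sub>1_def intro: generate.incl)
  have "{x 1, x 2, y 1, y 2} \<subseteq> S\<^sub>6" by (auto simp: S_defs)
  then have full: "generate G S\<^sub>6 = carrier G"
    using mono_generate[of "{x 1, x 2, y 1, y 2}" S\<^sub>6] generate_xy generate_in_carrier[OF S6]
    by blast
  note z_pow' = z_pow[of 1, simplified] z_pow[of 2, simplified]
  note xy_pow = x_pow[of 1, simplified] x_pow[of 2, simplified] y_pow[of 1, simplified] y_pow[of 2, simplified]
  have "finite (generate G S\<^sub>0)"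
    unfolding S\<^sub>0_def
    by (rule finite_generate_central[OF _ central_gens_central p_pos central_gens_pow])
       (auto simp: central_gens_def)
  then have "finite (generate G S\<^sub>1)" unfolding S\<^sub>1_def
    using finite_generate_insert[OF S0 _ p_pos _ c1] z_pow' by simp
  then have "finite (generate G S\<^sub>2)" unfolding S\<^sub>2_def
    using finite_generate_insert[OF S1 _ p_pos _ c2] z_pow' by simp
  then have "finite (generate G S\<^sub>3)" unfolding S\<^sub>3_def
    using finite_generate_insert[OF S2 _ p_pos _ c3] xy_pow by simp
  then have "finite (generate G S\<^sub>4)" unfolding S\<^sub>4_def
    using finite_generate_insert[OF S3 _ p_pos _ c4] xy_pow by simp
  then have "finite (generate G S\<^sub>5)" unfolding S\<^sub>5_def
    using finite_generate_insert[OF S4 _ p_pos _ c5] xy_pow by simp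
  then have "finite (generate G S\<^sub>6)" unfolding S\<^sub>6_def
    using finite_generate_insert[OF S5 _ p_pos _ c6] xy_pow by simp
  then show ?finite using full by simp
  assume "g \<in> carrier G"
  then have g: "g \<in> generate G (insert (x 1) S\<^sub>5)" using full S\<^sub>6_def by simp
  obtain a :: nat and g5 where 6: "g5 \<in> generate G S\<^sub>5" "g = x 1 [^] a \<otimes> g5"
    by (rule generate_insertE[OF g S5 xy_closed(1) p_pos xy_pow(1) c6])
  obtain b :: nat and g4 where 5: "g4 \<in> generate G S\<^sub>4" "g5 = x 2 [^] b \<otimes> g4"
    by (rule generate_insertE[OF 6(1)[unfolded S\<^sub>5_def] S4 xy_closed(2) p_pos xy_pow(2) c5])
  obtain c :: nat and g3 where 4: "g3 \<in> generate G S\<^sub>3" "g4 = y 1 [^] c \<otimes> g3"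
    by (rule generate_insertE[OF 5(1)[unfolded S\<^sub>4_def] S3 xy_closed(3) p_pos xy_pow(3) c4])
  obtain d :: nat and g2 where 3: "g2 \<in> generate G S\<^sub>2" "g3 = y 2 [^] d \<otimes> g2"
    by (rule generate_insertE[OF 4(1)[unfolded S\<^sub>3_def] S2 xy_closed(4) p_pos xy_pow(4) c3])
  obtain e :: nat and g1 where 2: "g1 \<in> generate G S\<^sub>1" "g2 = z 1 [^] e \<otimes> g1"
    by (rule generate_insertE[OF 3(1)[unfolded S\<^sub>2_def] S1 z_closed(2) p_pos z_pow'(1) c2])
  obtain f :: nat and k where 1: "k \<in> generate G S\<^sub>0" "g1 = z 2 [^] f \<otimes> k"
    by (rule generate_insertE[OF 2(1)[unfolded S\<^sub>1_def] S0 z_closed(3) p_pos z_pow'(2) c1])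
  have eq: "g = x 1 [^] a \<otimes> (x 2 [^] b \<otimes> (y 1 [^] c \<otimes> (y 2 [^] d \<otimes> (z 1 [^] e \<otimes> (z 2 [^] f \<otimes> k)))))"
    by (simp only: 6(2) 5(2) 4(2) 3(2) 2(2) 1(2))
  have k: "k \<in> central_part" using 1(1) by (simp add: central_part_def S\<^sub>0_def)
  show "\<exists>(a::nat) (b::nat) (c::nat) (d::nat) (e::nat) (f::nat). \<exists>k\<in>central_part.
      g = x 1 [^] a \<otimes> (x 2 [^] b \<otimes> (y 1 [^] c \<otimes> (y 2 [^] d \<otimes> (z 1 [^] e \<otimes> (z 2 [^] f \<otimes> k)))))"
    by (rule exI[of _ a], rule exI[of _ b], rule exI[of _ c], rule exI[of _ d], rule exI[of _ e],
        rule exI[of _ f], rule bexI[of _ k], rule eq, rule k)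
qed

end

section \<open>Heisenberg groups over dual numbers\<close>

definition heis :: "('a, 'b) ring_scheme \<Rightarrow> 'a \<Rightarrow> 'a \<Rightarrow> 'a \<Rightarrow> 'a mat" where
  "heis R \<alpha> \<beta> \<gamma> = mat 3 3 (\<lambda>(i, j).
     if i = j then \<one>\<^bsub>R\<^esub> else if i = 0 \<and> j = 1 then \<alpha>
     else if i = 1 \<and> j = 2 then \<beta> else if i = 0 \<and> j = 2 then \<gamma> else \<zero>\<^bsub>R\<^esub>)"

lemma less_3_cases: "(i::nat) < 3 \<longleftrightarrow> i = 0 \<or> i = 1 \<or> i = 2"
  by auto

context cring begin

abbreviation "HG \<equiv> heisenberg_group R"

text \<open>Unitriangular \<open>3 \<times> 3\<close> matrices are handled through their three free entries from here on.\<close>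

lemma carrier_HG:
  "carrier HG = {heis R \<alpha> \<beta> \<gamma> | \<alpha> \<beta> \<gamma>. \<alpha> \<in> carrier R \<and> \<beta> \<in> carrier R \<and> \<gamma> \<in> carrier R}"
proof (intro equalityI subsetI)
  fix A assume "A \<in> carrier HG"
  then have A: "A \<in> carrier_mat 3 3" and e: "\<And>i j. i < 3 \<Longrightarrow> j < 3 \<Longrightarrow>
      A $$ (i, j) \<in> carrier R \<and> (i = j \<longrightarrow> A $$ (i, j) = \<one>) \<and> (j < i \<longrightarrow> A $$ (i, j) = \<zero>)"
    by (auto simp: heisenberg_group_def unitriangular_group_def)
  have "A = heis R (A $$ (0, 1)) (A $$ (1, 2)) (A $$ (0, 2))"
    using A e by (intro eq_matI) (auto simp: heis_def less_3_cases)
  then show "A \<in> {heis R \<alpha> \<beta> \<gamma> | \<alpha> \<beta> \<gamma>.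
      \<alpha> \<in> carrier R \<and> \<beta> \<in> carrier R \<and> \<gamma> \<in> carrier R}"
    using e[of 0 1] e[of 1 2] e[of 0 2] by auto
qed (auto simp: heisenberg_group_def unitriangular_group_def heis_def less_3_cases)

lemma carrier_HG_cases:
  assumes "A \<in> carrier HG"
  obtains \<alpha> \<beta> \<gamma> where "A = heis R \<alpha> \<beta> \<gamma>" "\<alpha> \<in> carrier R" "\<beta> \<in> carrier R" "\<gamma> \<in> carrier R"
  using assms by (auto simp: carrier_HG)

lemma heis_closed [simp]:
  "\<alpha> \<in> carrier R \<Longrightarrow> \<beta> \<in> carrier R \<Longrightarrow> \<gamma> \<in> carrier R \<Longrightarrow> heis R \<alpha> \<beta> \<gamma> \<in> carrier HG"
  by (auto simp: carrier_HG)

lemma finsum_3: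
  assumes "f 0 \<in> carrier R" "f 1 \<in> carrier R" "f 2 \<in> carrier R"
  shows "finsum R f {0..<3::nat} = f 0 \<oplus> f 1 \<oplus> f 2"
proof -
  have "{0..<3::nat} = {0, 1, 2}" by auto
  then show ?thesis using assms by (simp add: a_assoc)
qed

lemma heis_mult [simp]:
  assumes "\<alpha> \<in> carrier R" "\<beta> \<in> carrier R" "\<gamma> \<in> carrier R"
    "\<alpha>' \<in> carrier R" "\<beta>' \<in> carrier R" "\<gamma>' \<in> carrier R"
  shows "heis R \<alpha> \<beta> \<gamma> \<otimes>\<^bsub>HG\<^esub> heis R \<alpha>' \<beta>' \<gamma>' =
    heis R (\<alpha> \<oplus> \<alpha>') (\<beta> \<oplus> \<beta>') (\<gamma> \<oplus> \<gamma>' \<oplus> \<alpha> \<otimes> \<beta>')"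
proof -
  have "mat_mult_over R 3 (heis R \<alpha> \<beta> \<gamma>) (heis R \<alpha>' \<beta>' \<gamma>') =
      heis R (\<alpha> \<oplus> \<alpha>') (\<beta> \<oplus> \<beta>') (\<gamma> \<oplus> \<gamma>' \<oplus> \<alpha> \<otimes> \<beta>')"
    unfolding mat_mult_over_def
  proof (intro eq_matI)
    fix i j
    assume "i < dim_row (heis R (\<alpha> \<oplus> \<alpha>') (\<beta> \<oplus> \<beta>') (\<gamma> \<oplus> \<gamma>' \<oplus> \<alpha> \<otimes> \<beta>'))"
      and "j < dim_col (heis R (\<alpha> \<oplus> \<alpha>') (\<beta> \<oplus> \<beta>') (\<gamma> \<oplus> \<gamma>' \<oplus> \<alpha> \<otimes> \<beta>'))"
    then have ij: "i = 0 \<or> i = 1 \<or> i = 2" "j = 0 \<or> j = 1 \<or> j = 2"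
      by (simp_all add: heis_def less_3_cases)
    then have ij3: "i < 3" "j < 3" by auto
    let ?f = "\<lambda>k. heis R \<alpha> \<beta> \<gamma> $$ (i, k) \<otimes> heis R \<alpha>' \<beta>' \<gamma>' $$ (k, j)"
    have "?f k \<in> carrier R" if "k < 3" for k
      using assms ij that by (auto simp: heis_def)
    then have "finsum R ?f {0..<3} = ?f 0 \<oplus> ?f 1 \<oplus> ?f 2" by (intro finsum_3) auto
    also have "\<dots> = heis R (\<alpha> \<oplus> \<alpha>') (\<beta> \<oplus> \<beta>') (\<gamma> \<oplus> \<gamma>' \<oplus> \<alpha> \<otimes> \<beta>') $$ (i, j)"
      using assms ij by (elim disjE) (simp_all add: heis_def a_ac)
    finally show "mat 3 3 (\<lambda>(i, j). \<Oplus>k\<in>{0..<3}.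
        heis R \<alpha> \<beta> \<gamma> $$ (i, k) \<otimes> heis R \<alpha>' \<beta>' \<gamma>' $$ (k, j)) $$ (i, j) =
        heis R (\<alpha> \<oplus> \<alpha>') (\<beta> \<oplus> \<beta>') (\<gamma> \<oplus> \<gamma>' \<oplus> \<alpha> \<otimes> \<beta>') $$ (i, j)"
      using ij3 by simp
  qed (simp_all add: heis_def)
  then show ?thesis by (simp add: heisenberg_group_def unitriangular_group_def)
qed

lemma heis_one: "\<one>\<^bsub>HG\<^esub> = heis R \<zero> \<zero> \<zero>"
  by (intro eq_matI) (auto simp: heisenberg_group_def unitriangular_group_def heis_def)

lemma heis_eq_iff:
  "heis R \<alpha> \<beta> \<gamma> = heis R \<alpha>' \<beta>' \<gamma>' \<longleftrightarrow> \<alpha> = \<alpha>' \<and> \<beta> = \<beta>' \<and> \<gamma> = \<gamma>'"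
proof
  assume eq: "heis R \<alpha> \<beta> \<gamma> = heis R \<alpha>' \<beta>' \<gamma>'"
  have "heis R \<alpha> \<beta> \<gamma> $$ ij = heis R \<alpha>' \<beta>' \<gamma>' $$ ij" for ij by (simp add: eq)
  from this[of "(0, 1)"] this[of "(1, 2)"] this[of "(0, 2)"]
  show "\<alpha> = \<alpha>' \<and> \<beta> = \<beta>' \<and> \<gamma> = \<gamma>'" by (simp add: heis_def)
qed simp

lemma group_HG: "group HG"
proof (rule groupI)
  fix A B C assume "A \<in> carrier HG" "B \<in> carrier HG" "C \<in> carrier HG"
  then show "A \<otimes>\<^bsub>HG\<^esub> B \<otimes>\<^bsub>HG\<^esub> C = A \<otimes>\<^bsub>HG\<^esub> (B \<otimes>\<^bsub>HG\<^esub> C)"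
    by (auto simp: carrier_HG heis_eq_iff a_assoc) algebra
next
  fix A assume "A \<in> carrier HG"
  then obtain \<alpha> \<beta> \<gamma> where A: "A = heis R \<alpha> \<beta> \<gamma>"
    "\<alpha> \<in> carrier R" "\<beta> \<in> carrier R" "\<gamma> \<in> carrier R" by (auto simp: carrier_HG)
  have "heis R (\<ominus> \<alpha>) (\<ominus> \<beta>) (\<ominus> \<gamma> \<oplus> \<alpha> \<otimes> \<beta>) \<otimes>\<^bsub>HG\<^esub> A = \<one>\<^bsub>HG\<^esub>"
    using A(2-4) unfolding A(1) by (simp add: heis_one heis_eq_iff l_neg) algebra
  moreover have "heis R (\<ominus> \<alpha>) (\<ominus> \<beta>) (\<ominus> \<gamma> \<oplus> \<alpha> \<otimes> \<beta>) \<in> carrier HG" using A by simp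
  ultimately show "\<exists>B\<in>carrier HG. B \<otimes>\<^bsub>HG\<^esub> A = \<one>\<^bsub>HG\<^esub>" by blast
next
  fix A B assume "A \<in> carrier HG" "B \<in> carrier HG"
  then show "A \<otimes>\<^bsub>HG\<^esub> B \<in> carrier HG" by (auto elim!: carrier_HG_cases)
next
  fix A assume "A \<in> carrier HG"
  then show "\<one>\<^bsub>HG\<^esub> \<otimes>\<^bsub>HG\<^esub> A = A" by (auto elim!: carrier_HG_cases simp: heis_one)
qed (simp add: heis_one)

lemma heis_commutator:
  assumes "\<alpha> \<in> carrier R" "\<beta> \<in> carrier R" "\<gamma> \<in> carrier R"
    "\<alpha>' \<in> carrier R" "\<beta>' \<in> carrier R" "\<gamma>' \<in> carrier R"
  shows "commutator HG (heis R \<alpha> \<beta> \<gamma>) (heis R \<alpha>' \<beta>' \<gamma>') =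
    heis R \<zero> \<zero> (\<alpha> \<otimes> \<beta>' \<ominus> \<alpha>' \<otimes> \<beta>)"
  by (rule group.commutator_unique[OF group_HG])
     (use assms in \<open>simp_all add: heis_eq_iff a_comm\<close>, algebra)

lemma heis_central:
  assumes "\<gamma> \<in> carrier R"
  shows "heis R \<zero> \<zero> \<gamma> \<in> group_center HG"
  using assms by (auto simp: group_center_def carrier_HG heis_eq_iff a_comm)

lemma heis_pow:
  assumes "\<alpha> \<in> carrier R"
  shows "heis R \<alpha> \<zero> \<zero> [^]\<^bsub>HG\<^esub> (n::nat) = heis R (add_pow R n \<alpha>) \<zero> \<zero>"
    "heis R \<zero> \<alpha> \<zero> [^]\<^bsub>HG\<^esub> n = heis R \<zero> (add_pow R n \<alpha>) \<zero>"
    "heis R \<zero> \<zero> \<alpha> [^]\<^bsub>HG\<^esub> n = heis R \<zero> \<zero> (add_pow R n \<alpha>)"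
  using assms by (induction n) (simp_all add: heis_one)

end

text \<open>A ring that is free of rank two over \<open>\<int>/p\<close>, with basis \<open>1, t\<close> and
  \<open>t\<^sup>2 = 0\<close>.\<close>

locale dual_ring = cring R for R (structure) +
  fixes t :: 'a and p :: nat
  assumes t_closed [simp]: "t \<in> carrier R"
    and t_square [simp]: "t \<otimes> t = \<zero>"
    and characteristic: "add_pow R p \<one> = \<zero>"
    and spanning: "\<alpha> \<in> carrier R \<Longrightarrow> \<exists>(a::nat) (b::nat). \<alpha> = add_pow R a \<one> \<oplus> add_pow R b t"
    and independent: "add_pow R a \<one> \<oplus> add_pow R b t = \<zero> \<Longrightarrow> p dvd (a::nat) \<and> p dvd (b::nat)"
begin

definition lin :: "nat \<Rightarrow> nat \<Rightarrow> 'a" where "lin a b = add_pow R a \<one> \<oplus> add_pow R b t"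

lemma lin_closed [simp]: "lin a b \<in> carrier R"
  by (simp add: lin_def)

lemma spanning_lin: "\<alpha> \<in> carrier R \<Longrightarrow> \<exists>a b. \<alpha> = lin a b"
  using spanning by (simp add: lin_def)

lemma independent_lin: "lin a b = \<zero> \<Longrightarrow> p dvd a \<and> p dvd b"
  using independent by (simp add: lin_def)

definition hx :: "nat \<Rightarrow> 'a mat" where "hx i = heis R (if i = 1 then \<one> else t) \<zero> \<zero>"
definition hy :: "nat \<Rightarrow> 'a mat" where "hy i = heis R \<zero> (if i = 1 then \<one> else t) \<zero>"

lemma characteristic': "\<alpha> \<in> carrier R \<Longrightarrow> add_pow R p \<alpha> = \<zero>"
  using add_pow_ldistr[of \<one> \<alpha> p] characteristic by simp

lemma hz: "commutator HG (hy 1) (hx i) = heis R \<zero> \<zero> (\<ominus> (if i = 1 then \<one> else t))"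
  by (simp add: hx_def hy_def heis_commutator minus_eq)

text \<open>In the Heisenberg group itself all the required elements are central because a
  commutator differs from the identity matrix only in the top right entry.\<close>

lemma heisenberg_lift_HG:
  assumes "odd p"
  shows "heisenberg_lift HG p hx hy"
proof -
  interpret H: group HG by (rule group_HG)
  have one: "heis R \<zero> \<zero> \<zero> \<in> group_center HG" by (rule heis_central) simp
  show ?thesis
  proof
    show "commutator HG (hy 2) (hx 1) \<otimes>\<^bsub>HG\<^esub> inv\<^bsub>HG\<^esub> (commutator HG (hy 1) (hx 2)) \<in> group_center HG"
    proof -
      have "commutator HG (hy 2) (hx 1) = commutator HG (hy 1) (hx 2)"
        by (simp add: hx_def hy_def heis_commutator)
      then show ?thesis using H.one_in_group_center by (simp add: hz)
    qed
    show "commutator HG (hy 1) (hx i) [^]\<^bsub>HG\<^esub> p \<in> group_center HG" for i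
      unfolding hz by (rule H.nat_pow_in_group_center, rule heis_central) simp
  qed (use assms one in \<open>simp_all add: hx_def hy_def heis_commutator heis_pow heis_one
        characteristic' heis_central minus_eq\<close>)
qed

lemma heis_normal_form:
  fixes a b c d e f :: nat
  defines "z \<equiv> \<lambda>i. commutator HG (hy 1) (hx i)"
  shows "hx 1 [^]\<^bsub>HG\<^esub> a \<otimes>\<^bsub>HG\<^esub> (hx 2 [^]\<^bsub>HG\<^esub> b \<otimes>\<^bsub>HG\<^esub> (hy 1 [^]\<^bsub>HG\<^esub> c \<otimes>\<^bsub>HG\<^esub>
      (hy 2 [^]\<^bsub>HG\<^esub> d \<otimes>\<^bsub>HG\<^esub> (z 1 [^]\<^bsub>HG\<^esub> e \<otimes>\<^bsub>HG\<^esub> z 2 [^]\<^bsub>HG\<^esub> f)))) =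
    heis R (lin a b) (lin c d)
      (lin a b \<otimes> lin c d \<ominus> lin e f)"
proof -
  have neg: "add_pow R n (\<ominus> \<alpha>) = \<ominus> (add_pow R n \<alpha>)" if "\<alpha> \<in> carrier R" for n :: nat and \<alpha>
    using that by (rule add.nat_pow_inv)
  define A B C D E F where "A = add_pow R a \<one>" and "B = add_pow R b t" and "C = add_pow R c \<one>"
    and "D = add_pow R d t" and "E = add_pow R e \<one>" and "F = add_pow R f t"
  have closed: "A \<in> carrier R" "B \<in> carrier R" "C \<in> carrier R" "D \<in> carrier R"
    "E \<in> carrier R" "F \<in> carrier R"
    by (simp_all add: A_def B_def C_def D_def E_def F_def)
  show ?thesis
    unfolding z_def hz lin_def
    apply (simp add: hx_def hy_def heis_pow neg heis_eq_iff)
    apply (fold A_def B_def C_def D_def E_def F_def)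
    using closed by (simp add: minus_eq) algebra
qed

end

text \<open>A homomorphism from a cover to the Heisenberg group that matches the generators. It kills the
  central part, and comparing normal forms shows that it kills nothing else.\<close>

locale heisenberg_projection = cover: heisenberg_cover G p x y + dual_ring R t p
  for G :: "('g, 'm) monoid_scheme" and p x y and R :: "('r, 'n) ring_scheme" (structure) and t +
  fixes \<pi> :: "'g \<Rightarrow> 'r mat"
  assumes pi_hom: "\<pi> \<in> hom G HG"
    and pi_x: "i \<in> {1, 2} \<Longrightarrow> \<pi> (x i) = hx i"
    and pi_y: "i \<in> {1, 2} \<Longrightarrow> \<pi> (y i) = hy i"
begin

sublocale pi: group_hom G HG \<pi>
  by (simp add: group_hom_def group_hom_axioms_def cover.group_axioms group_HG pi_hom)

lemma pi_xy [simp]: "\<pi> (x 1) = hx 1" "\<pi> (x 2) = hx 2" "\<pi> (y 1) = hy 1" "\<pi> (y 2) = hy 2"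
  using pi_x pi_y by auto

lemma pi_z: "i \<in> {1, 2} \<Longrightarrow> \<pi> (cover.z i) = commutator HG (hy 1) (hx i)"
  using cover.x_closed[of i] pi_x[of i] by (simp add: cover.z_def pi.hom_commutator)

lemma pi_central_part:
  assumes "k \<in> cover.central_part"
  shows "\<pi> k = \<one>\<^bsub>HG\<^esub>"
proof -
  have "cover.central_gens \<subseteq> kernel G HG \<pi>"
  proof -
    have "c \<in> carrier G" if "c \<in> cover.central_gens" for c
      using that cover.central_gens_central cover.group_centerD(1) by blast
    moreover have "\<pi> c = \<one>\<^bsub>HG\<^esub>" if "c \<in> cover.central_gens" for c
    proof -
      have c: "commutator HG (hy 2) (hx 1) = commutator HG (hy 1) (hx 2)"
        by (simp add: hx_def hy_def heis_commutator)
      have "\<pi> (cover.w j) = \<one>\<^bsub>HG\<^esub>" for j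
        using pi_z[of 2] c
        by (simp add: cover.w_def pi.hom_commutator pi.hom_inv)
           (simp add: hx_def hy_def heis_commutator heis_one minus_eq)
      moreover have "\<pi> (commutator G (cover.z 1) g) = \<one>\<^bsub>HG\<^esub>" if "g \<in> carrier G" for g
      proof -
        have "\<pi> g \<in> carrier HG" using that by simp
        then show ?thesis using that pi_z[of 1]
          by (auto simp: pi.hom_commutator hz heis_commutator carrier_HG heis_one minus_eq)
      qed
      ultimately show ?thesis using that by (auto simp: cover.central_gens_def)
    qed
    ultimately show ?thesis by (auto simp: kernel_def)
  qed
  then have "cover.central_part \<subseteq> kernel G HG \<pi>"
    unfolding cover.central_part_def
    by (rule cover.generate_subgroup_incl) (rule pi.subgroup_kernel)
  then show ?thesis using assms by (auto simp: kernel_def)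
qed

lemma pi_normal_form:
  assumes k: "k \<in> cover.central_part"
  shows "\<pi> (x 1 [^]\<^bsub>G\<^esub> a \<otimes>\<^bsub>G\<^esub> (x 2 [^]\<^bsub>G\<^esub> b \<otimes>\<^bsub>G\<^esub> (y 1 [^]\<^bsub>G\<^esub> c \<otimes>\<^bsub>G\<^esub>
      (y 2 [^]\<^bsub>G\<^esub> d \<otimes>\<^bsub>G\<^esub> (cover.z 1 [^]\<^bsub>G\<^esub> e \<otimes>\<^bsub>G\<^esub> (cover.z 2 [^]\<^bsub>G\<^esub> f \<otimes>\<^bsub>G\<^esub> k)))))) =
    heis R (lin a b) (lin c d)
      (lin a b \<otimes> lin c d \<ominus>
        lin e f)"
proof -
  have kc: "k \<in> carrier G"
    using k cover.central_part_central cover.group_centerD(1) by blast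
  have "\<pi> (cover.z 2 [^]\<^bsub>G\<^esub> f \<otimes>\<^bsub>G\<^esub> k) = commutator HG (hy 1) (hx 2) [^]\<^bsub>HG\<^esub> f"
    using kc pi_central_part[OF k] pi_z[of 2] by (simp add: pi.hom_nat_pow hz)
  then show ?thesis
    unfolding heis_normal_form[symmetric] using kc pi_z[of 1] by (simp add: pi.hom_nat_pow)
qed

lemma pi_surj: "\<pi> ` carrier G = carrier HG"
proof
  show "carrier HG \<subseteq> \<pi> ` carrier G"
  proof
    fix A assume "A \<in> carrier HG"
    then obtain \<alpha> \<beta> \<gamma> where A: "A = heis R \<alpha> \<beta> \<gamma>"
      "\<alpha> \<in> carrier R" "\<beta> \<in> carrier R" "\<gamma> \<in> carrier R" by (auto simp: carrier_HG)
    obtain a b :: nat where ab: "\<alpha> = lin a b" using spanning_lin A by blast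
    obtain c d :: nat where cd: "\<beta> = lin c d" using spanning_lin A by blast
    obtain e f :: nat where ef: "\<alpha> \<otimes> \<beta> \<ominus> \<gamma> = lin e f"
      using spanning_lin[of "\<alpha> \<otimes> \<beta> \<ominus> \<gamma>"] A by auto
    have "\<gamma> = \<alpha> \<otimes> \<beta> \<ominus> (\<alpha> \<otimes> \<beta> \<ominus> \<gamma>)" using A(2-4) by algebra
    then have "A = \<pi> (x 1 [^]\<^bsub>G\<^esub> a \<otimes>\<^bsub>G\<^esub> (x 2 [^]\<^bsub>G\<^esub> b \<otimes>\<^bsub>G\<^esub> (y 1 [^]\<^bsub>G\<^esub> c \<otimes>\<^bsub>G\<^esub>
      (y 2 [^]\<^bsub>G\<^esub> d \<otimes>\<^bsub>G\<^esub> (cover.z 1 [^]\<^bsub>G\<^esub> e \<otimes>\<^bsub>G\<^esub> (cover.z 2 [^]\<^bsub>G\<^esub> f \<otimes>\<^bsub>G\<^esub> \<one>\<^bsub>G\<^esub>))))))"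
      using A(1) subgroup.one_closed[OF cover.subgroup_central_part]
      by (subst pi_normal_form) (simp_all flip: ab cd ef)
    then show "A \<in> \<pi> ` carrier G" by (rule image_eqI) simp
  qed
qed auto

lemma pi_kernel: "kernel G HG \<pi> = cover.central_part"
proof
  show "cover.central_part \<subseteq> kernel G HG \<pi>"
    using pi_central_part cover.central_part_central cover.group_centerD(1)
    by (auto simp: kernel_def)
  show "kernel G HG \<pi> \<subseteq> cover.central_part"
  proof
    fix g assume "g \<in> kernel G HG \<pi>"
    then have g: "g \<in> carrier G" "\<pi> g = heis R \<zero> \<zero> \<zero>" by (auto simp: kernel_def heis_one)
    obtain a b c d e f :: nat and k where k: "k \<in> cover.central_part" and
      nf: "g = x 1 [^]\<^bsub>G\<^esub> a \<otimes>\<^bsub>G\<^esub> (x 2 [^]\<^bsub>G\<^esub> b \<otimes>\<^bsub>G\<^esub> (y 1 [^]\<^bsub>G\<^esub> c \<otimes>\<^bsub>G\<^esub>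
      (y 2 [^]\<^bsub>G\<^esub> d \<otimes>\<^bsub>G\<^esub> (cover.z 1 [^]\<^bsub>G\<^esub> e \<otimes>\<^bsub>G\<^esub> (cover.z 2 [^]\<^bsub>G\<^esub> f \<otimes>\<^bsub>G\<^esub> k)))))"
      using cover.normal_form(2)[OF g(1)] by blast
    have "lin a b = \<zero> \<and> lin c d = \<zero> \<and>
        lin a b \<otimes> lin c d \<ominus> lin e f = \<zero>"
      using g(2) unfolding nf pi_normal_form[OF k] heis_eq_iff .
    then have zero: "lin a b = \<zero>" "lin c d = \<zero>"
      "lin e f = \<zero>"
      by (auto simp: minus_eq)
    have pow: "u [^]\<^bsub>G\<^esub> n = \<one>\<^bsub>G\<^esub>" if "p dvd n" "u \<in> carrier G" "u [^]\<^bsub>G\<^esub> p = \<one>\<^bsub>G\<^esub>" for u n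
      using that by (auto simp: cover.nat_pow_pow[symmetric] elim!: dvdE)
    have kc: "k \<in> carrier G"
      using k cover.central_part_central cover.group_centerD(1) by blast
    have "g = k"
      unfolding nf
      using independent_lin[OF zero(1)] independent_lin[OF zero(2)] independent_lin[OF zero(3)] kc
        cover.x_pow cover.y_pow cover.z_pow by (simp add: pow)
    then show "g \<in> cover.central_part" using k by simp
  qed
qed

lemma finite_HG: "finite (carrier HG)"
  using cover.normal_form(1) finite_imageI pi_surj by metis

end

section \<open>The dual numbers as a free module of rank two\<close>

lemma add_pow_Suc: "add_pow R (Suc n) a = add_pow R n a \<oplus>\<^bsub>R\<^esub> a"
  by (simp add: add_pow_def)

lemma ring_hom_add_pow:
  assumes "h \<in> Ring.ring_hom R S" "ring R" "ring S" "a \<in> carrier R"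
  shows "h (add_pow R (n::nat) a) = add_pow S n (h a)"
proof -
  interpret R: ring R by fact
  interpret S: ring S by fact
  interpret h: ring_hom_ring R S h
    by (rule ring_hom_ringI2) (use assms in auto)
  show ?thesis
    by (induction n) (use assms in \<open>simp_all add: add_pow_Suc\<close>)
qed

lemma residue_ring_add_pow: "m > 1 \<Longrightarrow> add_pow (residue_ring m) (n::nat) 1 = int n mod m"
  by (induction n) (simp_all add: add_pow_Suc, simp_all add: residue_ring_def add_pow_def mod_simps add.commute)

text \<open>Division with remainder by the polynomial \<open>X\<close> of degree one leaves a constant.\<close>

lemma (in field) univ_poly_split_var:
  assumes f: "f \<in> carrier (poly_ring R)"
  obtains q c where "q \<in> carrier (poly_ring R)" "c \<in> carrier R"
    "f = X \<otimes>\<^bsub>poly_ring R\<^esub> q \<oplus>\<^bsub>poly_ring R\<^esub> poly_of_const c"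
proof -
  have X: "X \<in> carrier (poly_ring R)" "X \<noteq> []"
    using var_closed(1)[OF carrier_is_subring] by (auto simp: var_def)
  obtain q r where q: "q \<in> carrier (poly_ring R)" and r: "r \<in> carrier (poly_ring R)"
    and "long_divides f X (q, r)"
    using exists_long_division[OF carrier_is_subfield f X] by blast
  then have f_eq: "f = X \<otimes>\<^bsub>poly_ring R\<^esub> q \<oplus>\<^bsub>poly_ring R\<^esub> r"
    and deg: "r = [] \<or> length r - 1 < length X - 1"
    by (auto simp: long_divides_def)
  have "\<exists>c\<in>carrier R. r = poly_of_const c"
  proof (cases r)
    case Nil
    then show ?thesis by (intro bexI[of _ \<zero>]) (simp_all add: poly_of_const_def)
  next
    case (Cons c cs)
    then have "cs = []" using deg by (simp add: var_def)
    moreover have "c \<in> carrier R" "c \<noteq> \<zero>"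
      using r Cons by (auto simp: univ_poly_carrier[symmetric] polynomial_def)
    ultimately show ?thesis using Cons by (intro bexI[of _ c]) (simp_all add: poly_of_const_def)
  qed
  then show thesis using that q f_eq by blast
qed

text \<open>Splitting off \<open>X\<close> twice writes every polynomial as a constant plus a multiple of \<open>X\<close> plus a
  multiple of \<open>X\<^sup>2\<close>. Independence of \<open>1\<close> and \<open>t\<close> comes from evaluating at \<open>0\<close>: in
  \<open>a + b X = g X\<^sup>2\<close> this gives \<open>a = 0\<close>, and after cancelling one \<open>X\<close> it gives \<open>b = 0\<close>.\<close>

theorem dual_ring_dual_numbers:
  assumes p: "Factorial_Ring.prime p"
  shows "\<exists>t. dual_ring (dual_numbers (residue_ring (int p))) t p"
proof -
  let ?K = "residue_ring (int p)"
  let ?P = "poly_ring ?K"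
  let ?X = "var ?K"
  interpret K: residues_prime p ?K by unfold_locales (rule p)
  note sub = K.carrier_is_subring
  interpret P: domain ?P by (rule K.univ_poly_is_domain[OF sub])
  have X: "?X \<in> carrier ?P" using K.var_closed(1)[OF sub] .
  define I where "I = PIdl\<^bsub>?P\<^esub> (?X [^]\<^bsub>?P\<^esub> (2::nat))"
  have X2: "?X [^]\<^bsub>?P\<^esub> (2::nat) = ?X \<otimes>\<^bsub>?P\<^esub> ?X"
    using X by (simp add: numeral_2_eq_2)
  interpret I: ideal I ?P unfolding I_def by (rule P.cgenideal_ideal) (use X in simp)
  let ?R = "dual_numbers ?K"
  have R: "?R = ?P Quot I" by (simp add: dual_numbers_def I_def Let_def)
  interpret R: cring ?R unfolding R by (rule I.quotient_is_cring[OF P.cring_axioms])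
  define \<pi> where "\<pi> = (+>\<^bsub>?P\<^esub>) I"
  have \<pi>_hom: "\<pi> \<in> Ring.ring_hom ?P ?R" unfolding \<pi>_def R by (rule I.rcos_ring_hom)
  interpret \<pi>: ring_hom_cring ?P ?R \<pi>
    by (rule ring_hom_cringI[OF P.cring_axioms R.cring_axioms \<pi>_hom])
  have \<pi>_surj: "\<exists>f\<in>carrier ?P. \<alpha> = \<pi> f" if "\<alpha> \<in> carrier ?R" for \<alpha>
    using that unfolding R \<pi>_def FactRing_def A_RCOSETS_def' by auto
  have \<pi>_zero: "\<pi> f = \<zero>\<^bsub>?R\<^esub> \<longleftrightarrow> f \<in> I" if "f \<in> carrier ?P" for f
  proof -
    have "\<zero>\<^bsub>?R\<^esub> = I" unfolding R by (simp add: FactRing_def)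
    moreover have "I +>\<^bsub>?P\<^esub> f = I \<longleftrightarrow> f \<in> I"
      using I.a_rcos_const[of f] I.a_rcos_self[OF that] by auto
    ultimately show ?thesis by (simp add: \<pi>_def)
  qed
  define ev where "ev f = K.eval f \<zero>\<^bsub>?K\<^esub>" for f
  interpret ev: ring_hom_cring ?P ?K ev
    unfolding ev_def by (rule K.eval_cring_hom[OF sub]) simp
  have ev_X: "ev ?X = \<zero>\<^bsub>?K\<^esub>" by (simp add: ev_def K.eval_var)
  let ?c = "K.poly_of_const"
  have c_hom: "?c \<in> Ring.ring_hom ?K ?P"
    using K.canonical_embedding_is_hom[OF sub] by simp
  interpret c: ring_hom_cring ?K ?P ?c
    by (rule ring_hom_cringI[OF K.cring P.cring_axioms c_hom])
  have c_eq: "?c k = add_pow ?P (nat k) \<one>\<^bsub>?P\<^esub>" if "k \<in> carrier ?K" for k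
  proof -
    have k: "0 \<le> k" "k < int p" using that by (auto simp: residue_ring_def)
    have one: "\<one>\<^bsub>?K\<^esub> = 1" by (simp add: residue_ring_def)
    have "k = add_pow ?K (nat k) \<one>\<^bsub>?K\<^esub>"
      using k residue_ring_add_pow[of "int p" "nat k"] K.m_gt_one unfolding one by simp
    then have "?c k = ?c (add_pow ?K (nat k) \<one>\<^bsub>?K\<^esub>)" by simp
    also have "\<dots> = add_pow ?P (nat k) \<one>\<^bsub>?P\<^esub>"
      using ring_hom_add_pow[OF c_hom K.ring_axioms P.ring_axioms, of "\<one>\<^bsub>?K\<^esub>"] by simp
    finally show ?thesis .
  qed
  have K_one: "\<one>\<^bsub>?K\<^esub> = 1" by (simp add: residue_ring_def)
  have ev_one: "ev (add_pow ?P n \<one>\<^bsub>?P\<^esub>) = int n mod int p" for n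
    using ring_hom_add_pow[OF ev.homh P.ring_axioms K.ring_axioms, of "\<one>\<^bsub>?P\<^esub>" n]
      residue_ring_add_pow[OF K.m_gt_one, of n] by (simp add: K_one)
  have \<pi>_add_pow: "\<pi> (add_pow ?P n f) = add_pow ?R n (\<pi> f)" if "f \<in> carrier ?P" for f and n :: nat
    by (rule ring_hom_add_pow[OF \<pi>_hom P.ring_axioms R.ring_axioms that])
  have K_zero: "\<zero>\<^bsub>?K\<^esub> = 0" by (simp add: residue_ring_def)
  have p_zero: "add_pow ?P n \<one>\<^bsub>?P\<^esub> = \<zero>\<^bsub>?P\<^esub>" if "p dvd n" for n
  proof -
    have "add_pow ?P n \<one>\<^bsub>?P\<^esub> = ?c (add_pow ?K n \<one>\<^bsub>?K\<^esub>)"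
      using ring_hom_add_pow[OF c_hom K.ring_axioms P.ring_axioms, of "\<one>\<^bsub>?K\<^esub>" n] by simp
    also have "add_pow ?K n \<one>\<^bsub>?K\<^esub> = \<zero>\<^bsub>?K\<^esub>"
      using residue_ring_add_pow[OF K.m_gt_one, of n] that by (simp add: residue_ring_def)
    finally show ?thesis by simp
  qed
  define t where "t = \<pi> ?X"
  have t_square: "t \<otimes>\<^bsub>?R\<^esub> t = \<zero>\<^bsub>?R\<^esub>"
  proof -
    have "?X \<otimes>\<^bsub>?P\<^esub> ?X \<in> I" unfolding I_def X2[symmetric] by (rule P.cgenideal_self) (use X in simp)
    then show ?thesis
      using X \<pi>_zero[of "?X \<otimes>\<^bsub>?P\<^esub> ?X"] by (simp add: t_def)
  qed
  have "dual_ring ?R t p"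
  proof
    show "t \<in> carrier ?R" using X by (simp add: t_def)
    show "t \<otimes>\<^bsub>?R\<^esub> t = \<zero>\<^bsub>?R\<^esub>" by (rule t_square)
    show "add_pow ?R p \<one>\<^bsub>?R\<^esub> = \<zero>\<^bsub>?R\<^esub>"
      using \<pi>_add_pow[of "\<one>\<^bsub>?P\<^esub>" p] p_zero[of p] by simp
  next
    fix \<alpha> assume "\<alpha> \<in> carrier ?R"
    then obtain f where f: "f \<in> carrier ?P" "\<alpha> = \<pi> f" using \<pi>_surj by blast
    obtain q c where q: "q \<in> carrier ?P" "c \<in> carrier ?K"
      "f = ?X \<otimes>\<^bsub>?P\<^esub> q \<oplus>\<^bsub>?P\<^esub> ?c c"
      using K.univ_poly_split_var[OF f(1)] .
    obtain q' d where q': "q' \<in> carrier ?P" "d \<in> carrier ?K"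
      "q = ?X \<otimes>\<^bsub>?P\<^esub> q' \<oplus>\<^bsub>?P\<^esub> ?c d"
      using K.univ_poly_split_var[OF q(1)] .
    have c: "?c c \<in> carrier ?P" "?c d \<in> carrier ?P" using q(2) q'(2) by simp_all
    have "f = (?X \<otimes>\<^bsub>?P\<^esub> ?X) \<otimes>\<^bsub>?P\<^esub> q' \<oplus>\<^bsub>?P\<^esub> (?c c \<oplus>\<^bsub>?P\<^esub> ?c d \<otimes>\<^bsub>?P\<^esub> ?X)"
      using X q'(1) c unfolding q(3) q'(3) by algebra
    moreover have "\<pi> ((?X \<otimes>\<^bsub>?P\<^esub> ?X) \<otimes>\<^bsub>?P\<^esub> q') = \<zero>\<^bsub>?R\<^esub>"
      using X q'(1) t_square by (simp add: t_def)
    ultimately have "\<alpha> = \<pi> (?c c) \<oplus>\<^bsub>?R\<^esub> \<pi> (?c d) \<otimes>\<^bsub>?R\<^esub> t"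
      using X q'(1) c f(2) by (simp add: t_def)
    also have "\<dots> = add_pow ?R (nat c) \<one>\<^bsub>?R\<^esub> \<oplus>\<^bsub>?R\<^esub> add_pow ?R (nat d) t"
      using q(2) q'(2) X R.add_pow_ldistr[of "\<one>\<^bsub>?R\<^esub>" t "nat d"] by (simp add: c_eq \<pi>_add_pow t_def)
    finally show "\<exists>(a::nat) (b::nat). \<alpha> = add_pow ?R a \<one>\<^bsub>?R\<^esub> \<oplus>\<^bsub>?R\<^esub> add_pow ?R b t" by blast
  next
    fix a b :: nat
    assume zero: "add_pow ?R a \<one>\<^bsub>?R\<^esub> \<oplus>\<^bsub>?R\<^esub> add_pow ?R b t = \<zero>\<^bsub>?R\<^esub>"
    define A B where "A = add_pow ?P a \<one>\<^bsub>?P\<^esub>" and "B = add_pow ?P b \<one>\<^bsub>?P\<^esub>"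
    have AB: "A \<in> carrier ?P" "B \<in> carrier ?P" by (simp_all add: A_def B_def)
    have bX: "add_pow ?P b ?X = B \<otimes>\<^bsub>?P\<^esub> ?X"
      using X P.add_pow_ldistr[of "\<one>\<^bsub>?P\<^esub>" ?X b] by (simp add: B_def)
    have "\<pi> (A \<oplus>\<^bsub>?P\<^esub> B \<otimes>\<^bsub>?P\<^esub> ?X) = \<zero>\<^bsub>?R\<^esub>"
      using zero X \<pi>_add_pow[OF X, of b] AB by (simp add: A_def \<pi>_add_pow t_def flip: bX)
    then have "A \<oplus>\<^bsub>?P\<^esub> B \<otimes>\<^bsub>?P\<^esub> ?X \<in> I"
      using \<pi>_zero[of "A \<oplus>\<^bsub>?P\<^esub> B \<otimes>\<^bsub>?P\<^esub> ?X"] AB X by simp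
    then obtain g where g: "g \<in> carrier ?P"
      "A \<oplus>\<^bsub>?P\<^esub> B \<otimes>\<^bsub>?P\<^esub> ?X = g \<otimes>\<^bsub>?P\<^esub> (?X \<otimes>\<^bsub>?P\<^esub> ?X)"
      unfolding I_def X2 cgenideal_def by auto
    from arg_cong[OF g(2), of ev] have "ev A = \<zero>\<^bsub>?K\<^esub>" using AB X g(1) by (simp add: ev_X)
    then have "int a mod int p = 0" by (simp add: A_def ev_one K_zero)
    then have a: "p dvd a" by (simp flip: of_nat_mod add: mod_eq_0_iff_dvd)
    then have "A = \<zero>\<^bsub>?P\<^esub>" using p_zero by (simp add: A_def)
    then have "B \<otimes>\<^bsub>?P\<^esub> ?X = (g \<otimes>\<^bsub>?P\<^esub> ?X) \<otimes>\<^bsub>?P\<^esub> ?X" using g AB X by (simp add: P.m_assoc)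
    moreover have "?X \<noteq> \<zero>\<^bsub>?P\<^esub>" by (simp add: var_def univ_poly_zero)
    ultimately have "B = g \<otimes>\<^bsub>?P\<^esub> ?X" using P.m_rcancel[of ?X B "g \<otimes>\<^bsub>?P\<^esub> ?X"] AB X g(1) by simp
    then have "ev B = \<zero>\<^bsub>?K\<^esub>" using X g(1) by (simp add: ev_X)
    then have "int b mod int p = 0" by (simp add: B_def ev_one K_zero)
    then have "p dvd b" by (simp flip: of_nat_mod add: mod_eq_0_iff_dvd)
    with a show "p dvd a \<and> p dvd b" ..
  qed
  then show ?thesis ..
qed

section \<open>Elementary abelian groups are self-dual\<close>

lemma complex_units_simps [simp]:
  "carrier complex_units = UNIV - {0}" "\<one>\<^bsub>complex_units\<^esub> = 1"
  "w \<otimes>\<^bsub>complex_units\<^esub> w' = w * w'"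
  by (simp_all add: complex_units_def)

definition unity_root :: "nat \<Rightarrow> complex" where "unity_root p = cis (2 * pi / real p)"

lemma unity_root_nonzero: "unity_root p \<noteq> 0"
  by (simp add: unity_root_def)

context
  fixes p :: nat
  assumes p: "Factorial_Ring.prime p"
begin

lemma unity_root_pow: "unity_root p ^ n = cis (2 * pi * real n / real p)"
  by (simp add: unity_root_def DeMoivre mult_ac)

lemma p_gt_0: "p > 0" and p_gt_1: "p > 1"
  using p prime_gt_0_nat prime_gt_1_nat by auto

lemma unity_root_pow_p: "unity_root p ^ p = 1"
  using p_gt_0 by (simp add: unity_root_pow)

lemma unity_root_cong: "[m = n] (mod p) \<Longrightarrow> unity_root p ^ m = unity_root p ^ n"
proof -
  have *: "unity_root p ^ k = unity_root p ^ (k mod p)" for k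
  proof -
    have "unity_root p ^ k = (unity_root p ^ p) ^ (k div p) * unity_root p ^ (k mod p)"
      by (simp flip: power_mult power_add)
    then show ?thesis by (simp add: unity_root_pow_p)
  qed
  assume "[m = n] (mod p)"
  then show ?thesis using *[of m] *[of n] by (simp add: cong_def)
qed

lemma unity_root_eq_1: "unity_root p ^ n = 1 \<Longrightarrow> p dvd n"
proof -
  assume "unity_root p ^ n = 1"
  then have "unity_root p ^ (n mod p) = unity_root p ^ 0" using unity_root_cong[of "n mod p" n] by (simp add: cong_def)
  moreover have "inj_on (\<lambda>k. unity_root p ^ k) {..<p}"
    using bij_betw_roots_unity[OF p_gt_0] by (simp add: bij_betw_def unity_root_pow)
  ultimately have "n mod p = 0" using p_gt_0 by (auto dest!: inj_onD[where x = "n mod p" and y = 0])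
  then show ?thesis by auto
qed

lemma unity_root_surj: "w ^ p = 1 \<Longrightarrow> \<exists>k. w = unity_root p ^ k"
proof -
  assume "w ^ p = 1"
  then have "w \<in> (\<lambda>k. cis (2 * pi * real k / real p)) ` {..<p}"
    using bij_betw_roots_unity[OF p_gt_0] by (auto simp: bij_betw_def)
  then show ?thesis by (auto simp: unity_root_pow)
qed

end

context comm_group begin

definition comb :: "'a set \<Rightarrow> ('a \<Rightarrow> nat) \<Rightarrow> 'a" where
  "comb B f = (\<Otimes>b\<in>B. b [^] f b)"

context
  fixes p :: nat and B :: "'a set"
  assumes p: "Factorial_Ring.prime p" and pow: "\<And>a. a \<in> carrier G \<Longrightarrow> a [^] p = \<one>"
    and B: "B \<subseteq> carrier G" "finite B"
begin

lemma comb_closed [simp]: "comb B f \<in> carrier G"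
  unfolding comb_def using B by (intro finprod_closed) auto

lemma comb_add: "comb B (\<lambda>b. f b + g b) = comb B f \<otimes> comb B g"
proof -
  have "comb B (\<lambda>b. f b + g b) = (\<Otimes>b\<in>B. b [^] f b \<otimes> b [^] g b)"
    unfolding comb_def using B by (intro finprod_cong') (auto simp: nat_pow_mult)
  then show ?thesis unfolding comb_def using B by (subst (asm) finprod_multf) auto
qed

lemma comb_zero: "comb B (\<lambda>_. 0) = \<one>"
  by (simp add: comb_def)

lemma comb_mult: "comb B (\<lambda>b. n * f b) = comb B f [^] n"
  by (induction n) (simp_all add: comb_zero comb_add m_comm)

lemma comb_single: "i \<in> B \<Longrightarrow> comb B (\<lambda>b. if i = b then n else 0) = i [^] n"
proof -
  assume i: "i \<in> B"
  have "comb B (\<lambda>b. if i = b then n else 0) = (\<Otimes>b\<in>B. if i = b then b [^] n else \<one>)"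
    unfolding comb_def using B by (intro finprod_cong') auto
  also have "\<dots> = i [^] n" using B i by (intro finprod_singleton) auto
  finally show ?thesis .
qed

lemma comb_dvd:
  assumes "\<And>b. b \<in> B \<Longrightarrow> p dvd f b"
  shows "comb B f = \<one>"
  unfolding comb_def
proof (rule finprod_one_eqI)
  fix b assume b: "b \<in> B"
  then have "b [^] (p * k) = \<one>" for k
    using B pow[of b] nat_pow_pow[of b p k] by auto
  then show "b [^] f b = \<one>" using assms[OF b] by (auto elim!: dvdE)
qed

lemma inv_eq_pow: "a \<in> carrier G \<Longrightarrow> inv a = a [^] (p - 1)"
  using pow[of a] p_gt_0[OF p] nat_pow_Suc[of a "p - 1"] by (intro inv_equality) auto

lemma generate_comb: "a \<in> generate G B \<Longrightarrow> \<exists>f. a = comb B f"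
proof (induction rule: generate.induct)
  case one
  show ?case by (rule exI[of _ "\<lambda>_. 0"]) (simp add: comb_zero)
next
  case (incl i)
  then show ?case
    using comb_single[of i 1] B by (intro exI[of _ "\<lambda>b. if i = b then 1 else 0"]) auto
next
  case (inv i)
  then have "inv i = i [^] (p - 1)" using B inv_eq_pow by blast
  then show ?case
    using comb_single[OF inv, of "p - 1"]
    by (intro exI[of _ "\<lambda>b. if i = b then p - 1 else 0"]) simp
next
  case (eng a b)
  then obtain f g where "a = comb B f" "b = comb B g" by blast
  then show ?case by (intro exI[of _ "\<lambda>b. f b + g b"]) (simp add: comb_add)
qed

lemma comb_in_generate:
  assumes "C \<subseteq> S" "S \<subseteq> B"
  shows "(\<Otimes>b\<in>C. b [^] (f b :: nat)) \<in> generate G S"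
proof -
  have "C \<subseteq> B" using assms by simp
  then have "finite C" using B(2) by (rule finite_subset)
  then show ?thesis using assms(1)
  proof (induction C rule: finite_induct)
    case (insert c C)
    have S: "S \<subseteq> carrier G" using assms B by blast
    have "c \<in> generate G S" using insert.prems by (auto intro: generate.incl)
    then have "c [^] f c \<in> generate G S"
      using subgroup_int_pow_closed[OF generate_is_subgroup[OF S], of c "int (f c)"]
      by (simp add: int_pow_int)
    then have "c [^] f c \<otimes> (\<Otimes>b\<in>C. b [^] f b) \<in> generate G S"
      using insert by (intro generate.eng) auto
    moreover have "(\<lambda>b. b [^] f b) \<in> C \<rightarrow> carrier G" "c [^] f c \<in> carrier G"
      using insert.prems S by auto
    ultimately show ?case using insert.hyps by simp
  qed (auto intro: generate.one)
qed

text \<open>If the coefficient of \<open>b\<close> were invertible modulo \<open>p\<close>, then \<open>b\<close> would be a combination of the other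
  generators, against minimality.\<close>

lemma minimal_independent:
  assumes gen: "generate G B = carrier G"
    and minimal: "\<And>b. b \<in> B \<Longrightarrow> generate G (B - {b}) \<noteq> carrier G"
    and h: "comb B h = \<one>" and b: "b \<in> B"
  shows "p dvd h b"
proof (rule ccontr)
  assume "\<not> p dvd h b"
  then have "coprime (h b) p" using p by (metis coprime_commute prime_imp_coprime)
  then obtain m where m: "[h b * m = 1] (mod p)"
    using cong_solve_coprime_nat[of "h b" p] by (auto simp: One_nat_def)
  let ?S = "B - {b}"
  have S: "?S \<subseteq> carrier G" using B by blast
  have bc: "b \<in> carrier G" using b B by blast
  have rest: "(\<Otimes>b\<in>?S. b [^] h b) \<in> generate G ?S" by (rule comb_in_generate) auto
  have "comb B h = b [^] h b \<otimes> (\<Otimes>b\<in>?S. b [^] h b)"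
    unfolding comb_def using B b bc finprod_insert[of ?S b "\<lambda>b. b [^] h b"]
    by (auto simp: insert_absorb)
  then have "b [^] h b = inv (\<Otimes>b\<in>?S. b [^] h b)"
    using h bc rest generate_in_carrier[OF S] by (simp add: inv_equality)
  then have "b [^] h b \<in> generate G ?S" using generate_m_inv_closed[OF S rest] by simp
  then have "(b [^] h b) [^] m \<in> generate G ?S"
    using subgroup_int_pow_closed[OF generate_is_subgroup[OF S], of _ "int m"]
    by (simp add: int_pow_int)
  moreover have "(b [^] h b) [^] m = b"
  proof -
    have red: "b [^] n = b [^] (n mod p)" for n
    proof -
      have "b [^] (p * (n div p)) = \<one>" using nat_pow_pow[OF bc, of p "n div p"] pow[OF bc] by simp
      then show ?thesis using bc nat_pow_mult[OF bc, of "p * (n div p)" "n mod p"] by simp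
    qed
    have "b [^] (h b * m) = b [^] (1::nat)"
      using m red[of "h b * m"] red[of 1] by (simp add: cong_def)
    then show ?thesis using bc by (simp add: nat_pow_pow)
  qed
  ultimately have "b \<in> generate G ?S" by simp
  then have "B \<subseteq> generate G ?S" by (auto intro: generate.incl)
  then have "generate G B \<subseteq> generate G ?S"
    by (rule generate_subgroup_incl[OF _ generate_is_subgroup[OF S]])
  then show False using minimal[OF b] gen generate_in_carrier[OF S] by blast
qed

end

lemma minimal_generating_set:
  assumes "finite (carrier G)"
  obtains B where "B \<subseteq> carrier G" "generate G B = carrier G"
    "\<And>b. b \<in> B \<Longrightarrow> generate G (B - {b}) \<noteq> carrier G"
proof -
  let ?P = "\<lambda>B. B \<subseteq> carrier G \<and> generate G B = carrier G"
  have "generate G (carrier G) = carrier G"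
  proof
    show "generate G (carrier G) \<subseteq> carrier G" using generate_in_carrier[of "carrier G"] by blast
    show "carrier G \<subseteq> generate G (carrier G)" by (blast intro: generate.incl)
  qed
  then have "?P (carrier G)" by blast
  then obtain B where B: "?P B" "\<And>C. ?P C \<Longrightarrow> card B \<le> card C"
    using ex_has_least_nat[of ?P "carrier G" card] by auto
  have fin: "finite B" using B(1) assms finite_subset by blast
  have "generate G (B - {b}) \<noteq> carrier G" if "b \<in> B" for b
  proof
    assume "generate G (B - {b}) = carrier G"
    then have "card B \<le> card (B - {b})" using B(1) by (intro B(2)) auto
    then show False using that fin by (metis card_Diff1_less leD)
  qed
  then show thesis using that B(1) by blast
qed

text \<open>A minimal generating set \<open>B\<close> behaves like a basis over \<open>\<int>/p\<close>. The pairing is the standard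
  bilinear form in the coordinates with respect to \<open>B\<close>, composed with \<open>n \<mapsto> \<omega>\<^sup>n\<close> for a primitive
  \<open>p\<close>-th root of unity \<open>\<omega>\<close>. A character takes values that are powers of \<open>\<omega>\<close>, and the exponents at
  the elements of \<open>B\<close> are the coordinates of the element that represents it.\<close>

theorem elementary_abelian_pairing:
  fixes p :: nat
  assumes p: "Factorial_Ring.prime p" and pow: "\<And>a. a \<in> carrier G \<Longrightarrow> a [^] p = \<one>"
    and fin: "finite (carrier G)"
  obtains \<chi> :: "'a \<Rightarrow> 'a \<Rightarrow> complex" where
    "\<And>a b. \<chi> a b \<noteq> 0"
    "\<And>a b c. a \<in> carrier G \<Longrightarrow> b \<in> carrier G \<Longrightarrow> c \<in> carrier G \<Longrightarrow> \<chi> (a \<otimes> b) c = \<chi> a c * \<chi> b c"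
    "\<And>a b c. a \<in> carrier G \<Longrightarrow> b \<in> carrier G \<Longrightarrow> c \<in> carrier G \<Longrightarrow> \<chi> a (b \<otimes> c) = \<chi> a b * \<chi> a c"
    "\<And>a. a \<in> carrier G \<Longrightarrow> (\<And>b. b \<in> carrier G \<Longrightarrow> \<chi> a b = 1) \<Longrightarrow> a = \<one>"
    "\<And>\<psi>. \<psi> \<in> hom G complex_units \<Longrightarrow> \<exists>a\<in>carrier G. \<forall>b\<in>carrier G. \<psi> b = \<chi> a b"
proof -
  obtain B where B: "B \<subseteq> carrier G" and gen: "generate G B = carrier G"
    and minimal: "\<And>b. b \<in> B \<Longrightarrow> generate G (B - {b}) \<noteq> carrier G"
    using minimal_generating_set[OF fin] by blast
  have finB: "finite B" using B fin by (rule finite_subset)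
  note ctx = p pow B finB
  \<comment> \<open>Coordinates are natural numbers, which are determined only modulo \<open>p\<close>.\<close>
  define co where "co a = (SOME f. a = comb B f)" for a
  have co: "comb B (co a) = a" if "a \<in> carrier G" for a
    using someI_ex[OF generate_comb[OF ctx, of a]] that gen by (simp add: co_def)
  have unique: "[f b = g b] (mod p)" if eq: "comb B f = comb B g" and b: "b \<in> B" for f g b
  proof -
    \<comment> \<open>The multiple \<open>p - 1\<close> plays the part of \<open>-1\<close>.\<close>
    have "comb B (\<lambda>b. f b + (p - 1) * g b) = \<one>"
      using comb_add[OF ctx, of f "\<lambda>b. (p - 1) * g b"] comb_mult[OF ctx, of "p - 1" g] eq
        inv_eq_pow[OF ctx comb_closed[OF ctx, of g]] comb_closed[OF ctx, of g]
      by (metis r_inv)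
    from minimal_independent[OF ctx gen minimal this b] have "[f b + (p - 1) * g b = 0] (mod p)" by (simp add: cong_0_iff)
    then have "[f b + (p - 1) * g b + g b = 0 + g b] (mod p)" by (rule cong_add[OF _ cong_refl])
    moreover have "f b + (p - 1) * g b + g b = f b + g b * p"
      using p_gt_0[OF p] by (cases p) (simp_all add: algebra_simps)
    ultimately show ?thesis by (simp add: cong_def)
  qed
  let ?\<omega> = "unity_root p"
  define \<chi> where "\<chi> a c = ?\<omega> ^ (\<Sum>b\<in>B. co a b * co c b)" for a c
  have comm: "\<chi> a c = \<chi> c a" for a c by (simp add: \<chi>_def mult.commute)
  have nz: "\<chi> a c \<noteq> 0" for a c by (simp add: \<chi>_def unity_root_nonzero)
  have add: "\<chi> (a \<otimes> b) c = \<chi> a c * \<chi> b c" if "a \<in> carrier G" "b \<in> carrier G" for a b c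
  proof -
    have "comb B (co (a \<otimes> b)) = comb B (\<lambda>i. co a i + co b i)"
      using that co by (simp add: comb_add[OF ctx])
    then have "[(\<Sum>i\<in>B. co (a \<otimes> b) i * co c i) = (\<Sum>i\<in>B. (co a i + co b i) * co c i)] (mod p)"
      by (intro cong_sum cong_mult unique cong_refl)
    from unity_root_cong[OF p this] show ?thesis
      by (simp add: \<chi>_def algebra_simps sum.distrib power_add)
  qed
  have on_B: "\<chi> a i = ?\<omega> ^ co a i" if "i \<in> B" for a i
  proof -
    have "comb B (co i) = comb B (\<lambda>b. if i = b then 1 else 0)"
      using that B co comb_single[OF ctx that, of 1] by auto
    then have "[(\<Sum>b\<in>B. co a b * co i b) = (\<Sum>b\<in>B. co a b * (if i = b then 1 else 0))] (mod p)"
      by (intro cong_sum cong_mult unique cong_refl)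
    moreover have "(\<Sum>b\<in>B. co a b * (if i = b then 1 else 0)) = co a i"
      using that finB by (simp add: if_distrib sum.delta cong: if_cong)
    ultimately show ?thesis using unity_root_cong[OF p] by (metis \<chi>_def)
  qed
  show thesis
  proof (rule that[of \<chi>])
    show "\<chi> (a \<otimes> b) c = \<chi> a c * \<chi> b c" "\<chi> c (a \<otimes> b) = \<chi> c a * \<chi> c b"
      if "a \<in> carrier G" "b \<in> carrier G" for a b c
      using add[OF that, of c] by (simp_all add: comm[of c])
    show "a = \<one>" if a: "a \<in> carrier G" and triv: "\<And>b. b \<in> carrier G \<Longrightarrow> \<chi> a b = 1" for a
    proof -
      have "p dvd co a b" if "b \<in> B" for b
        using triv[of b] that B on_B[OF that, of a] unity_root_eq_1[OF p] by auto
      then have "comb B (co a) = \<one>" using comb_dvd[OF ctx] by blast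
      then show ?thesis using co[OF a] by simp
    qed
    show "\<exists>a\<in>carrier G. \<forall>b\<in>carrier G. \<psi> b = \<chi> a b" if \<psi>: "\<psi> \<in> hom G complex_units" for \<psi>
    proof -
      interpret C: comm_group complex_units by (rule comm_group_complex_units)
      interpret psi: group_hom G complex_units \<psi>
        by (simp add: group_hom_def group_hom_axioms_def group_axioms C.group_axioms \<psi>)
      have mult: "\<psi> (a \<otimes> b) = \<psi> a * \<psi> b" if "a \<in> carrier G" "b \<in> carrier G" for a b
        using psi.hom_mult[OF that] by (simp add: complex_units_def)
      have nz: "\<psi> a \<noteq> 0" if "a \<in> carrier G" for a
        using psi.hom_closed[OF that] by (simp add: complex_units_def)
      have one: "\<psi> \<one> = 1" using psi.hom_one by (simp add: complex_units_def)
      have psi_pow: "\<psi> (a [^] (n::nat)) = \<psi> a ^ n" if "a \<in> carrier G" for a n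
        using that by (induction n) (simp_all add: mult.commute)
      have "\<exists>k. \<psi> b = ?\<omega> ^ k" if "b \<in> B" for b
        using that B psi_pow[of b p] pow[of b] one unity_root_surj[OF p, of "\<psi> b"] by auto
      then obtain k where k: "\<And>b. b \<in> B \<Longrightarrow> \<psi> b = ?\<omega> ^ k b" by metis
      define a where "a = comb B k"
      have a: "a \<in> carrier G" by (simp add: a_def comb_closed[OF ctx])
      have "comb B (co a) = comb B k" using co[OF a] by (simp add: a_def)
      then have eq_B: "\<psi> b = \<chi> a b" if "b \<in> B" for b
        using that k on_B unity_root_cong[OF p unique[of "co a" k b]] by simp
      have one': "\<chi> a \<one> = 1" using add[of \<one> \<one> a] nz comm[of a \<one>]
        by (metis \<open>\<And>c a. \<chi> a c \<noteq> 0\<close> l_one mult_cancel_right1 one_closed)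
      have "\<psi> b = \<chi> a b" if "b \<in> generate G B" for b
        using that
      proof (induction rule: generate.induct)
        case one
        then show ?case using \<open>\<psi> \<one> = 1\<close> one' by simp
      next
        case (incl b)
        then show ?case by (rule eq_B)
      next
        case (inv b)
        then have b: "b \<in> carrier G" using B by blast
        have "\<psi> (inv b) * \<psi> b = 1" using mult[of "inv b" b] b \<open>\<psi> \<one> = 1\<close> by simp
        moreover have "\<chi> a (inv b) * \<chi> a b = 1" using add[of "inv b" b a] b one' comm by simp
        ultimately show ?case using eq_B[OF inv] nz[OF b] by (metis mult_right_cancel)
      next
        case (eng b c)
        then have "b \<in> carrier G" "c \<in> carrier G" using gen by auto
        then show ?case using eng mult add[of b c a] comm by simp
      qed
      then show ?thesis using a gen by auto
    qed
  qed (rule nz)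
qed

end

section \<open>The central extension of a cocycle\<close>

text \<open>For a cocycle that is not normalized, the neutral element has the second component
  \<open>f(1, 1)\<inverse>\<close> in place of \<open>1\<close>.\<close>

definition cocycle_ext :: "('g, 'b) monoid_scheme \<Rightarrow> ('g \<times> 'g \<Rightarrow> complex) \<Rightarrow> ('g \<times> complex) monoid" where
  "cocycle_ext G f =
     \<lparr>carrier = carrier G \<times> (UNIV - {0}),
      monoid.mult = (\<lambda>(g, a) (h, b). (g \<otimes>\<^bsub>G\<^esub> h, a * b * f (g, h))),
      one = (\<one>\<^bsub>G\<^esub>, inverse (f (\<one>\<^bsub>G\<^esub>, \<one>\<^bsub>G\<^esub>)))\<rparr>"

locale cocycle_extension = group G for G (structure) +
  fixes f :: "'a \<times> 'a \<Rightarrow> complex"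
  assumes f: "f \<in> carrier (two_cocycles G complex_units)"
begin

abbreviation "ext \<equiv> cocycle_ext G f"

lemma f_nonzero: "g \<in> carrier G \<Longrightarrow> h \<in> carrier G \<Longrightarrow> f (g, h) \<noteq> 0"
  using f by (auto simp: two_cocycles_def complex_units_def PiE_iff)

lemma f_cocycle:
  "g \<in> carrier G \<Longrightarrow> h \<in> carrier G \<Longrightarrow> k \<in> carrier G \<Longrightarrow>
    f (g, h) * f (g \<otimes> h, k) = f (h, k) * f (g, h \<otimes> k)"
  using f by (auto simp: two_cocycles_def complex_units_def)

lemma f_one_left: "g \<in> carrier G \<Longrightarrow> f (\<one>, g) = f (\<one>, \<one>)"
  using f_cocycle[of \<one> \<one> g] f_nonzero[of \<one> g] by simp

lemma f_one_right: "g \<in> carrier G \<Longrightarrow> f (g, \<one>) = f (\<one>, \<one>)"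
  using f_cocycle[of g \<one> \<one>] f_nonzero[of g \<one>] by simp

lemma ext_simps [simp]:
  "carrier ext = carrier G \<times> (UNIV - {0})"
  "(g, a) \<otimes>\<^bsub>ext\<^esub> (h, b) = (g \<otimes> h, a * b * f (g, h))"
  "\<one>\<^bsub>ext\<^esub> = (\<one>, inverse (f (\<one>, \<one>)))"
  by (simp_all add: cocycle_ext_def)

lemma group_ext: "group ext"
proof (rule groupI)
  fix u v w assume "u \<in> carrier ext" "v \<in> carrier ext" "w \<in> carrier ext"
  then show "u \<otimes>\<^bsub>ext\<^esub> v \<otimes>\<^bsub>ext\<^esub> w = u \<otimes>\<^bsub>ext\<^esub> (v \<otimes>\<^bsub>ext\<^esub> w)"
    using f_cocycle by (auto simp: m_assoc)
next
  fix u assume "u \<in> carrier ext"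
  then obtain g a where u: "u = (g, a)" "g \<in> carrier G" "a \<noteq> 0" by auto
  let ?b = "inverse (f (\<one>, \<one>) * a * f (inv g, g))"
  have "(inv g, ?b) \<in> carrier ext" using u f_nonzero by simp
  moreover have "(inv g, ?b) \<otimes>\<^bsub>ext\<^esub> u = \<one>\<^bsub>ext\<^esub>" using u f_nonzero by (simp add: field_simps)
  ultimately show "\<exists>v\<in>carrier ext. v \<otimes>\<^bsub>ext\<^esub> u = \<one>\<^bsub>ext\<^esub>" by blast
next
  fix u assume "u \<in> carrier ext"
  then obtain g a where u: "u = (g, a)" "g \<in> carrier G" "a \<noteq> 0" by auto
  then show "\<one>\<^bsub>ext\<^esub> \<otimes>\<^bsub>ext\<^esub> u = u"
    using f_one_left[of g] f_nonzero[of \<one> \<one>] by simp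
qed (use f_nonzero in auto)

lemma fst_hom: "fst \<in> hom ext G"
  by (auto simp: hom_def)

sublocale ext: group_hom ext G fst
  by (simp add: group_hom_def group_hom_axioms_def group_ext group_axioms fst_hom)

lemma kernel_central: "kernel ext G fst \<subseteq> group_center ext"
proof
  fix u assume "u \<in> kernel ext G fst"
  then have "u \<in> carrier ext" "fst u = \<one>" by (simp_all add: kernel_def)
  then obtain a where u: "u = (\<one>, a)" "a \<noteq> 0" by (cases u) simp
  have "u \<otimes>\<^bsub>ext\<^esub> v = v \<otimes>\<^bsub>ext\<^esub> u" if "v \<in> carrier ext" for v
  proof -
    obtain h b where v: "v = (h, b)" "h \<in> carrier G" using \<open>v \<in> carrier ext\<close> by (cases v) simp
    show ?thesis using f_one_left[OF v(2)] f_one_right[OF v(2)] v(2) by (simp add: u(1) v(1))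
  qed
  then show "u \<in> group_center ext"
    using \<open>u \<in> carrier ext\<close> unfolding group_center_def by blast
qed

text \<open>The embedding of \<open>\<complex>\<^sup>\<times>\<close>; the factor makes it a homomorphism.\<close>

definition scalar :: "complex \<Rightarrow> 'a \<times> complex" where
  "scalar c = (\<one>, c * inverse (f (\<one>, \<one>)))"

lemma scalar_closed: "c \<noteq> 0 \<Longrightarrow> scalar c \<in> carrier ext"
  using f_nonzero by (simp add: scalar_def)

lemma scalar_mult: "scalar c \<otimes>\<^bsub>ext\<^esub> scalar d = scalar (c * d)"
  using f_nonzero by (simp add: scalar_def)

lemma scalar_pow: "scalar c [^]\<^bsub>ext\<^esub> (n::nat) = scalar (c ^ n)"
  by (induction n) (simp_all add: scalar_mult mult.commute, simp add: scalar_def)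

text \<open>The \<open>n\<close>-th power of any lift is a scalar. Multiplying the lift by an \<open>n\<close>-th root of the inverse
  of that scalar makes the power trivial.\<close>

lemma lift_order:
  fixes n :: nat
  assumes g: "g \<in> carrier G" "g [^] n = \<one>" and n: "n > 0"
  obtains a where "(g, a) \<in> carrier ext" "(g, a) [^]\<^bsub>ext\<^esub> n = \<one>\<^bsub>ext\<^esub>"
proof -
  have g1: "(g, 1) \<in> carrier ext" using g by simp
  have "fst ((g, 1) [^]\<^bsub>ext\<^esub> n) = \<one>" using ext.hom_nat_pow[OF g1, of n] g by simp
  moreover have "(g, 1) [^]\<^bsub>ext\<^esub> n \<in> carrier ext" using g1 by (rule ext.G.nat_pow_closed)
  ultimately obtain m where m: "(g, 1) [^]\<^bsub>ext\<^esub> n = (\<one>, m)" "m \<noteq> 0"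
    by (cases "(g, 1) [^]\<^bsub>ext\<^esub> n") auto
  define c where "c = m * f (\<one>, \<one>)"
  have c: "(g, 1) [^]\<^bsub>ext\<^esub> n = scalar c" "c \<noteq> 0"
    using m f_nonzero by (simp_all add: c_def scalar_def)
  have "card {r :: complex. r ^ n = inverse c} = n"
    using n c(2) by (intro card_nth_roots) auto
  then have "card {r :: complex. r ^ n = inverse c} > 0" using n by simp
  then have "{r :: complex. r ^ n = inverse c} \<noteq> {}" by (auto simp only: card.empty)
  then obtain r where r: "r ^ n = inverse c" by blast
  have r0: "r \<noteq> 0" using r c(2) n by (auto simp: zero_power)
  have sr: "scalar r \<in> group_center ext"
    using kernel_central scalar_closed[OF r0] by (auto simp: kernel_def scalar_def)
  have "(g, 1) \<otimes>\<^bsub>ext\<^esub> scalar r = scalar r \<otimes>\<^bsub>ext\<^esub> (g, 1)"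
    using ext.G.group_centerD(2)[OF sr g1] by simp
  then have "((g, 1) \<otimes>\<^bsub>ext\<^esub> scalar r) [^]\<^bsub>ext\<^esub> n = scalar c \<otimes>\<^bsub>ext\<^esub> scalar (r ^ n)"
    using ext.G.pow_mult_distrib[OF _ g1 scalar_closed[OF r0]] c(1) by (simp add: scalar_pow)
  also have "\<dots> = \<one>\<^bsub>ext\<^esub>" using c(2) by (simp only: scalar_mult r) (simp add: scalar_def)
  finally have pow: "((g, 1) \<otimes>\<^bsub>ext\<^esub> scalar r) [^]\<^bsub>ext\<^esub> n = \<one>\<^bsub>ext\<^esub>" .
  have "(g, 1) \<otimes>\<^bsub>ext\<^esub> scalar r \<in> carrier ext"
    using ext.G.m_closed[OF g1 scalar_closed[OF r0]] .
  moreover obtain a where a: "(g, 1) \<otimes>\<^bsub>ext\<^esub> scalar r = (g, a)" using g by (simp add: scalar_def)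
  ultimately show thesis using that[of a] pow unfolding a by blast
qed

end

section \<open>The transgression isomorphism\<close>

text \<open>The last hypothesis is the lifting property that makes the transgression surjective; the two before
  it make the transgression well defined and injective.\<close>

locale central_cover = group_hom E G \<pi>
  for E :: "('e, 'b) monoid_scheme" and G :: "('g, 'c) monoid_scheme" (structure) and \<pi> +
  assumes surj: "\<pi> ` carrier E = carrier G"
    and kernel_center: "kernel E G \<pi> \<subseteq> group_center E"
    and kernel_derived: "kernel E G \<pi> \<subseteq> derived E (carrier E)"
    and lift: "f \<in> carrier (two_cocycles G complex_units) \<Longrightarrow>
      \<exists>\<psi>\<in>hom E (cocycle_ext G f). \<forall>e\<in>carrier E. fst (\<psi> e) = \<pi> e"
begin

abbreviation "A \<equiv> kernel E G \<pi>"

text \<open>A set-theoretic section of \<open>\<pi>\<close>.\<close>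

definition s :: "'g \<Rightarrow> 'e" where "s g = (SOME e. e \<in> carrier E \<and> \<pi> e = g)"

lemma s_section: assumes "g \<in> carrier G" shows "s g \<in> carrier E" "\<pi> (s g) = g"
proof -
  have "\<exists>e. e \<in> carrier E \<and> \<pi> e = g" using assms[folded surj] by blast
  then have "s g \<in> carrier E \<and> \<pi> (s g) = g" unfolding s_def by (rule someI_ex)
  then show "s g \<in> carrier E" "\<pi> (s g) = g" by auto
qed

definition factor_set :: "'g \<Rightarrow> 'g \<Rightarrow> 'e" where
  "factor_set g h = inv\<^bsub>E\<^esub> s (g \<otimes> h) \<otimes>\<^bsub>E\<^esub> (s g \<otimes>\<^bsub>E\<^esub> s h)"

lemma A_carrier: "a \<in> A \<Longrightarrow> a \<in> carrier E" "a \<in> A \<Longrightarrow> \<pi> a = \<one>"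
  by (auto simp: kernel_def)

lemma A_comm: "a \<in> A \<Longrightarrow> e \<in> carrier E \<Longrightarrow> a \<otimes>\<^bsub>E\<^esub> e = e \<otimes>\<^bsub>E\<^esub> a"
  using kernel_center G.group_centerD(2) by blast

lemma factor_set:
  assumes "g \<in> carrier G" "h \<in> carrier G"
  shows "factor_set g h \<in> A" "s g \<otimes>\<^bsub>E\<^esub> s h = s (g \<otimes> h) \<otimes>\<^bsub>E\<^esub> factor_set g h"
  using assms s_section[OF assms(1)] s_section[OF assms(2)] s_section[of "g \<otimes> h"]
  by (simp_all add: factor_set_def kernel_def G.mult_inv_cancel_left)

text \<open>Both sides measure the failure of \<open>s(g) s(h) s(k)\<close> to be \<open>s(g h k)\<close>, bracketed in the two
  possible ways.\<close>

lemma factor_set_cocycle: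
  assumes g: "g \<in> carrier G" and h: "h \<in> carrier G" and k: "k \<in> carrier G"
  shows "factor_set g h \<otimes>\<^bsub>E\<^esub> factor_set (g \<otimes> h) k = factor_set h k \<otimes>\<^bsub>E\<^esub> factor_set g (h \<otimes> k)"
proof -
  note c = s_section(1)[OF g] s_section(1)[OF h] s_section(1)[OF k] s_section(1)[of "g \<otimes> h"] s_section(1)[of "h \<otimes> k"]
    s_section(1)[of "g \<otimes> (h \<otimes> k)"]
  let ?a = "factor_set g h" and ?b = "factor_set (g \<otimes> h) k"
    and ?c = "factor_set h k" and ?d = "factor_set g (h \<otimes> k)"
  have A: "?a \<in> A" "?b \<in> A" "?c \<in> A" "?d \<in> A" using g h k factor_set(1) by auto
  note C = A_carrier(1)[OF A(1)] A_carrier(1)[OF A(2)] A_carrier(1)[OF A(3)] A_carrier(1)[OF A(4)]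
  have "s g \<otimes>\<^bsub>E\<^esub> s h \<otimes>\<^bsub>E\<^esub> s k = s (g \<otimes> h) \<otimes>\<^bsub>E\<^esub> (?a \<otimes>\<^bsub>E\<^esub> s k)"
    using g h c C factor_set(2)[OF g h] by (simp add: G.m_assoc)
  also have "\<dots> = s (g \<otimes> h) \<otimes>\<^bsub>E\<^esub> s k \<otimes>\<^bsub>E\<^esub> ?a"
    using g h c C A_comm[OF A(1) c(3)] by (simp add: G.m_assoc)
  also have "\<dots> = s (g \<otimes> (h \<otimes> k)) \<otimes>\<^bsub>E\<^esub> (?b \<otimes>\<^bsub>E\<^esub> ?a)"
    using g h k c C factor_set(2)[of "g \<otimes> h" k] by (simp add: G.m_assoc H.m_assoc)
  also have "?b \<otimes>\<^bsub>E\<^esub> ?a = ?a \<otimes>\<^bsub>E\<^esub> ?b" by (rule A_comm[OF A(2) C(1)])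
  finally have 1: "s g \<otimes>\<^bsub>E\<^esub> s h \<otimes>\<^bsub>E\<^esub> s k = s (g \<otimes> (h \<otimes> k)) \<otimes>\<^bsub>E\<^esub> (?a \<otimes>\<^bsub>E\<^esub> ?b)" .
  have "s g \<otimes>\<^bsub>E\<^esub> s h \<otimes>\<^bsub>E\<^esub> s k = s g \<otimes>\<^bsub>E\<^esub> s (h \<otimes> k) \<otimes>\<^bsub>E\<^esub> ?c"
    using h k c C factor_set(2)[OF h k] by (simp add: G.m_assoc)
  also have "\<dots> = s (g \<otimes> (h \<otimes> k)) \<otimes>\<^bsub>E\<^esub> (?d \<otimes>\<^bsub>E\<^esub> ?c)"
    using g h k c C factor_set(2)[of g "h \<otimes> k"] by (simp add: G.m_assoc)
  also have "?d \<otimes>\<^bsub>E\<^esub> ?c = ?c \<otimes>\<^bsub>E\<^esub> ?d" by (rule A_comm[OF A(4) C(3)])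
  finally have "s (g \<otimes> (h \<otimes> k)) \<otimes>\<^bsub>E\<^esub> (?a \<otimes>\<^bsub>E\<^esub> ?b) = s (g \<otimes> (h \<otimes> k)) \<otimes>\<^bsub>E\<^esub> (?c \<otimes>\<^bsub>E\<^esub> ?d)"
    using 1 by simp
  then show ?thesis using g h k c C by simp
qed

definition transgress :: "('e \<Rightarrow> complex) \<Rightarrow> 'g \<times> 'g \<Rightarrow> complex" where
  "transgress \<chi> = (\<lambda>(g, h)\<in>carrier G \<times> carrier G. \<chi> (factor_set g h))"

definition character :: "('e \<Rightarrow> complex) \<Rightarrow> bool" where
  "character \<chi> \<longleftrightarrow> (\<forall>a\<in>A. \<chi> a \<noteq> 0) \<and> (\<forall>a\<in>A. \<forall>b\<in>A. \<chi> (a \<otimes>\<^bsub>E\<^esub> b) = \<chi> a * \<chi> b)"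

lemma transgress_cocycle:
  assumes "character \<chi>"
  shows "transgress \<chi> \<in> carrier (two_cocycles G complex_units)"
proof -
  have "transgress \<chi> \<in> carrier G \<times> carrier G \<rightarrow>\<^sub>E carrier complex_units"
    using assms factor_set(1) by (auto simp: transgress_def character_def complex_units_def)
  moreover have "\<chi> (factor_set g h) * \<chi> (factor_set (g \<otimes> h) k) =
      \<chi> (factor_set h k) * \<chi> (factor_set g (h \<otimes> k))"
    if "g \<in> carrier G" "h \<in> carrier G" "k \<in> carrier G" for g h k
  proof -
    have "\<chi> (factor_set g h \<otimes>\<^bsub>E\<^esub> factor_set (g \<otimes> h) k) =
        \<chi> (factor_set h k \<otimes>\<^bsub>E\<^esub> factor_set g (h \<otimes> k))"
      using factor_set_cocycle[OF that] by simp
    then show ?thesis using assms that factor_set(1) by (simp add: character_def)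
  qed
  ultimately show ?thesis by (simp add: two_cocycles_def transgress_def complex_units_def)
qed

text \<open>If \<open>\<chi>\<close> transgresses to the coboundary of \<open>c\<close>, then \<open>s(g) a \<mapsto> c(g) \<chi>(a)\<close> is a character of \<open>E\<close>.
  It is trivial on \<open>[E, E]\<close>, hence on \<open>A\<close>.\<close>

lemma transgress_trivial:
  assumes \<chi>: "character \<chi>" and cob: "transgress \<chi> \<in> two_coboundaries G complex_units"
    and a: "a \<in> A"
  shows "\<chi> a = 1"
proof -
  obtain c where c: "c \<in> carrier G \<rightarrow> carrier complex_units" and
    "transgress \<chi> = (\<lambda>(g, h)\<in>carrier G \<times> carrier G.
      c g \<otimes>\<^bsub>complex_units\<^esub> c h \<otimes>\<^bsub>complex_units\<^esub> inv\<^bsub>complex_units\<^esub> c (g \<otimes> h))"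
    using cob by (auto simp: two_coboundaries_def)
  note eq = fun_cong[OF this(2)]
  interpret C: comm_group complex_units by (rule comm_group_complex_units)
  have c0: "c g \<noteq> 0" if "g \<in> carrier G" for g using c that by (auto simp: complex_units_def)
  have inv_c: "inv\<^bsub>complex_units\<^esub> w = inverse w" if "w \<noteq> 0" for w
    by (rule C.inv_equality) (use that in \<open>simp_all add: complex_units_def\<close>)
  have cob_eq: "c g * c h = c (g \<otimes> h) * \<chi> (factor_set g h)" if "g \<in> carrier G" "h \<in> carrier G" for g h
    using eq[of "(g, h)"] that c0[of "g \<otimes> h"]
    by (simp add: transgress_def inv_c)
  define \<psi> where "\<psi> e = c (\<pi> e) * \<chi> (inv\<^bsub>E\<^esub> s (\<pi> e) \<otimes>\<^bsub>E\<^esub> e)" for e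
  have part: "inv\<^bsub>E\<^esub> s (\<pi> e) \<otimes>\<^bsub>E\<^esub> e \<in> A" if "e \<in> carrier E" for e
    using that s_section[of "\<pi> e"] by (simp add: kernel_def)
  have \<chi>0: "\<chi> a \<noteq> 0" if "a \<in> A" for a using \<chi> that by (simp add: character_def)
  have \<chi>_mult: "\<chi> (a \<otimes>\<^bsub>E\<^esub> b) = \<chi> a * \<chi> b" if "a \<in> A" "b \<in> A" for a b
    using \<chi> that by (simp add: character_def)
  have A_mult: "a \<otimes>\<^bsub>E\<^esub> b \<in> A" if "a \<in> A" "b \<in> A" for a b
    using that by (simp add: kernel_def)
  have \<psi>_mult: "\<psi> (d \<otimes>\<^bsub>E\<^esub> e) = \<psi> d * \<psi> e" if d: "d \<in> carrier E" and e: "e \<in> carrier E" for d e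
  proof -
    let ?g = "\<pi> d" and ?h = "\<pi> e"
    define a b where "a = inv\<^bsub>E\<^esub> s ?g \<otimes>\<^bsub>E\<^esub> d" and "b = inv\<^bsub>E\<^esub> s ?h \<otimes>\<^bsub>E\<^esub> e"
    have ab: "a \<in> A" "b \<in> A" using part d e by (simp_all add: a_def b_def)
    note C = A_carrier(1)[OF ab(1)] A_carrier(1)[OF ab(2)] s_section(1)[of ?g] s_section(1)[of ?h] s_section(1)[of "?g \<otimes> ?h"]
    have fs: "factor_set ?g ?h \<in> A" using d e factor_set(1) by simp
    note F = A_carrier(1)[OF fs]
    have "d \<otimes>\<^bsub>E\<^esub> e = s ?g \<otimes>\<^bsub>E\<^esub> a \<otimes>\<^bsub>E\<^esub> (s ?h \<otimes>\<^bsub>E\<^esub> b)"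
      using d e C by (simp add: a_def b_def G.mult_inv_cancel_left)
    also have "\<dots> = s ?g \<otimes>\<^bsub>E\<^esub> (a \<otimes>\<^bsub>E\<^esub> s ?h) \<otimes>\<^bsub>E\<^esub> b"
      using d e C by (simp add: G.m_assoc)
    also have "a \<otimes>\<^bsub>E\<^esub> s ?h = s ?h \<otimes>\<^bsub>E\<^esub> a" using A_comm[OF ab(1)] C e by simp
    also have "s ?g \<otimes>\<^bsub>E\<^esub> (s ?h \<otimes>\<^bsub>E\<^esub> a) \<otimes>\<^bsub>E\<^esub> b = s ?g \<otimes>\<^bsub>E\<^esub> s ?h \<otimes>\<^bsub>E\<^esub> (a \<otimes>\<^bsub>E\<^esub> b)"
      using d e C by (simp add: G.m_assoc)
    also have "\<dots> = s (?g \<otimes> ?h) \<otimes>\<^bsub>E\<^esub> (factor_set ?g ?h \<otimes>\<^bsub>E\<^esub> (a \<otimes>\<^bsub>E\<^esub> b))"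
      using d e C F factor_set(2)[of ?g ?h] by (simp add: G.m_assoc)
    finally have de: "d \<otimes>\<^bsub>E\<^esub> e = s (?g \<otimes> ?h) \<otimes>\<^bsub>E\<^esub> (factor_set ?g ?h \<otimes>\<^bsub>E\<^esub> (a \<otimes>\<^bsub>E\<^esub> b))" .
    have "inv\<^bsub>E\<^esub> s (?g \<otimes> ?h) \<otimes>\<^bsub>E\<^esub> (d \<otimes>\<^bsub>E\<^esub> e) = factor_set ?g ?h \<otimes>\<^bsub>E\<^esub> (a \<otimes>\<^bsub>E\<^esub> b)"
      unfolding de using d e C F by (simp add: G.mult_inv_cancel_left)
    then have "\<psi> (d \<otimes>\<^bsub>E\<^esub> e) = c (?g \<otimes> ?h) * \<chi> (factor_set ?g ?h \<otimes>\<^bsub>E\<^esub> (a \<otimes>\<^bsub>E\<^esub> b))"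
      using d e by (simp add: \<psi>_def)
    also have "\<dots> = c (?g \<otimes> ?h) * \<chi> (factor_set ?g ?h) * (\<chi> a * \<chi> b)"
      using ab fs A_mult by (simp add: \<chi>_mult)
    also have "c (?g \<otimes> ?h) * \<chi> (factor_set ?g ?h) = c ?g * c ?h"
      using cob_eq[of ?g ?h] d e by simp
    also have "c ?g * c ?h * (\<chi> a * \<chi> b) = \<psi> d * \<psi> e" by (simp add: \<psi>_def a_def b_def)
    finally show ?thesis .
  qed
  have \<psi>0: "\<psi> e \<noteq> 0" if "e \<in> carrier E" for e
    using that c0[of "\<pi> e"] \<chi>0[OF part[OF that]] by (simp add: \<psi>_def)
  have \<psi>_one: "\<psi> \<one>\<^bsub>E\<^esub> = 1" using \<psi>_mult[of "\<one>\<^bsub>E\<^esub>" "\<one>\<^bsub>E\<^esub>"] \<psi>0[of "\<one>\<^bsub>E\<^esub>"] by simp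
  have "\<psi> \<in> hom E complex_units"
    using \<psi>_mult \<psi>0 by (auto simp: hom_def complex_units_def)
  then interpret psi: group_hom E complex_units \<psi>
    by (simp add: group_hom_def group_hom_axioms_def G.group_axioms C.group_axioms)
  have "derived E (carrier E) \<subseteq> kernel E complex_units \<psi>"
    unfolding derived_def
  proof (rule G.generate_subgroup_incl[OF _ psi.subgroup_kernel])
    show "derived_set E (carrier E) \<subseteq> kernel E complex_units \<psi>"
      by (auto simp: kernel_def inv_c \<psi>0 field_simps)
  qed
  then have \<psi>A: "\<psi> b = 1" if "b \<in> A" for b
    using kernel_derived that by (auto simp: kernel_def complex_units_def)
  have s1: "inv\<^bsub>E\<^esub> s \<one> \<in> A" using s_section[of \<one>] by (simp add: kernel_def)
  have oneA: "\<one>\<^bsub>E\<^esub> \<in> A" by (simp add: kernel_def)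
  have "c \<one> * \<chi> (inv\<^bsub>E\<^esub> s \<one>) = 1"
    using \<psi>_one s_section[of \<one>] by (simp add: \<psi>_def)
  moreover have "c \<one> * (\<chi> (inv\<^bsub>E\<^esub> s \<one>) * \<chi> a) = 1"
    using \<psi>A[OF a] A_carrier(2)[OF a] \<chi>_mult[OF s1 a] by (simp add: \<psi>_def)
  ultimately show ?thesis by (metis mult.assoc mult_1)
qed

text \<open>A homomorphism over \<open>G\<close> from \<open>E\<close> to the extension defined by \<open>f\<close> has a second component. On \<open>A\<close> it
  is a character \<open>\<chi>\<close>, up to the normalization \<open>f(1, 1)\<close>; on the section it is a cochain \<open>c\<close> by which
  \<open>f\<close> and the transgression of \<open>\<chi>\<close> differ.\<close>

lemma transgress_onto:
  assumes f: "f \<in> carrier (two_cocycles G complex_units)"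
  obtains \<chi> c where "character \<chi>" "c \<in> carrier G \<rightarrow> carrier complex_units"
    "\<And>g h. g \<in> carrier G \<Longrightarrow> h \<in> carrier G \<Longrightarrow>
      c g * c h * f (g, h) = c (g \<otimes> h) * \<chi> (factor_set g h)"
proof -
  interpret X: cocycle_extension G f
    by (simp add: cocycle_extension_def cocycle_extension_axioms_def H.group_axioms f)
  obtain \<psi> where \<psi>: "\<psi> \<in> hom E (cocycle_ext G f)" and fst\<psi>: "\<And>e. e \<in> carrier E \<Longrightarrow> fst (\<psi> e) = \<pi> e"
    using lift[OF f] by blast
  define c where "c e = snd (\<psi> e)" for e
  have \<psi>_eq: "\<psi> e = (\<pi> e, c e)" if "e \<in> carrier E" for e
    using fst\<psi>[OF that] by (simp add: c_def prod_eq_iff)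
  have c0: "c e \<noteq> 0" if "e \<in> carrier E" for e
    using hom_in_carrier[OF \<psi> that] \<psi>_eq[OF that] by simp
  have mult: "c (d \<otimes>\<^bsub>E\<^esub> e) = c d * c e * f (\<pi> d, \<pi> e)" if "d \<in> carrier E" "e \<in> carrier E" for d e
    using Group.hom_mult[OF \<psi> that] that by (simp add: \<psi>_eq)
  define \<chi> where "\<chi> a = c a * f (\<one>, \<one>)" for a
  have right: "c (e \<otimes>\<^bsub>E\<^esub> a) = c e * \<chi> a" if "e \<in> carrier E" "a \<in> A" for e a
    using mult[OF that(1) A_carrier(1)[OF that(2)]] that A_carrier(2)[OF that(2)]
    using X.f_one_right[of "\<pi> e"] by (simp add: \<chi>_def)
  have "character \<chi>"
    unfolding character_def
  proof (intro conjI ballI)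
    show "\<chi> a \<noteq> 0" if "a \<in> A" for a
      using c0[OF A_carrier(1)[OF that]] X.f_nonzero by (simp add: \<chi>_def)
    show "\<chi> (a \<otimes>\<^bsub>E\<^esub> b) = \<chi> a * \<chi> b" if "a \<in> A" "b \<in> A" for a b
      using right[OF A_carrier(1)[OF that(1)] that(2)] by (simp add: \<chi>_def)
  qed
  moreover have "(\<lambda>g. c (s g)) \<in> carrier G \<rightarrow> carrier complex_units"
    using c0 s_section(1) by (auto simp: complex_units_def)
  moreover have "c (s g) * c (s h) * f (g, h) = c (s (g \<otimes> h)) * \<chi> (factor_set g h)"
    if "g \<in> carrier G" "h \<in> carrier G" for g h
    using mult[of "s g" "s h"] right[of "s (g \<otimes> h)" "factor_set g h"] that s_section factor_set[OF that]
    by simp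
  ultimately show thesis by (rule that)
qed

text \<open>The pairing turns an element of \<open>A\<close> into a character, and the isomorphism sends the element to the
  transgression of that character.\<close>

theorem kernel_iso_H2:
  fixes p :: nat
  assumes p: "Factorial_Ring.prime p" and pow: "\<And>a. a \<in> A \<Longrightarrow> a [^]\<^bsub>E\<^esub> p = \<one>\<^bsub>E\<^esub>" and fin: "finite A"
  shows "E\<lparr>carrier := A\<rparr> \<cong> H2 G complex_units"
proof -
  let ?A = "E\<lparr>carrier := A\<rparr>"
  let ?Z = "two_cocycles G complex_units" and ?B = "two_coboundaries G complex_units"
  interpret A: group ?A using G.subgroup_imp_group[OF subgroup_kernel] .
  interpret A: comm_group ?A
    by (rule A.group_comm_groupI) (use A_comm A_carrier(1) in auto)
  interpret Z: comm_group ?Z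
    by (rule comm_group_two_cocycles[OF H.group_axioms comm_group_complex_units])
  have "subgroup ?B ?Z"
    by (rule subgroup_two_coboundaries[OF H.group_axioms comm_group_complex_units])
  then interpret B: normal ?B ?Z by (rule Z.subgroup_imp_normal)
  have powA: "a [^]\<^bsub>?A\<^esub> n = a [^]\<^bsub>E\<^esub> n" for a and n :: nat
    by (simp add: nat_pow_def)
  obtain \<chi> :: "'e \<Rightarrow> 'e \<Rightarrow> complex" where \<chi>0: "\<And>a b. \<chi> a b \<noteq> 0"
    and \<chi>_left: "\<And>a b c. a \<in> A \<Longrightarrow> b \<in> A \<Longrightarrow> c \<in> A \<Longrightarrow> \<chi> (a \<otimes>\<^bsub>E\<^esub> b) c = \<chi> a c * \<chi> b c"
    and \<chi>_right: "\<And>a b c. a \<in> A \<Longrightarrow> b \<in> A \<Longrightarrow> c \<in> A \<Longrightarrow> \<chi> a (b \<otimes>\<^bsub>E\<^esub> c) = \<chi> a b * \<chi> a c"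
    and nondeg: "\<And>a. a \<in> A \<Longrightarrow> (\<And>b. b \<in> A \<Longrightarrow> \<chi> a b = 1) \<Longrightarrow> a = \<one>\<^bsub>E\<^esub>"
    and all: "\<And>\<psi>. \<psi> \<in> hom ?A complex_units \<Longrightarrow> \<exists>a\<in>A. \<forall>b\<in>A. \<psi> b = \<chi> a b"
    using A.elementary_abelian_pairing[OF p] pow fin by (simp add: powA) blast
  have char: "character (\<chi> a)" if "a \<in> A" for a
    using that \<chi>0 \<chi>_right by (simp add: character_def)
  define \<Phi> where "\<Phi> a = ?B #>\<^bsub>?Z\<^esub> transgress (\<chi> a)" for a
  have T: "transgress (\<chi> a) \<in> carrier ?Z" if "a \<in> A" for a
    using transgress_cocycle[OF char[OF that]] .
  have T_hom: "(\<lambda>a. transgress (\<chi> a)) \<in> hom ?A ?Z"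
  proof (rule homI)
    show "transgress (\<chi> (a \<otimes>\<^bsub>?A\<^esub> b)) = transgress (\<chi> a) \<otimes>\<^bsub>?Z\<^esub> transgress (\<chi> b)"
      if "a \<in> carrier ?A" "b \<in> carrier ?A" for a b
      using that \<chi>_left factor_set(1)
      by (auto simp: transgress_def two_cocycles_def complex_units_def restrict_def fun_eq_iff)
  qed (use T in auto)
  have \<Phi>_hom: "\<Phi> \<in> hom ?A (H2 G complex_units)"
    using Group.hom_compose[OF T_hom B.r_coset_hom_Mod] by (simp add: \<Phi>_def[abs_def] H2_def o_def)
  have H2: "group (H2 G complex_units)" unfolding H2_def by (rule B.factorgroup_is_group)
  have "inj_on \<Phi> (carrier ?A)"
  proof -
    interpret \<Phi>: group_hom ?A "H2 G complex_units" \<Phi>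
      by (simp add: group_hom_def group_hom_axioms_def A.group_axioms H2 \<Phi>_hom)
    have "a = \<one>\<^bsub>?A\<^esub>" if a: "a \<in> carrier ?A" "\<Phi> a = \<one>\<^bsub>H2 G complex_units\<^esub>" for a
    proof -
      have "?B #>\<^bsub>?Z\<^esub> transgress (\<chi> a) = ?B" using a(2) by (simp add: \<Phi>_def H2_def)
      then have "transgress (\<chi> a) \<in> ?B"
        using T a(1) Z.rcos_self[OF _ B.subgroup_axioms, of "transgress (\<chi> a)"] by simp
      then have "\<chi> a b = 1" if "b \<in> A" for b
        using transgress_trivial[OF char] a(1) that by simp
      then show ?thesis using nondeg a(1) by simp
    qed
    then show ?thesis using \<Phi>.inj_on_one_iff by blast
  qed
  moreover have "\<Phi> ` carrier ?A = carrier (H2 G complex_units)"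
  proof
    show "\<Phi> ` carrier ?A \<subseteq> carrier (H2 G complex_units)"
      using \<Phi>_hom by (auto simp: hom_def)
    show "carrier (H2 G complex_units) \<subseteq> \<Phi> ` carrier ?A"
    proof
      fix C assume "C \<in> carrier (H2 G complex_units)"
      then obtain f where f: "f \<in> carrier ?Z" and C: "C = ?B #>\<^bsub>?Z\<^esub> f"
        by (auto simp: H2_def carrier_FactGroup)
      obtain \<psi> c where \<psi>: "character \<psi>" and c: "c \<in> carrier G \<rightarrow> carrier complex_units"
        and eq: "\<And>g h. g \<in> carrier G \<Longrightarrow> h \<in> carrier G \<Longrightarrow>
          c g * c h * f (g, h) = c (g \<otimes> h) * \<psi> (factor_set g h)"
        using transgress_onto[OF f] by blast
      have "\<psi> \<in> hom ?A complex_units"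
        using \<psi> by (auto simp: character_def hom_def complex_units_def)
      then obtain a where a: "a \<in> A" "\<And>b. b \<in> A \<Longrightarrow> \<psi> b = \<chi> a b" using all by blast
      interpret C: comm_group complex_units by (rule comm_group_complex_units)
      have c0: "c g \<noteq> 0" if "g \<in> carrier G" for g using c that by (auto simp: complex_units_def)
      have inv_c: "inv\<^bsub>complex_units\<^esub> w = inverse w" if "w \<noteq> 0" for w
        by (rule C.inv_equality) (use that in \<open>simp_all add: complex_units_def\<close>)
      define b where "b = (\<lambda>(g, h)\<in>carrier G \<times> carrier G.
        c g \<otimes>\<^bsub>complex_units\<^esub> c h \<otimes>\<^bsub>complex_units\<^esub> inv\<^bsub>complex_units\<^esub> c (g \<otimes> h))"
      have b: "b \<in> ?B" using c by (auto simp: two_coboundaries_def b_def)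
      have "transgress (\<chi> a) (g, h) = b (g, h) * f (g, h)"
        if "g \<in> carrier G" "h \<in> carrier G" for g h
        using eq[OF that] that c0[of "g \<otimes> h"] a(2)[OF factor_set(1)[OF that]]
        by (simp add: transgress_def b_def inv_c) (simp add: complex_units_def field_simps)
      then have "transgress (\<chi> a) = b \<otimes>\<^bsub>?Z\<^esub> f"
        by (auto simp: two_cocycles_def complex_units_def fun_eq_iff transgress_def restrict_def)
      then have "transgress (\<chi> a) \<in> ?B #>\<^bsub>?Z\<^esub> f" using b by (auto simp: r_coset_def)
      then have "C = \<Phi> a"
        unfolding C \<Phi>_def using Z.repr_independence[OF _ f B.subgroup_axioms] by blast
      then show "C \<in> \<Phi> ` carrier ?A" using a(1) by auto
    qed
  qed
  ultimately have "\<Phi> \<in> iso ?A (H2 G complex_units)"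
    using \<Phi>_hom by (simp add: iso_def bij_betw_def)
  then show ?thesis by (auto simp: is_iso_def)
qed

end

section \<open>The presented group\<close>

definition star_word :: "nat \<Rightarrow> gen word \<Rightarrow> gen word set" where
  "star_word p = presented_class gens (relations p)"

interpretation star: presentation gens "relations p" for p
  by unfold_locales (rule relations_closed)

lemma group_G_star: "group (G_star p)"
  unfolding G_star_def by (rule star.group_presented)

lemma star_word_hom: "group_hom Fr (G_star p) (star_word p)"
  using star.presented_class_hom group_free_group group_G_star
  by (simp add: group_hom_def group_hom_axioms_def star_word_def G_star_def)

lemma star_word_relation: "(l, r) \<in> relations p \<Longrightarrow> star_word p l = star_word p r"
  unfolding star_word_def by (rule star.presented_class_relation)

lemma generate_G_star:
  "generate (G_star p) {star_word p (el_x 1), star_word p (el_x 2), star_word p (el_y 1), star_word p (el_y 2)} =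
     carrier (G_star p)"
  using star.generate_presented[of p] by (simp add: G_star_def star_word_def gens_def el_x_def el_y_def)

text \<open>The convention that unstated commutators vanish makes \<open>w\<^sub>j\<close>, \<open>u\<^sub>i\<close> and \<open>v\<^sub>i\<close> commute with the four
  generators, so these elements are central.\<close>

lemma heisenberg_cover_G_star:
  assumes "odd p"
  shows "heisenberg_cover (G_star p) p (\<lambda>i. star_word p (el_x i)) (\<lambda>i. star_word p (el_y i))"
proof -
  interpret F: group Fr by (rule group_free_group)
  interpret E: group "G_star p" by (rule group_G_star)
  interpret q: group_hom Fr "G_star p" "star_word p" by (rule star_word_hom)
  have closed: "star_word p (val n) \<in> carrier (G_star p)" if "n \<in> names" for n
    using Fr_closed(5)[OF that] by simp
  have unstated: "commutator (G_star p) (star_word p (val a)) (star_word p (val b)) = \<one>\<^bsub>G_star p\<^esub>"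
    if "a \<in> names" "b \<in> names" "(a, b) \<notin> stated_pairs" "(b, a) \<notin> stated_pairs" for a b
  proof -
    have "(comm (val a) (val b), \<one>\<^bsub>Fr\<^esub>) \<in> relations p"
      using that by (auto simp: relations_def)
    from star_word_relation[OF this] show ?thesis
      using that Fr_closed(5) by (simp add: q.hom_commutator)
  qed
  have xy: "star_word p (el_x i) \<in> carrier (G_star p)" "star_word p (el_y i) \<in> carrier (G_star p)"
    if "i \<in> {1, 2}" for i
    using that Fr_closed(1,2) by simp_all
  have central: "star_word p (val n) \<in> group_center (G_star p)"
    if "n \<in> Nw ` {1..4} \<union> Nu ` {1..2} \<union> Nv ` {1..2}" for n
  proof (rule E.central_if_commutes_with_generators[OF _ generate_G_star])
    have n: "n \<in> names" using that by (auto simp: names_def)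
    then show "star_word p (val n) \<in> carrier (G_star p)" by (rule closed)
    have *: "commutator (G_star p) (star_word p (val n)) (star_word p (val m)) = \<one>\<^bsub>G_star p\<^esub>"
      if "m \<in> {Nx 1, Nx 2, Ny 1, Ny 2}" for m
      by (rule unstated[OF n])
         (use that \<open>n \<in> Nw ` {1..4} \<union> Nu ` {1..2} \<union> Nv ` {1..2}\<close>
           in \<open>auto simp: names_def stated_pairs_def\<close>)
    show "commutator (G_star p) (star_word p (val n)) g = \<one>\<^bsub>G_star p\<^esub>"
      if "g \<in> {star_word p (el_x 1), star_word p (el_x 2), star_word p (el_y 1), star_word p (el_y 2)}" for g
      using that *[of "Nx 1"] *[of "Nx 2"] *[of "Ny 1"] *[of "Ny 2"] by auto
  qed (use xy in auto)
  have pow: "star_word p (el_x i) [^]\<^bsub>G_star p\<^esub> p = \<one>\<^bsub>G_star p\<^esub>"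
    "star_word p (el_y i) [^]\<^bsub>G_star p\<^esub> p = \<one>\<^bsub>G_star p\<^esub>"
    "star_word p (el_z i) [^]\<^bsub>G_star p\<^esub> p = \<one>\<^bsub>G_star p\<^esub>"
    if i: "i \<in> {1, 2}" for i
  proof -
    have "(el_x i [^]\<^bsub>Fr\<^esub> p, \<one>\<^bsub>Fr\<^esub>) \<in> relations p" "(el_y i [^]\<^bsub>Fr\<^esub> p, \<one>\<^bsub>Fr\<^esub>) \<in> relations p"
      "(el_z i [^]\<^bsub>Fr\<^esub> p, \<one>\<^bsub>Fr\<^esub>) \<in> relations p"
      using i by (auto simp: relations_def)
    from this[THEN star_word_relation] show
      "star_word p (el_x i) [^]\<^bsub>G_star p\<^esub> p = \<one>\<^bsub>G_star p\<^esub>"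
      "star_word p (el_y i) [^]\<^bsub>G_star p\<^esub> p = \<one>\<^bsub>G_star p\<^esub>"
      "star_word p (el_z i) [^]\<^bsub>G_star p\<^esub> p = \<one>\<^bsub>G_star p\<^esub>"
      using Fr_closed(1-3)[OF i] by (simp_all add: q.hom_nat_pow)
  qed
  have z: "star_word p (el_z i) = commutator (G_star p) (star_word p (el_y 1)) (star_word p (el_x i))"
    if "i \<in> {1, 2}" for i
    using that Fr_closed(1)[OF that] Fr_closed(2)[of 1] by (simp add: el_z_def q.hom_commutator)
  note Fr = Fr_closed(1)[of 1, simplified] Fr_closed(1)[of 2, simplified]
    Fr_closed(2)[of 1, simplified] Fr_closed(2)[of 2, simplified]
    Fr_closed(3)[of 1, simplified] Fr_closed(3)[of 2, simplified] Fr_closed(4)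
  have w: "star_word p (el_w j) \<in> group_center (G_star p)" if "j \<in> {1..4}" for j
    using central[of "Nw j"] that by simp
  have z1: "commutator (G_star p) (star_word p (el_z 1)) (star_word p (el_x i)) \<in> group_center (G_star p)"
    "commutator (G_star p) (star_word p (el_z 1)) (star_word p (el_y i)) \<in> group_center (G_star p)"
    if "i \<in> {1, 2}" for i
    using central[of "Nv i"] central[of "Nu i"] that Fr Fr_closed(1,2)[OF that]
    by (simp_all add: index_sets el_v_def el_u_def q.hom_commutator image_iff)
  have z2: "commutator (G_star p) (star_word p (el_z 2)) (star_word p (el_x i)) \<in> group_center (G_star p)"
    "commutator (G_star p) (star_word p (el_z 2)) (star_word p (el_y i)) \<in> group_center (G_star p)"
    if i: "i \<in> {1, 2}" for i
  proof -
    have "(comm (el_z 2) (el_x 1), comm (el_z 1) (el_x 2)) \<in> relations p"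
      "(comm (el_z 2) (el_y 1), comm (el_z 1) (el_y 2)) \<in> relations p"
      by (auto simp: relations_def)
    from this[THEN star_word_relation]
    have "commutator (G_star p) (star_word p (el_z 2)) (star_word p (el_x 1)) \<in> group_center (G_star p)"
      "commutator (G_star p) (star_word p (el_z 2)) (star_word p (el_y 1)) \<in> group_center (G_star p)"
      using z1[of 2] Fr by (simp_all add: q.hom_commutator)
    moreover have "commutator (G_star p) (star_word p (el_z 2)) (star_word p (el_x 2)) = \<one>\<^bsub>G_star p\<^esub>"
      "commutator (G_star p) (star_word p (el_z 2)) (star_word p (el_y 2)) = \<one>\<^bsub>G_star p\<^esub>"
      using unstated[of "Nz 2" "Nx 2"] unstated[of "Nz 2" "Ny 2"]
      by (simp_all add: names_def stated_pairs_def index_sets)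
    ultimately show
      "commutator (G_star p) (star_word p (el_z 2)) (star_word p (el_x i)) \<in> group_center (G_star p)"
      "commutator (G_star p) (star_word p (el_z 2)) (star_word p (el_y i)) \<in> group_center (G_star p)"
      using i E.one_in_group_center by auto
  qed
  show ?thesis
  proof
    show "commutator (G_star p) (star_word p (el_x 2)) (star_word p (el_x 1)) \<in> group_center (G_star p)"
      using w[of 1] Fr by (simp add: el_w_def q.hom_commutator)
    show "commutator (G_star p) (star_word p (el_y 2)) (star_word p (el_x 2)) \<in> group_center (G_star p)"
      using w[of 3] Fr by (simp add: el_w_def q.hom_commutator)
    show "commutator (G_star p) (star_word p (el_y 2)) (star_word p (el_y 1)) \<in> group_center (G_star p)"
      using w[of 4] Fr by (simp add: el_w_def q.hom_commutator)
    show "commutator (G_star p) (star_word p (el_y 2)) (star_word p (el_x 1)) \<otimes>\<^bsub>G_star p\<^esub>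
        inv\<^bsub>G_star p\<^esub> (commutator (G_star p) (star_word p (el_y 1)) (star_word p (el_x 2)))
        \<in> group_center (G_star p)"
      using w[of 2] Fr z[of 2] by (simp add: el_w_def q.hom_commutator)
    show "commutator (G_star p) (commutator (G_star p) (star_word p (el_y 1)) (star_word p (el_x i)))
        (star_word p (el_x j)) \<in> group_center (G_star p)"
      "commutator (G_star p) (commutator (G_star p) (star_word p (el_y 1)) (star_word p (el_x i)))
        (star_word p (el_y j)) \<in> group_center (G_star p)"
      if "i \<in> {1, 2}" "j \<in> {1, 2}" for i j
      using that z1[OF that(2)] z2[OF that(2)] by (auto simp flip: z)
    show "commutator (G_star p) (star_word p (el_y 1)) (star_word p (el_x i)) [^]\<^bsub>G_star p\<^esub> p
        \<in> group_center (G_star p)" if "i \<in> {1, 2}" for i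
      using pow(3)[OF that] E.one_in_group_center by (simp flip: z[OF that])
  qed (use assms xy pow generate_G_star in auto)
qed

lemma G_star_lift:
  assumes "heisenberg_lift H p x y"
  obtains \<psi> where "\<psi> \<in> hom (G_star p) H"
    "\<And>i. i \<in> {1, 2} \<Longrightarrow> \<psi> (star_word p (el_x i)) = x i"
    "\<And>i. i \<in> {1, 2} \<Longrightarrow> \<psi> (star_word p (el_y i)) = y i"
proof -
  interpret H: heisenberg_lift H p x y by fact
  obtain \<psi> where "\<psi> \<in> hom (presented_group gens (relations p)) H"
    and "\<And>w. w \<in> carrier Fr \<Longrightarrow> \<psi> (presented_class gens (relations p) w) = free_lift H (gen_val x y) w"
    using star.presented_lift[OF H.group_axioms H.gen_val_closed H.free_lift_relations] by blast
  then show thesis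
    using that[of \<psi>] Fr_closed H.free_lift_names by (simp add: G_star_def star_word_def)
qed

lemma hom_eq_on_generators:
  assumes h: "group_hom G H h" and k: "group_hom G H k" and S: "S \<subseteq> carrier G"
    and gen: "generate G S = carrier G" and eq: "\<And>s. s \<in> S \<Longrightarrow> h s = k s" and g: "g \<in> carrier G"
  shows "h g = k g"
proof -
  interpret h: group_hom G H h by fact
  interpret k: group_hom G H k by fact
  from g[folded gen] show ?thesis
  proof (induction rule: generate.induct)
    case (inv s)
    then show ?case using eq[OF inv] S by (auto simp: h.hom_inv k.hom_inv subset_iff)
  next
    case (eng a b)
    then show ?case using gen by auto
  qed (use eq in auto)
qed

text \<open>Every element that has to be central maps to the identity matrix, so it lies in the kernel of
  \<open>h\<close>, which is central.\<close>

lemma (in dual_ring) heisenberg_lift_over: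
  assumes h: "group_hom E HG h" and kernel: "kernel E HG h \<subseteq> group_center E" and p: "odd p"
    and x: "\<And>i. i \<in> {1, 2} \<Longrightarrow> x i \<in> carrier E \<and> h (x i) = hx i \<and> x i [^]\<^bsub>E\<^esub> p = \<one>\<^bsub>E\<^esub>"
    and y: "\<And>i. i \<in> {1, 2} \<Longrightarrow> y i \<in> carrier E \<and> h (y i) = hy i \<and> y i [^]\<^bsub>E\<^esub> p = \<one>\<^bsub>E\<^esub>"
  shows "heisenberg_lift E p x y"
proof -
  interpret h: group_hom E HG h by fact
  have central: "e \<in> group_center E" if "e \<in> carrier E" "h e = \<one>\<^bsub>HG\<^esub>" for e
    using that kernel by (auto simp: kernel_def)
  note xy = x[of 1, simplified] x[of 2, simplified] y[of 1, simplified] y[of 2, simplified]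
  note calc = h.hom_commutator hx_def hy_def heis_commutator heis_one minus_eq
  have z: "h (commutator E (y 1) (x i)) = heis R \<zero> \<zero> (\<ominus> (if i = 1 then \<one> else t))"
    if "i \<in> {1, 2}" for i
    using x[OF that] xy by (simp add: h.hom_commutator hz)
  show ?thesis
  proof
    show "commutator E (x 2) (x 1) \<in> group_center E" by (rule central) (use xy in \<open>simp_all add: calc\<close>)
    show "commutator E (y 2) (x 2) \<in> group_center E" by (rule central) (use xy in \<open>simp_all add: calc\<close>)
    show "commutator E (y 2) (y 1) \<in> group_center E" by (rule central) (use xy in \<open>simp_all add: calc\<close>)
    have "h (commutator E (y 2) (x 1)) = h (commutator E (y 1) (x 2))"
      using xy by (simp add: calc)
    then show "commutator E (y 2) (x 1) \<otimes>\<^bsub>E\<^esub> inv\<^bsub>E\<^esub> (commutator E (y 1) (x 2)) \<in> group_center E"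
      by (intro central) (use xy in simp_all)
    show "commutator E (commutator E (y 1) (x i)) (x j) \<in> group_center E"
      "commutator E (commutator E (y 1) (x i)) (y j) \<in> group_center E"
      if "i \<in> {1, 2}" "j \<in> {1, 2}" for i j
    proof -
      have c: "commutator E (y 1) (x i) \<in> carrier E" "x j \<in> carrier E" "y j \<in> carrier E"
        using xy x[OF that(1)] x[OF that(2)] y[OF that(2)] by simp_all
      have "h (commutator E (commutator E (y 1) (x i)) (x j)) = \<one>\<^bsub>HG\<^esub>"
        "h (commutator E (commutator E (y 1) (x i)) (y j)) = \<one>\<^bsub>HG\<^esub>"
        using c x[OF that(2)] y[OF that(2)]
        by (simp_all add: h.hom_commutator[OF c(1)] z[OF that(1)])
           (simp_all add: calc)
      then show "commutator E (commutator E (y 1) (x i)) (x j) \<in> group_center E"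
        "commutator E (commutator E (y 1) (x i)) (y j) \<in> group_center E"
        using c by (auto intro!: central)
    qed
    show "commutator E (y 1) (x i) [^]\<^bsub>E\<^esub> p \<in> group_center E" if "i \<in> {1, 2}" for i
    proof (rule central)
      show c: "commutator E (y 1) (x i) [^]\<^bsub>E\<^esub> p \<in> carrier E" using xy x[OF that] by simp
      show "h (commutator E (y 1) (x i) [^]\<^bsub>E\<^esub> p) = \<one>\<^bsub>HG\<^esub>"
        using xy x[OF that]
        by (simp add: h.hom_nat_pow z[OF that] heis_pow characteristic' heis_one)
    qed
  qed (use p x y in auto)
qed

theorem theorem1p3:
  fixes p :: nat
  assumes "Factorial_Ring.prime p" and "odd p"
  shows "is_representation_group (G_star p) (heisenberg_group (dual_numbers (residue_ring (int p))))"
proof -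
  let ?R = "dual_numbers (residue_ring (int p))"
  let ?E = "G_star p" and ?H = "heisenberg_group ?R"
  let ?x = "\<lambda>i. star_word p (el_x i)" and ?y = "\<lambda>i. star_word p (el_y i)"
  obtain t where "dual_ring ?R t p" using dual_ring_dual_numbers[OF assms(1)] by blast
  then interpret R: dual_ring ?R t p .
  interpret cover: heisenberg_cover ?E p ?x ?y by (rule heisenberg_cover_G_star[OF assms(2)])
  obtain \<pi> where \<pi>: "\<pi> \<in> hom ?E ?H" "\<And>i. i \<in> {1, 2} \<Longrightarrow> \<pi> (?x i) = R.hx i"
    "\<And>i. i \<in> {1, 2} \<Longrightarrow> \<pi> (?y i) = R.hy i"
    using G_star_lift[OF R.heisenberg_lift_HG[OF assms(2)]] by blast
  interpret P: heisenberg_projection ?E p ?x ?y ?R t \<pi>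
    by unfold_locales (use \<pi> in auto)
  have lift: "\<exists>\<psi>\<in>hom ?E (cocycle_ext ?H f). \<forall>e\<in>carrier ?E. fst (\<psi> e) = \<pi> e"
    if f: "f \<in> carrier (two_cocycles ?H complex_units)" for f
  proof -
    interpret X: cocycle_extension ?H f
      by (simp add: cocycle_extension_def cocycle_extension_axioms_def R.group_HG f)
    define r where
      "r g = (SOME a. (g, a) \<in> carrier X.ext \<and> (g, a) [^]\<^bsub>X.ext\<^esub> p = \<one>\<^bsub>X.ext\<^esub>)" for g
    have r: "(g, r g) \<in> carrier X.ext \<and> (g, r g) [^]\<^bsub>X.ext\<^esub> p = \<one>\<^bsub>X.ext\<^esub>"
      if g: "g \<in> carrier ?H" "g [^]\<^bsub>?H\<^esub> p = \<one>\<^bsub>?H\<^esub>" for g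
    proof -
      obtain a where "(g, a) \<in> carrier X.ext" "(g, a) [^]\<^bsub>X.ext\<^esub> p = \<one>\<^bsub>X.ext\<^esub>"
        by (rule X.lift_order[OF g cover.p_pos])
      then have "\<exists>a. (g, a) \<in> carrier X.ext \<and> (g, a) [^]\<^bsub>X.ext\<^esub> p = \<one>\<^bsub>X.ext\<^esub>"
        by (intro exI[of _ a] conjI)
      then show ?thesis unfolding r_def by (rule someI_ex)
    qed
    interpret L: heisenberg_lift ?H p R.hx R.hy by (rule R.heisenberg_lift_HG[OF assms(2)])
    \<comment> \<open>The hypotheses of \<open>G_star_lift\<close> are met in the extension, so the presented group maps to it.\<close>
    have "heisenberg_lift X.ext p (\<lambda>i. (R.hx i, r (R.hx i))) (\<lambda>i. (R.hy i, r (R.hy i)))"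
    proof (rule R.heisenberg_lift_over[OF X.ext.group_hom_axioms X.kernel_central assms(2)])
      show "(R.hx i, r (R.hx i)) \<in> carrier X.ext \<and> fst (R.hx i, r (R.hx i)) = R.hx i \<and>
          (R.hx i, r (R.hx i)) [^]\<^bsub>X.ext\<^esub> p = \<one>\<^bsub>X.ext\<^esub>" if "i \<in> {1, 2}" for i
        using r[OF L.x_closed[OF that] L.x_pow[OF that]] by simp
      show "(R.hy i, r (R.hy i)) \<in> carrier X.ext \<and> fst (R.hy i, r (R.hy i)) = R.hy i \<and>
          (R.hy i, r (R.hy i)) [^]\<^bsub>X.ext\<^esub> p = \<one>\<^bsub>X.ext\<^esub>" if "i \<in> {1, 2}" for i
        using r[OF L.y_closed[OF that] L.y_pow[OF that]] by simp
    qed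
    then obtain \<psi> where \<psi>: "\<psi> \<in> hom ?E X.ext"
      "\<And>i. i \<in> {1, 2} \<Longrightarrow> \<psi> (?x i) = (R.hx i, r (R.hx i))"
      "\<And>i. i \<in> {1, 2} \<Longrightarrow> \<psi> (?y i) = (R.hy i, r (R.hy i))"
      using G_star_lift by blast
    have "group_hom ?E ?H (fst \<circ> \<psi>)"
      using hom_compose[OF \<psi>(1) X.fst_hom]
      by (simp add: group_hom_def group_hom_axioms_def cover.group_axioms R.group_HG)
    then have "(fst \<circ> \<psi>) e = \<pi> e" if "e \<in> carrier ?E" for e
      by (rule hom_eq_on_generators[OF _ P.pi.group_hom_axioms _ cover.generate_xy _ that])
         (use \<psi>(2,3) in auto)
    then show ?thesis using \<psi>(1) by auto
  qed
  interpret C: central_cover ?E ?H \<pi>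
    by unfold_locales
       (use P.pi_surj P.pi_kernel cover.central_part_central cover.central_part_derived lift in auto)
  let ?A = "kernel ?E ?H \<pi>"
  have "?E\<lparr>carrier := ?A\<rparr> \<cong> H2 ?H complex_units"
  proof (rule C.kernel_iso_H2[OF assms(1)])
    show "a [^]\<^bsub>?E\<^esub> p = \<one>\<^bsub>?E\<^esub>" if "a \<in> ?A" for a
      using that P.pi_kernel cover.central_part_pow by auto
    show "finite ?A"
      using cover.normal_form(1) by (rule rev_finite_subset) (auto simp: kernel_def)
  qed
  moreover have "?E Mod ?A \<cong> ?H" by (rule P.pi.FactGroup_iso[OF P.pi_surj])
  ultimately show ?thesis
    unfolding is_representation_group_def
    using R.group_HG P.finite_HG cover.group_axioms cover.normal_form(1)
      P.pi.subgroup_kernel C.kernel_center C.kernel_derived by blast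
qed

end
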